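(* Let $X_1,\dots,X_n$ be i.i.d. from a distribution $R_0\in\mathcal{R}$ such that the support of $R_0$ is $\mathbb{X}$. Let $\mathcal{P}$ be an exponential family on $\mathbb{X}$ with complete sufficient (canonical) statistic $T$ such that $\mu(R_0)\in\mu(\mathcal{P})$. If $\widehat{\mathbf{P}}$ is the MLE or an extended MLE that exists a.e., then $\widehat{\mathbf{P}}$ is distribution unbiased for $\Pi R_0$, and it is the unique uniformly minimum distribution variance estimator among all $\mathcal{R}$-valued estimators $\mathbf{R}$ that are distribution unbiased for $\Pi R_0$ and for which the extended projection $\overline{\Pi}\mathbf{R}$ exists a.e. That is, for every such $\mathbf{R}$ one has $V^{\dagger}\widehat{\mathbf{P}}\le V^{\dagger}\mathbf{R}$ for every admissible $R_0$, and any such $\mathbf{R}$ that also attains the minimum for every admissible $R_0$ equals $\widehat{\mathbf{P}}$ a.e.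
   Context: $(\mathbb{X},\mathscr{X})$ is a sample space with a $\sigma$-finite measure $\lambda$ (usually counting measure when $\mathbb{X}$ is finite or countable, and Lebesgue measure when $\mathbb{X}\subset\mathbb{R}^d$ contains an open set). $\mathcal{R}$ is the set of all probability measures on $(\mathbb{X},\mathscr{X})$ absolutely continuous with respect to $\lambda$; lower case letters denote densities with respect to $\lambda$; "support $\mathbb{X}$" means the density is positive $\lambda$-a.e. Expectations $E$ are under i.i.d. sampling from $R_0$. An $\mathcal{R}$-valued random variable (estimator) $\mathbf{R}$ is a map $\mathbf{x}\mapsto\mathbf{R}_{\mathbf{x}}$ from $\mathbb{X}^n$ to $\mathcal{R}$ (not depending on $R_0$) evaluated at $(X_1,\dots,X_n)$, such that $\mathbf{R}(A)$ is a real-valued random variable for each $A\in\mathscr{X}$; its density $\mathbf{r}_{\mathbf{x}}(y)$ is taken jointly measurable. $D(R_1,R_2)=E_{R_1}\log(r_1/r_2)\in[0,\infty]$ is the KL divergence. The KL mean $E\mathbf{R}\in\mathcal{R}$ is the distribution $A\mapsto E[\mathbf{R}(A)]$. $\mathcal{P}\subset\mathcal{R}$ is an exponential family on $\mathbb{X}$ if there exist $P_0\in\mathcal{R}$ with support $\mathbb{X}$ and a function $T:\mathbb{X}\to\mathbb{R}^d$ (the canonical statistic) such that every $P\in\mathcal{P}$ satisfies $dP\propto e^{\theta'T(x)}dP_0$ for some $\theta\in\mathbb{R}^d$. Write $\mu(R)=E_RT$ and $M=\mu(\mathcal{P})=\{E_PT:P\in\mathcal{P}\}$; $\mu$ parameterizes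 $\mathcal{P}$, and $P(\cdot\,;\tau)$ is the member of $\mathcal{P}$ with mean $\tau\in M$. For the sample, the (complete sufficient) statistic, also written $T$, is $n^{-1}\sum_{i=1}^nT(X_i)$, with observed value $t$. $T$ is complete for $\mathcal{P}$ if $E_Ph(T)=0$ for all $P\in\mathcal{P}$ implies $h(T)=0$ a.e. $\mathcal{P}$. MLE and extended MLE: when $t\in M$ the maximum likelihood estimate is $P(\cdot\,;t)$. The extended MLE is the distribution estimator equal to $P(\cdot\,;t)$ if $t\in M$ and to $\bar P(\cdot\,;t)$ if $t\notin M$, where $\bar P(\cdot\,;t)\in\mathcal{R}$ is a distribution with $\mu(\bar P(\cdot\,;t))=t$ and $\inf_{P\in\mathcal{P}}D(\bar P(\cdot\,;t),P)=0$. KL projection: $\Pi R=\arg\min_{P\in\mathcal{P}}D(R,P)$. An extended projection $\overline{\Pi}R$ of $R\in\mathcal{R}$ is any distribution in $\mathcal{R}$ such that $\mu(R)=\mu(\overline{\Pi}R)$; $D(R,P)=D(R,\overline{\Pi}R)+D(\overline{\Pi}R,P)$ for all $P\in\mathcal{P}$; and $\inf_{P\in\mathcal{P}}D(\overline{\Pi}R,P)=0$. Distribution variance: $V^{\dagger}\mathbf{R}=\inf_{P\in\mathcal{P}}E[D(\mathbf{R},P)]$. Distribution mean: $E^{\dagger}\mathbf{R}=\arg\min_{P\in\mathcal{P}}E[D(\mathbf{R},P)]=\Pi E\mathbf{R}$. $\mathbf{R}$ is distribution unbiased for $\Pi R_0$ if $E^{\dagger}\mathbf{R}=\Pi R_0$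 for every admissible $R_0$. Admissible $R_0$: those $R_0\in\mathcal{R}$ with support $\mathbb{X}$, $\mu(R_0)\in\mu(\mathcal{P})$, and such that the quantities in the expressions ($\Pi R_0$, the distribution means and distribution variances of the estimators under consideration, and $\mu(E\mathbf{R})\in\mu(\mathcal{P})$) exist and are finite.
   Formalization: Unbiasedness of R also requires E†R to exist and μ(ER) ∈ μ(P) at each R0 that is otherwise admissible (not a filter on R0), and uniqueness assumes at least one R0 is admissible for both estimators; without these the claim fails. *)

theory Defs
  imports "HOL-Probability.Probability"
begin

text \<open>
  Throughout, \<open>lam\<close> is the dominating measure on the sample space \<open>space lam\<close>, \<open>T\<close> the canonical
  statistic of one observation, \<open>\<P>\<close> the family, and a sample of size \<open>n\<close> is a point of the
  product space over the index set \<open>{..<n}\<close>.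
\<close>

definition dominated :: "'a measure \<Rightarrow> 'a measure set" where
  "dominated lam = {R. prob_space R \<and> sets R = sets lam \<and> absolutely_continuous lam R}"

definition full_support :: "'a measure \<Rightarrow> 'a measure \<Rightarrow> bool" where
  "full_support lam R \<longleftrightarrow> (AE x in lam. RN_deriv lam R x > 0)"

abbreviation iid :: "nat \<Rightarrow> 'a measure \<Rightarrow> (nat \<Rightarrow> 'a) measure" where
  "iid n R \<equiv> Pi\<^sub>M {..<n} (\<lambda>_. R)"

text \<open>
  \<open>KL R1 R2\<close> is \<open>E\<^bsub>R1\<^esub> log (r1 / r2)\<close> with values in \<open>[0, \<infinity>]\<close>. The library's real-valued
  \<open>KL_divergence b M N\<close> is the expectation under its second measure \<open>N\<close>, hence the swapped
  arguments. The negative part of \<open>log (r1 / r2)\<close> is always \<open>R1\<close>-integrable, so the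
  divergence is infinite exactly when absolute continuity or integrability fails.
\<close>
definition KL :: "'a measure \<Rightarrow> 'a measure \<Rightarrow> ennreal" where
  "KL R1 R2 =
    (if absolutely_continuous R2 R1 \<and> integrable R1 (entropy_density (exp 1) R2 R1)
     then ennreal (KL_divergence (exp 1) R2 R1) else \<infinity>)"

definition mean :: "('a \<Rightarrow> 'b::euclidean_space) \<Rightarrow> 'a measure \<Rightarrow> 'b" where
  "mean T R = (\<integral>x. T x \<partial>R)"

definition exponential_family ::
  "'a measure \<Rightarrow> ('a \<Rightarrow> 'b::euclidean_space) \<Rightarrow> 'a measure set \<Rightarrow> bool" where
  "exponential_family lam T \<P> \<longleftrightarrow>
    T \<in> borel_measurable lam \<and> \<P> \<subseteq> dominated lam \<and>
    (\<exists>P0\<in>dominated lam. full_support lam P0 \<and>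
      (\<forall>P\<in>\<P>. \<exists>\<theta> c. 0 < c \<and> P = density P0 (\<lambda>x. ennreal (c * exp (\<theta> \<bullet> T x)))))"

definition has_mean_in :: "('a \<Rightarrow> 'b::euclidean_space) \<Rightarrow> 'a measure set \<Rightarrow> 'a measure \<Rightarrow> bool" where
  "has_mean_in T \<P> R \<longleftrightarrow> integrable R T \<and> mean T R \<in> mean T ` \<P>"

text \<open>
  \<open>P(\<cdot> ; \<tau>)\<close>: within an exponential family whose members all have a mean, the mean determines
  the member, so the description is proper for every \<open>\<tau> \<in> mean T ` \<P>\<close>.
\<close>
definition member_with_mean ::
  "('a \<Rightarrow> 'b::euclidean_space) \<Rightarrow> 'a measure set \<Rightarrow> 'b \<Rightarrow> 'a measure" where
  "member_with_mean T \<P> \<tau> = (THE P. P \<in> \<P> \<and> mean T P = \<tau>)"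

definition sample_stat :: "nat \<Rightarrow> ('a \<Rightarrow> 'b::euclidean_space) \<Rightarrow> (nat \<Rightarrow> 'a) \<Rightarrow> 'b" where
  "sample_stat n T x = (1 / real n) *\<^sub>R (\<Sum>i<n. T (x i))"

definition complete_statistic ::
  "nat \<Rightarrow> ('a \<Rightarrow> 'b::euclidean_space) \<Rightarrow> 'a measure set \<Rightarrow> bool" where
  "complete_statistic n T \<P> \<longleftrightarrow>
    (\<forall>h :: 'b \<Rightarrow> real. h \<in> borel_measurable borel \<longrightarrow>
      (\<forall>P\<in>\<P>. integrable (iid n P) (\<lambda>x. h (sample_stat n T x)) \<and>
              (\<integral>x. h (sample_stat n T x) \<partial>iid n P) = 0) \<longrightarrow>
      (\<forall>P\<in>\<P>. AE x in iid n P. h (sample_stat n T x) = 0))"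

definition estimator ::
  "nat \<Rightarrow> 'a measure \<Rightarrow> ((nat \<Rightarrow> 'a) \<Rightarrow> 'a measure) \<Rightarrow> bool" where
  "estimator n lam R \<longleftrightarrow>
    (\<forall>x\<in>space (iid n lam). R x \<in> dominated lam) \<and>
    (\<forall>A\<in>sets lam. (\<lambda>x. measure (R x) A) \<in> borel_measurable (iid n lam)) \<and>
    (\<exists>r :: (nat \<Rightarrow> 'a) \<Rightarrow> 'a \<Rightarrow> ennreal.
      case_prod r \<in> borel_measurable (iid n lam \<Otimes>\<^sub>M lam) \<and>
      (\<forall>x\<in>space (iid n lam). R x = density lam (r x)))"

text \<open>
  ``Almost everywhere'' on the sample space refers to the product of \<open>lam\<close>, which has the same
  null sets as \<open>iid n R0\<close> for every \<open>R0\<close> with full support.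
\<close>
definition is_MLE ::
  "nat \<Rightarrow> 'a measure \<Rightarrow> ('a \<Rightarrow> 'b::euclidean_space) \<Rightarrow> 'a measure set \<Rightarrow>
   ((nat \<Rightarrow> 'a) \<Rightarrow> 'a measure) \<Rightarrow> bool" where
  "is_MLE n lam T \<P> Phat \<longleftrightarrow>
    estimator n lam Phat \<and>
    (AE x in iid n lam.
      sample_stat n T x \<in> mean T ` \<P> \<and>
      Phat x = member_with_mean T \<P> (sample_stat n T x))"

definition boundary_member ::
  "'a measure \<Rightarrow> ('a \<Rightarrow> 'b::euclidean_space) \<Rightarrow> 'a measure set \<Rightarrow> 'b \<Rightarrow> 'a measure \<Rightarrow> bool" where
  "boundary_member lam T \<P> \<tau> Q \<longleftrightarrow>
    Q \<in> dominated lam \<and> integrable Q T \<and> mean T Q = \<tau> \<and> (INF P\<in>\<P>. KL Q P) = 0"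

definition is_extended_MLE ::
  "nat \<Rightarrow> 'a measure \<Rightarrow> ('a \<Rightarrow> 'b::euclidean_space) \<Rightarrow> 'a measure set \<Rightarrow>
   ((nat \<Rightarrow> 'a) \<Rightarrow> 'a measure) \<Rightarrow> bool" where
  "is_extended_MLE n lam T \<P> Phat \<longleftrightarrow>
    estimator n lam Phat \<and>
    (AE x in iid n lam.
      (if sample_stat n T x \<in> mean T ` \<P>
       then Phat x = member_with_mean T \<P> (sample_stat n T x)
       else boundary_member lam T \<P> (sample_stat n T x) (Phat x)))"

text \<open>
  The existence predicates below say that the corresponding arg min is attained at exactly one
  member of the family, with finite value; \<open>arg_min\<close> is then that member.
\<close>
definition KL_proj :: "'a measure set \<Rightarrow> 'a measure \<Rightarrow> 'a measure" where
  "KL_proj \<P> R = arg_min (\<lambda>P. KL R P) (\<lambda>P. P \<in> \<P>)"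

definition KL_proj_exists :: "'a measure set \<Rightarrow> 'a measure \<Rightarrow> bool" where
  "KL_proj_exists \<P> R \<longleftrightarrow>
    (\<exists>!Q. is_arg_min (\<lambda>P. KL R P) (\<lambda>P. P \<in> \<P>) Q) \<and> KL R (KL_proj \<P> R) < \<infinity>"

definition extended_proj ::
  "'a measure \<Rightarrow> ('a \<Rightarrow> 'b::euclidean_space) \<Rightarrow> 'a measure set \<Rightarrow> 'a measure \<Rightarrow> 'a measure \<Rightarrow> bool" where
  "extended_proj lam T \<P> R Q \<longleftrightarrow>
    Q \<in> dominated lam \<and> integrable R T \<and> integrable Q T \<and> mean T R = mean T Q \<and>
    (\<forall>P\<in>\<P>. KL R P = KL R Q + KL Q P) \<and> (INF P\<in>\<P>. KL Q P) = 0"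

definition extended_proj_exists_ae ::
  "nat \<Rightarrow> 'a measure \<Rightarrow> ('a \<Rightarrow> 'b::euclidean_space) \<Rightarrow> 'a measure set \<Rightarrow>
   ((nat \<Rightarrow> 'a) \<Rightarrow> 'a measure) \<Rightarrow> bool" where
  "extended_proj_exists_ae n lam T \<P> R \<longleftrightarrow>
    (AE x in iid n lam. \<exists>Q. extended_proj lam T \<P> (R x) Q)"

definition KL_mean ::
  "nat \<Rightarrow> 'a measure \<Rightarrow> ((nat \<Rightarrow> 'a) \<Rightarrow> 'a measure) \<Rightarrow> 'a measure" where
  "KL_mean n R0 R = iid n R0 \<bind> R"

definition expected_KL ::
  "nat \<Rightarrow> 'a measure \<Rightarrow> ((nat \<Rightarrow> 'a) \<Rightarrow> 'a measure) \<Rightarrow> 'a measure \<Rightarrow> ennreal" where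
  "expected_KL n R0 R P = (\<integral>\<^sup>+x. KL (R x) P \<partial>iid n R0)"

definition dist_variance ::
  "nat \<Rightarrow> 'a measure set \<Rightarrow> 'a measure \<Rightarrow> ((nat \<Rightarrow> 'a) \<Rightarrow> 'a measure) \<Rightarrow> ennreal" where
  "dist_variance n \<P> R0 R = (INF P\<in>\<P>. expected_KL n R0 R P)"

definition dist_mean ::
  "nat \<Rightarrow> 'a measure set \<Rightarrow> 'a measure \<Rightarrow> ((nat \<Rightarrow> 'a) \<Rightarrow> 'a measure) \<Rightarrow> 'a measure" where
  "dist_mean n \<P> R0 R = arg_min (expected_KL n R0 R) (\<lambda>P. P \<in> \<P>)"

definition dist_mean_exists ::
  "nat \<Rightarrow> ('a \<Rightarrow> 'b::euclidean_space) \<Rightarrow> 'a measure set \<Rightarrow> 'a measure \<Rightarrow>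
   ((nat \<Rightarrow> 'a) \<Rightarrow> 'a measure) \<Rightarrow> bool" where
  "dist_mean_exists n T \<P> R0 R \<longleftrightarrow>
    (\<exists>!Q. is_arg_min (expected_KL n R0 R) (\<lambda>P. P \<in> \<P>) Q) \<and>
    expected_KL n R0 R (dist_mean n \<P> R0 R) < \<infinity> \<and>
    has_mean_in T \<P> (KL_mean n R0 R)"

text \<open>
  The admissible sampling distributions for a set \<open>Es\<close> of estimators. Only finiteness of the
  distribution variance and existence of the mean of \<open>T\<close> under the KL mean select \<open>R0\<close>; that the
  distribution mean exists, with the mean of the KL mean in \<open>mean T ` \<P>\<close>, is asserted by
  unbiasedness. Otherwise an estimator of a family with isolated means could be called unbiased
  merely because the \<open>R0\<close> at which it is biased are discarded.
\<close>
definition admissible ::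
  "nat \<Rightarrow> 'a measure \<Rightarrow> ('a \<Rightarrow> 'b::euclidean_space) \<Rightarrow> 'a measure set \<Rightarrow>
   ((nat \<Rightarrow> 'a) \<Rightarrow> 'a measure) set \<Rightarrow> 'a measure set" where
  "admissible n lam T \<P> Es =
    {R0 \<in> dominated lam. full_support lam R0 \<and> has_mean_in T \<P> R0 \<and> KL_proj_exists \<P> R0 \<and>
      (\<forall>R\<in>Es. dist_variance n \<P> R0 R < \<infinity> \<and> integrable (KL_mean n R0 R) T)}"

definition dist_unbiased ::
  "nat \<Rightarrow> ('a \<Rightarrow> 'b::euclidean_space) \<Rightarrow> 'a measure set \<Rightarrow> 'a measure set \<Rightarrow>
   ((nat \<Rightarrow> 'a) \<Rightarrow> 'a measure) \<Rightarrow> bool" where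
  "dist_unbiased n T \<P> \<A> R \<longleftrightarrow>
    (\<forall>R0\<in>\<A>. dist_mean_exists n T \<P> R0 R \<and> dist_mean n \<P> R0 R = KL_proj \<P> R0)"

end

theory Submission
  imports Defs
begin

text \<open>
  Write \<open>t\<close> for the sample statistic, \<open>\<mu>\<close> for the mean of \<open>T\<close> under the estimate \<open>R\<^sub>x\<close>, and
  \<open>\<delta> = \<mu> - t\<close>. Unbiasedness says that \<open>F u = \<integral> \<delta> x * (\<Prod>i<n. u (x i))\<close>, taken under \<open>R0\<close>,
  vanishes whenever \<open>u\<close> is a density bounded above and away from zero whose mean lies in
  \<open>mean T ` \<P>\<close>; a member of \<open>\<P>\<close> itself need not be admissible. As \<open>F\<close> is a polynomial of degree
  \<open>n\<close>, it then vanishes on every bounded density with such a mean. Along an affine section of the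
  mean map it becomes a polynomial of degree at most \<open>n\<close> on the space of means; completeness
  extends its zeros from \<open>mean T ` \<P>\<close> to the means of boundary members, hence to almost every value
  of \<open>t\<close>. The averages of \<open>n\<close> points of the support of \<open>T\<close> are unisolvent for degree \<open>n\<close>, so \<open>F\<close>
  vanishes on all bounded densities, and \<open>\<delta>\<close> is orthogonal to all events determined by \<open>t\<close>.

  If \<open>P\<close> is the projection of \<open>R0\<close> and \<open>P'\<close> is any member of \<open>\<P>\<close>, then \<open>KL R\<^sub>x P - KL R\<^sub>x P'\<close> is an
  affine function of \<open>\<mu>\<close>. Choosing \<open>P'\<close> as a function of \<open>t\<close> close to the maximum likelihood
  estimate, orthogonality turns this into a Pythagorean identity: the expected divergence of \<open>R\<close>
  from \<open>P\<close> is that of the estimate plus the limit of the expected divergences of \<open>R\<close> from \<open>P'\<close>.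
\<close>

section \<open>Polynomial maps of bounded degree\<close>

text \<open>A density bounded above and away from zero changes the law of the sample only by a
  bounded factor, so finiteness at \<open>R0\<close> survives such tilts. Nothing carries it over to
  members of \<open>\<P>\<close>; hence completeness cannot be applied directly to the mean of
  \<open>R\<close>. Moreover the tilts must keep their mean among the means of \<open>\<P>\<close>,
  a set that may have empty interior or isolated points, so the mean cannot be varied freely. The
  way out is that the degree of \<open>F\<close> equals the sample size. A product of
  \<open>n\<close> linear forms in \<open>(1, T)\<close>, one for each observation, has the
  corresponding polynomial in the mean as its expectation under every i.i.d. law. Completeness
  therefore acts on this product instead of on \<open>R\<close>. Conversely, averages of
  \<open>n\<close> points reach all the grid points on which a polynomial of degree \<open>n\<close>
  must be tested. A second obstacle is that an extended estimate may lie outside \<open>\<P>\<close>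
  and is only approached in divergence. Comparison members are thus taken from a countable dense
  subfamily and a limit is formed. Since the divergence obeys no triangle inequality, uniqueness
  goes through the Hellinger distance.\<close>

inductive poly_map :: "nat \<Rightarrow> ('e::euclidean_space \<Rightarrow> real) \<Rightarrow> bool" where
  const: "poly_map m (\<lambda>x. c)"
| add: "poly_map m f \<Longrightarrow> poly_map m g \<Longrightarrow> poly_map m (\<lambda>x. f x + g x)"
| mult: "poly_map m f \<Longrightarrow> poly_map (Suc m) (\<lambda>x. (x \<bullet> b) * f x)"

lemma poly_map_Suc: "poly_map m f \<Longrightarrow> poly_map (Suc m) f"
  by (induction rule: poly_map.induct) (auto intro: poly_map.intros)

lemma poly_map_cmult: "poly_map m f \<Longrightarrow> poly_map m (\<lambda>x. c * f x)"
proof (induction rule: poly_map.induct)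
  case (mult m f b)
  then show ?case using poly_map.mult[OF mult.IH, of b] by (simp add: mult.left_commute)
qed (auto simp: distrib_left intro: poly_map.intros)

lemma poly_map_sum:
  "(\<And>i. i \<in> I \<Longrightarrow> poly_map m (f i)) \<Longrightarrow> poly_map m (\<lambda>x. \<Sum>i\<in>I. f i x)"
  by (induction I rule: infinite_finite_induct) (auto intro: poly_map.intros)

lemma poly_map_prod_inner:
  fixes b :: "nat \<Rightarrow> 'e::euclidean_space"
  shows "poly_map n (\<lambda>z. \<Prod>i<n. z \<bullet> b i)"
proof (induction n)
  case (Suc n)
  show ?case using poly_map.mult[OF Suc, of "b n"] by (simp add: mult.commute)
qed (simp add: poly_map.const)

lemma poly_map_translate: "poly_map m f \<Longrightarrow> poly_map m (\<lambda>x. f (x + v))"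
proof (induction rule: poly_map.induct)
  case (mult m f b)
  have "poly_map (Suc m) (\<lambda>x. (x \<bullet> b) * f (x + v) + (v \<bullet> b) * f (x + v))"
    by (intro poly_map.add poly_map.mult poly_map_Suc[OF poly_map_cmult] mult.IH)
  then show ?case by (simp add: inner_add_left distrib_right)
qed (auto intro: poly_map.intros)

lemma poly_map_0_const: "poly_map m f \<Longrightarrow> m = 0 \<Longrightarrow> f x = f y"
  by (induction rule: poly_map.induct) auto

lemma poly_map_difference:
  "poly_map m f \<Longrightarrow> poly_map (m - 1) (\<lambda>x. f (x + v) - f x)"
proof (induction rule: poly_map.induct)
  case (add m f g)
  then show ?case using poly_map.add[OF add.IH] by (simp add: algebra_simps)
next
  case (mult m f b)
  \<comment> \<open>Discrete product rule: the difference of \<open>(x \<bullet> b) * f x\<close> is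
    this term plus \<open>(v \<bullet> b) * f (x + v)\<close>. For \<open>m = 0\<close> the
    truncated \<open>m - 1\<close> is again 0 and the extra factor would raise the degree, but there
    the difference of \<open>f\<close> is zero.\<close>
  have "poly_map m (\<lambda>x. (x \<bullet> b) * (f (x + v) - f x))"
  proof (cases m)
    case 0
    then have "f (x + v) - f x = 0" for x using poly_map_0_const[OF mult.hyps] by simp
    then show ?thesis by (simp add: poly_map.const)
  next
    case (Suc k)
    then show ?thesis using poly_map.mult[OF mult.IH, of b] by simp
  qed
  from poly_map.add[OF this poly_map_cmult[OF poly_map_translate[OF mult.hyps, of v], of "v \<bullet> b"]]
  show ?case by (simp add: algebra_simps inner_add_left)
qed (simp add: poly_map.const)

lemma poly_map_line: "poly_map m f \<Longrightarrow> \<exists>p. \<forall>s. f (x + s *\<^sub>R v) = poly p s"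
proof (induction rule: poly_map.induct)
  case (const m c)
  show ?case by (rule exI[of _ "[:c:]"]) simp
next
  case (add m f g)
  then obtain p q where "\<forall>s. f (x + s *\<^sub>R v) = poly p s" "\<forall>s. g (x + s *\<^sub>R v) = poly q s" by blast
  then show ?case by (intro exI[of _ "p + q"]) simp
next
  case (mult m f b)
  then obtain p where "\<forall>s. f (x + s *\<^sub>R v) = poly p s" by blast
  then show ?case
    by (intro exI[of _ "[:x \<bullet> b, v \<bullet> b:] * p"]) (simp add: inner_add_left algebra_simps)
qed

lemma poly_map_continuous: "poly_map m f \<Longrightarrow> continuous_on UNIV f"
  by (induction rule: poly_map.induct) (auto intro!: continuous_intros)

text \<open>Induction on the degree: the difference of \<open>f\<close> along a generator
  \<open>w\<close> has smaller degree and still vanishes at short sums, because prefixing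
  \<open>w\<close> to a list of length at most \<open>m\<close> gives length at most
  \<open>Suc m\<close>. Hence adding a generator never changes the value of
  \<open>f\<close>.\<close>

lemma poly_map_vanishes_semigroup:
  assumes "poly_map m f"
    and "\<And>ws. set ws \<subseteq> W \<Longrightarrow> length ws \<le> m \<Longrightarrow> f (p + sum_list ws) = 0"
    and "set ws \<subseteq> W"
  shows "f (p + sum_list ws) = 0"
  using assms
proof (induction m arbitrary: f ws)
  case 0
  then show ?case using poly_map_0_const[OF 0(1), of "p + sum_list ws" "p + sum_list []"]
    by (metis list.size(3) order_refl set_empty2 empty_subsetI)
next
  case (Suc m)
  show ?case using Suc.prems(3)
  proof (induction ws)
    case Nil
    then show ?case using Suc.prems(2)[of "[]"] by simp
  next
    case (Cons w ws)
    have D: "poly_map m (\<lambda>x. f (x + w) - f x)"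
      using poly_map_difference[OF Suc.prems(1), of w] by simp
    have "f (p + sum_list ws + w) - f (p + sum_list ws) = 0"
    proof (rule Suc.IH[OF D])
      fix us assume us: "set us \<subseteq> W" "length us \<le> m"
      then have "f (p + sum_list (w # us)) = 0" "f (p + sum_list us) = 0"
        using Suc.prems(2)[of "w # us"] Suc.prems(2)[of us] Cons.prems by auto
      then show "f (p + sum_list us + w) - f (p + sum_list us) = 0"
        by (simp add: add.assoc add.commute[of w])
    qed (use Cons.prems in auto)
    then show ?case using Cons by (simp add: add.assoc add.commute[of w])
  qed
qed

lemma poly_zero_if_zero_on_infinite:
  fixes p :: "real poly"
  assumes "infinite A" "\<And>s. s \<in> A \<Longrightarrow> poly p s = 0"
  shows "p = 0"
  using assms poly_roots_finite[of p] finite_subset[of A "{x. poly p x = 0}"] by blast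

text \<open>Finite differences carry the vanishing to all sums of generators, and one-dimensional root
  counting carries it to real coefficients.\<close>
lemma poly_map_vanishes_span:
  assumes f: "poly_map m f"
    and van: "\<And>ws. set ws \<subseteq> W \<Longrightarrow> length ws \<le> m \<Longrightarrow> f (p + sum_list ws) = 0"
    and "x \<in> span W"
  shows "f (p + x) = 0"
proof -
  \<comment> \<open>The further sum of generators strengthens the induction: it lets the hypothesis
    be used at every natural multiple of a new generator \<open>w\<close>, which gives the
    one-variable polynomial \<open>q\<close> infinitely many roots.\<close>
  have "\<forall>ws. set ws \<subseteq> W \<longrightarrow> f (p + x + sum_list ws) = 0"
    using assms(3)
  proof (induction rule: span_induct_alt)
    case base
    then show ?case using poly_map_vanishes_semigroup[OF f van] by simp
  next
    case (step c w y)
    have replicate_real: "sum_list (replicate k w) = real k *\<^sub>R w" for k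
      by (induction k) (auto simp: algebra_simps)
    show ?case
    proof (intro allI impI)
      fix ws assume ws: "set ws \<subseteq> W"
      obtain q where q: "\<And>s. f ((p + y + sum_list ws) + s *\<^sub>R w) = poly q s"
        using poly_map_line[OF f] by metis
      have "poly q (real k) = 0" for k
      proof -
        have "f (p + y + sum_list (replicate k w @ ws)) = 0"
          using step ws by (intro step(2)[rule_format]) auto
        then show ?thesis by (simp add: q[symmetric] replicate_real add_ac)
      qed
      then have "q = 0"
        by (intro poly_zero_if_zero_on_infinite[of "range real"])
          (auto simp: range_inj_infinite inj_on_def)
      then show "f (p + (c *\<^sub>R w + y) + sum_list ws) = 0"
        using q[of c] by (simp add: add_ac)
    qed
  qed
  from this[rule_format, of "[]"] show ?thesis by simp
qed

section \<open>Densities and Kullback--Leibler divergence\<close>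

lemma prob_space_imp_sigma_finite: "prob_space M \<Longrightarrow> sigma_finite_measure M"
  by (simp add: prob_space_def finite_measure_def)

lemma PiM_density:
  assumes I: "finite I" and M: "sigma_finite_measure M" and f[measurable]: "f \<in> borel_measurable M"
    and D: "sigma_finite_measure (density M f)"
  shows "PiM I (\<lambda>_. density M f) = density (PiM I (\<lambda>_. M)) (\<lambda>x. \<Prod>i\<in>I. f (x i))"
proof -
  interpret M: product_sigma_finite "\<lambda>_. M" by (simp add: product_sigma_finite_def M)
  interpret D: product_sigma_finite "\<lambda>_. density M f" by (simp add: product_sigma_finite_def D)
  show ?thesis
  proof (rule D.PiM_eqI[OF I, symmetric])
    show "sets (density (PiM I (\<lambda>_. M)) (\<lambda>x. \<Prod>i\<in>I. f (x i))) = sets (PiM I (\<lambda>_. density M f))"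
      by (simp, intro sets_PiM_cong) simp_all
  next
    fix A assume A: "\<And>i. i \<in> I \<Longrightarrow> A i \<in> sets (density M f)"
    then have [measurable]: "\<And>i. i \<in> I \<Longrightarrow> A i \<in> sets M" by simp
    have "emeasure (density (PiM I (\<lambda>_. M)) (\<lambda>x. \<Prod>i\<in>I. f (x i))) (Pi\<^sub>E I A) =
      (\<integral>\<^sup>+x. (\<Prod>i\<in>I. f (x i)) * indicator (Pi\<^sub>E I A) x \<partial>PiM I (\<lambda>_. M))"
      using I A by (intro emeasure_density) (auto intro!: sets_PiM_I_finite)
    also have "\<dots> = (\<integral>\<^sup>+x. (\<Prod>i\<in>I. f (x i) * indicator (A i) (x i)) \<partial>PiM I (\<lambda>_. M))"
    proof (rule nn_integral_cong)
      fix x assume x: "x \<in> space (PiM I (\<lambda>_. M))"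
      have "indicator (Pi\<^sub>E I A) x = (\<Prod>i\<in>I. indicator (A i) (x i) :: ennreal)"
        using I x by (auto simp: indicator_def space_PiM PiE_iff prod_zero_iff)
      then show "(\<Prod>i\<in>I. f (x i)) * indicator (Pi\<^sub>E I A) x =
        (\<Prod>i\<in>I. f (x i) * indicator (A i) (x i))" by (simp add: prod.distrib)
    qed
    also have "\<dots> = (\<Prod>i\<in>I. \<integral>\<^sup>+y. f y * indicator (A i) y \<partial>M)"
      by (intro M.product_nn_integral_prod I) measurable
    also have "\<dots> = (\<Prod>i\<in>I. emeasure (density M f) (A i))"
      by (intro prod.cong refl emeasure_density[symmetric]) auto
    finally show "emeasure (density (PiM I (\<lambda>_. M)) (\<lambda>x. \<Prod>i\<in>I. f (x i))) (Pi\<^sub>E I A) =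
      (\<Prod>i\<in>I. emeasure (density M f) (A i))" .
  qed
qed

section \<open>Equivalent measures and their null sets\<close>

lemma density_positive:
  assumes M: "sigma_finite_measure M" and s: "sets N = sets M"
    and ac: "absolutely_continuous M N" "absolutely_continuous N M"
  shows "AE x in M. 0 < RN_deriv M N x"
proof -
  interpret sigma_finite_measure M by fact
  let ?Z = "{x\<in>space M. RN_deriv M N x = 0}"
  have Z[measurable]: "?Z \<in> sets M" by measurable
  have "?Z \<in> null_sets (density M (RN_deriv M N))"
    by (subst null_sets_density_iff) auto
  then have "?Z \<in> null_sets N" using density_RN_deriv[OF ac(1) s] by simp
  then have "?Z \<in> null_sets M" using ac(2) by (auto simp: absolutely_continuous_def)
  then have "AE x in M. x \<notin> ?Z" by (rule AE_not_in)
  then show ?thesis using AE_space by eventually_elim (auto simp: zero_less_iff_neq_zero)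
qed

lemma AE_absolutely_continuous_iff:
  assumes "sets N = sets M" "absolutely_continuous M N" "absolutely_continuous N M"
  shows "(AE x in N. P x) \<longleftrightarrow> (AE x in M. P x)"
  using assms absolutely_continuous_AE[of N M P] absolutely_continuous_AE[of M N P] by auto

text \<open>The product of the derivatives is a density of the product measure and is positive
  almost everywhere. Since \<open>N\<close> need only be sigma-finite, this covers
  \<open>lam\<close> itself.\<close>

lemma AE_PiM_equivalent:
  assumes I: "finite I" and Q: "prob_space Q" and N: "sigma_finite_measure N" and s: "sets N = sets Q"
    and ac: "absolutely_continuous Q N" "absolutely_continuous N Q"
  shows "(AE x in PiM I (\<lambda>_. N). P x) \<longleftrightarrow> (AE x in PiM I (\<lambda>_. Q). P x)"
proof -
  interpret Q: prob_space Q by fact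
  let ?f = "RN_deriv Q N"
  have D: "density Q ?f = N" by (rule Q.density_RN_deriv[OF ac(1) s])
  have "PiM I (\<lambda>_. N) = density (PiM I (\<lambda>_. Q)) (\<lambda>x. \<Prod>i\<in>I. ?f (x i))"
    using PiM_density[OF I prob_space_imp_sigma_finite[OF Q], of ?f] D N by simp
  then have "(AE x in PiM I (\<lambda>_. N). P x) \<longleftrightarrow>
    (AE x in PiM I (\<lambda>_. Q). 0 < (\<Prod>i\<in>I. ?f (x i)) \<longrightarrow> P x)"
    by (simp only:) (rule AE_density, measurable)
  moreover have "AE x in PiM I (\<lambda>_. Q). \<forall>i\<in>I. 0 < ?f (x i)"
    using density_positive[OF prob_space_imp_sigma_finite[OF Q] s ac]
    by (auto intro!: AE_finite_allI I AE_PiM_component simp: Q)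
  then have "\<forall>\<^sub>F x in ae_filter (PiM I (\<lambda>_. Q)). 0 < (\<Prod>i\<in>I. ?f (x i))"
    by eventually_elim (auto simp: zero_less_iff_neq_zero prod_zero_iff I)
  then have "\<forall>\<^sub>F x in ae_filter (PiM I (\<lambda>_. Q)). (0 < (\<Prod>i\<in>I. ?f (x i)) \<longrightarrow> P x) = P x"
    by eventually_elim simp
  then have "(AE x in PiM I (\<lambda>_. Q). 0 < (\<Prod>i\<in>I. ?f (x i)) \<longrightarrow> P x) \<longleftrightarrow>
    (AE x in PiM I (\<lambda>_. Q). P x)" by (rule eventually_subst)
  ultimately show ?thesis by simp
qed

lemma full_support_imp_ac:
  assumes lam: "sigma_finite_measure lam" and R: "R \<in> dominated lam" and f: "full_support lam R"
  shows "absolutely_continuous R lam"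
  unfolding absolutely_continuous_def
proof
  interpret sigma_finite_measure lam by fact
  fix A assume "A \<in> null_sets R"
  moreover have "density lam (RN_deriv lam R) = R"
    using R by (intro density_RN_deriv) (auto simp: dominated_def)
  ultimately have "A \<in> null_sets (density lam (RN_deriv lam R))" by simp
  then have A: "A \<in> sets lam" "AE x in lam. x \<in> A \<longrightarrow> RN_deriv lam R x = 0"
    by (auto simp: null_sets_density_iff)
  from A(2) f[unfolded full_support_def] have "AE x in lam. x \<notin> A" by eventually_elim auto
  then show "A \<in> null_sets lam" using A(1) by (simp add: AE_iff_null_sets)
qed

lemma full_supportI:
  assumes lam: "sigma_finite_measure lam" and R: "R \<in> dominated lam" and "absolutely_continuous R lam"
  shows "full_support lam R"
  unfolding full_support_def using assms by (intro density_positive) (auto simp: dominated_def)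


text \<open>Both measures have mass 1, so adding \<open>1 - r\<close> to \<open>r * ln r\<close>
  does not change the integral but makes the integrand nonnegative. The divergence becomes a
  nonnegative integral with no case distinction, which settles its sign and later its
  measurability.\<close>

lemma KL_density_real:
  fixes r :: "'a \<Rightarrow> real"
  assumes P: "prob_space P" and r[measurable]: "r \<in> borel_measurable P" and nn: "\<And>x. 0 \<le> r x"
    and R: "prob_space (density P r)"
  shows "KL (density P r) P =
      (if integrable P (\<lambda>x. r x * ln (r x)) then ennreal (\<integral>x. r x * ln (r x) \<partial>P) else \<infinity>)"
    and "KL (density P r) P = (\<integral>\<^sup>+x. ennreal (r x * ln (r x) - r x + 1) \<partial>P)"
    and "integrable P (\<lambda>x. r x * ln (r x)) \<Longrightarrow> 0 \<le> (\<integral>x. r x * ln (r x) \<partial>P)"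
proof -
  interpret P: prob_space P by fact
  interpret R: prob_space "density P r" by fact
  have ac: "absolutely_continuous P (density P r)"
    by (rule absolutely_continuousI_density) simp
  have "AE x in P. ennreal (r x) = RN_deriv P (density P r) x"
    by (rule P.RN_deriv_unique) auto
  then have ed: "AE x in P. entropy_density (exp 1) P (density P r) x = ln (r x)"
    by eventually_elim (auto simp: entropy_density_def log_def nn, metis enn2real_ennreal nn)
  have meas[measurable]: "entropy_density (exp 1) P (density P r) \<in> borel_measurable P" by measurable
  have 1: "integrable (density P r) (entropy_density (exp 1) P (density P r)) \<longleftrightarrow>
    integrable P (\<lambda>x. r x * ln (r x))"
  proof -
    have "integrable (density P r) (entropy_density (exp 1) P (density P r)) \<longleftrightarrow>
      integrable P (\<lambda>x. r x *\<^sub>R entropy_density (exp 1) P (density P r) x)"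
      by (rule integrable_density) (auto simp: nn)
    also have "\<dots> \<longleftrightarrow> integrable P (\<lambda>x. r x * ln (r x))"
      using ed by (intro integrable_cong_AE) auto
    finally show ?thesis .
  qed
  have 2: "KL_divergence (exp 1) P (density P r) = (\<integral>x. r x * ln (r x) \<partial>P)"
  proof -
    have "KL_divergence (exp 1) P (density P r) =
      (\<integral>x. r x *\<^sub>R entropy_density (exp 1) P (density P r) x \<partial>P)"
      unfolding KL_divergence_def by (rule integral_density) (auto simp: nn)
    also have "\<dots> = (\<integral>x. r x * ln (r x) \<partial>P)"
      using ed by (intro integral_cong_AE) auto
    finally show ?thesis .
  qed
  show A: "KL (density P r) P =
      (if integrable P (\<lambda>x. r x * ln (r x)) then ennreal (\<integral>x. r x * ln (r x) \<partial>P) else \<infinity>)"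
    unfolding KL_def using ac 1 2 by simp
  have "(\<integral>\<^sup>+x. ennreal (r x) \<partial>P) = 1"
    using R.emeasure_space_1 by (simp add: emeasure_density nn_integral_set_ennreal cong: nn_integral_cong)
  then have ir: "integrable P r" and r1: "(\<integral>x. r x \<partial>P) = 1"
    using nn by (auto simp: integrable_iff_bounded integral_eq_nn_integral)
  have pos: "0 \<le> u * ln u - u + 1" if "0 \<le> u" for u :: real
  proof (cases "u = 0")
    case False
    then have "u > 0" using that by simp
    then have "ln (1 / u) \<le> 1 / u - 1" by (intro ln_le_minus_one) simp
    then have "u * ln (1 / u) \<le> u * (1 / u - 1)" using that by (rule mult_left_mono)
    then show ?thesis using \<open>u > 0\<close> by (simp add: ln_div algebra_simps)
  qed simp
  have i: "integrable P (\<lambda>x. r x * ln (r x) - r x + 1) \<longleftrightarrow> integrable P (\<lambda>x. r x * ln (r x))"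
  proof
    assume "integrable P (\<lambda>x. r x * ln (r x) - r x + 1)"
    from Bochner_Integration.integrable_add[OF this Bochner_Integration.integrable_diff[OF ir, of "\<lambda>_. 1"]]
    show "integrable P (\<lambda>x. r x * ln (r x))" by simp
  qed (use ir in auto)
  have e: "(\<integral>x. r x * ln (r x) - r x + 1 \<partial>P) = (\<integral>x. r x * ln (r x) \<partial>P)"
    if "integrable P (\<lambda>x. r x * ln (r x))"
    using that ir r1 by (simp add: P.prob_space)
  show "KL (density P r) P = (\<integral>\<^sup>+x. ennreal (r x * ln (r x) - r x + 1) \<partial>P)"
  proof (cases "integrable P (\<lambda>x. r x * ln (r x))")
    case True
    then show ?thesis using i e pos nn by (simp add: A nn_integral_eq_integral)
  next
    case False
    then have "\<not> integrable P (\<lambda>x. r x * ln (r x) - r x + 1)" using i by simp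
    then have "(\<integral>\<^sup>+x. ennreal (r x * ln (r x) - r x + 1) \<partial>P) = \<infinity>"
      using pos nn by (auto simp: integrable_iff_bounded not_less top_unique)
    then show ?thesis using False by (simp add: A)
  qed
  show "0 \<le> (\<integral>x. r x * ln (r x) \<partial>P)" if "integrable P (\<lambda>x. r x * ln (r x))"
    unfolding e[OF that, symmetric] using pos nn by (intro Bochner_Integration.integral_nonneg) auto
qed

text \<open>This is \<open>ln v \<le> v - 1\<close> at \<open>v = 1 / sqrt u\<close>, multiplied by
  \<open>2 * u\<close>. Integrated, it bounds a squared Hellinger distance by the
  divergence.\<close>

lemma sqrt_diff_le_entropy:
  fixes u :: real assumes "0 \<le> u" shows "(sqrt u - 1)\<^sup>2 \<le> u * ln u - u + 1"
proof (cases "u = 0")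
  case False
  then have u: "u > 0" using assms by simp
  then have "ln (1 / sqrt u) \<le> 1 / sqrt u - 1" by (intro ln_le_minus_one) simp
  then have "2 - 2 / sqrt u \<le> ln u" using u by (simp add: ln_div ln_sqrt)
  then have "u * (2 - 2 / sqrt u) \<le> u * ln u" using u by (intro mult_left_mono) auto
  moreover have "u * (2 - 2 / sqrt u) = 2 * u - 2 * (u / sqrt u)"
    by (simp add: algebra_simps)
  moreover have "u / sqrt u = sqrt u" using u by (simp add: real_div_sqrt)
  moreover have "(sqrt u - 1)\<^sup>2 = u - 2 * sqrt u + 1" using u by (simp add: power2_diff)
  ultimately show ?thesis by simp
qed simp

section \<open>Exponential families\<close>

text \<open>The normalising constant is kept as its logarithm \<open>lc\<close>, so that log
  densities are affine in \<open>T\<close>. The pair \<open>lc P\<close>, \<open>th P\<close> is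
  merely some choice for each member; the natural parameter need not be unique.\<close>

locale exp_family =
  fixes lam :: "'a measure" and T :: "'a \<Rightarrow> 'b::euclidean_space" and \<P> :: "'a measure set"
    and P0 :: "'a measure" and lc :: "'a measure \<Rightarrow> real" and th :: "'a measure \<Rightarrow> 'b"
  assumes sigma_finite_lam: "sigma_finite_measure lam"
    and T_lam: "T \<in> borel_measurable lam"
    and P0: "P0 \<in> dominated lam" and ac_P0_lam: "absolutely_continuous P0 lam"
    and fam_dominated: "P \<in> \<P> \<Longrightarrow> P \<in> dominated lam"
    and fam_density: "P \<in> \<P> \<Longrightarrow> P = density P0 (\<lambda>x. ennreal (exp (lc P + th P \<bullet> T x)))"
    and fam_integrable: "P \<in> \<P> \<Longrightarrow> integrable P T"
begin

text \<open>The argument is a value of the statistic and not a sample point: the same affine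
  function is evaluated at \<open>T x\<close>, at the sample average and at the mean of an arbitrary
  distribution.\<close>

definition ld :: "'a measure \<Rightarrow> 'b \<Rightarrow> real" where
  "ld P \<tau> = lc P + th P \<bullet> \<tau>"

definition dens :: "'a measure \<Rightarrow> 'a \<Rightarrow> real" where
  "dens R x = enn2real (RN_deriv P0 R x)"

lemma sets_P0: "sets P0 = sets lam" and prob_P0: "prob_space P0"
  and ac_lam_P0: "absolutely_continuous lam P0"
  using P0 by (auto simp: dominated_def)

lemma dominatedD:
  assumes "R \<in> dominated lam"
  shows "prob_space R" "sets R = sets lam" "sets R = sets P0" "absolutely_continuous lam R"
    "absolutely_continuous P0 R" "space R = space P0"
  using assms sets_P0 ac_P0_lam sets_eq_imp_space_eq[of R P0]
  by (auto simp: dominated_def absolutely_continuous_def)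

lemma T_P0[measurable]: "T \<in> borel_measurable P0"
  using T_lam by (simp cong: measurable_cong_sets add: measurable_cong_sets[OF sets_P0 refl])

lemma dens_measurable[measurable]: "dens R \<in> borel_measurable P0"
  unfolding dens_def by measurable

lemma dens_nonneg: "0 \<le> dens R x" by (simp add: dens_def)

lemma ld_measurable[measurable]: "ld P \<in> borel_measurable borel"
  unfolding ld_def by measurable

lemma density_dens:
  assumes R: "R \<in> dominated lam"
  shows "density P0 (dens R) = R"
proof -
  interpret prob_space P0 by (rule prob_P0)
  note D = dominatedD[OF R]
  have "AE x in P0. RN_deriv P0 R x \<noteq> \<infinity>"
    by (rule RN_deriv_finite[OF prob_space_imp_sigma_finite[OF D(1)] D(5) D(3)])
  then have "AE x in P0. ennreal (dens R x) = RN_deriv P0 R x"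
    by eventually_elim (simp add: dens_def less_top)
  then have "density P0 (dens R) = density P0 (RN_deriv P0 R)"
    by (intro density_cong) auto
  then show ?thesis using density_RN_deriv[OF D(5) D(3)] by simp
qed

lemma fam_density_ld: "P \<in> \<P> \<Longrightarrow> P = density P0 (\<lambda>x. ennreal (exp (ld P (T x))))"
  using fam_density by (simp add: ld_def)

lemma ac_fam: assumes P: "P \<in> \<P>" shows "absolutely_continuous P P0"
proof -
  have "absolutely_continuous (density P0 (\<lambda>x. ennreal (exp (ld P (T x))))) P0"
    by (auto simp: absolutely_continuous_def null_sets_density_iff AE_iff_null_sets)
  then show ?thesis using fam_density_ld[OF P] by simp
qed

text \<open>The first form serves the algebra of log densities; the second, with nonnegative
  integrand, serves measurability in the estimate and the Hellinger bound.\<close>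

lemma KL_fam:
  fixes r :: "'a \<Rightarrow> real"
  assumes r[measurable]: "r \<in> borel_measurable P0" and nn: "\<And>x. 0 \<le> r x"
    and R: "R = density P0 r" "prob_space R" and P: "P \<in> \<P>"
  shows "KL R P = (if integrable R (\<lambda>x. ln (r x) - ld P (T x))
      then ennreal (\<integral>x. ln (r x) - ld P (T x) \<partial>R) else \<infinity>)" (is ?A)
    and "KL R P = (\<integral>\<^sup>+x. ennreal (r x / exp (ld P (T x)) * ln (r x / exp (ld P (T x)))
      - r x / exp (ld P (T x)) + 1) \<partial>P)" (is ?B)
    and "integrable R (\<lambda>x. ln (r x) - ld P (T x)) \<Longrightarrow> 0 \<le> (\<integral>x. ln (r x) - ld P (T x) \<partial>R)" (is "_ \<Longrightarrow> ?C")
proof -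
  let ?e = "\<lambda>x. exp (ld P (T x))"
  let ?u = "\<lambda>x. r x / ?e x"
  have Pd: "P = density P0 (\<lambda>x. ennreal (?e x))" using fam_density_ld[OF P] .
  have PP: "prob_space P" and sP: "sets P = sets P0"
    using dominatedD[OF fam_dominated[OF P]] by auto
  have u[measurable]: "?u \<in> borel_measurable P" by (subst Pd) simp
  have Ru: "density P (\<lambda>x. ennreal (?u x)) = R"
  proof -
    have "density P (\<lambda>x. ennreal (?u x)) = density P0 (\<lambda>x. ennreal (?e x) * ennreal (?u x))"
      by (subst Pd) (rule density_density_eq, simp_all)
    also have "\<dots> = R" unfolding R(1) by (simp add: ennreal_mult'[symmetric])
    finally show ?thesis .
  qed
  \<comment> \<open>Where \<open>r x = 0\<close> both sides are zero, whatever value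
    \<open>ln 0\<close> has.\<close>
  have eq: "?e x * (?u x * ln (?u x)) = r x * (ln (r x) - ld P (T x))" for x
    using nn[of x] by (cases "r x = 0") (auto simp: ln_div)
  have i: "integrable P (\<lambda>x. ?u x * ln (?u x)) \<longleftrightarrow> integrable R (\<lambda>x. ln (r x) - ld P (T x))"
  proof -
    have "integrable P (\<lambda>x. ?u x * ln (?u x)) \<longleftrightarrow> integrable P0 (\<lambda>x. ?e x *\<^sub>R (?u x * ln (?u x)))"
      by (subst Pd, rule integrable_density) simp_all
    also have "\<dots> \<longleftrightarrow> integrable P0 (\<lambda>x. r x *\<^sub>R (ln (r x) - ld P (T x)))" by (simp only: eq real_scaleR_def)
    also have "\<dots> \<longleftrightarrow> integrable R (\<lambda>x. ln (r x) - ld P (T x))"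
      unfolding R(1) by (rule integrable_density[symmetric]) (simp_all add: nn)
    finally show ?thesis .
  qed
  have e: "(\<integral>x. ?u x * ln (?u x) \<partial>P) = (\<integral>x. ln (r x) - ld P (T x) \<partial>R)"
  proof -
    have "(\<integral>x. ?u x * ln (?u x) \<partial>P) = (\<integral>x. ?e x *\<^sub>R (?u x * ln (?u x)) \<partial>P0)"
      by (subst Pd, rule integral_density) simp_all
    also have "\<dots> = (\<integral>x. r x *\<^sub>R (ln (r x) - ld P (T x)) \<partial>P0)" by (simp only: eq real_scaleR_def)
    also have "\<dots> = (\<integral>x. ln (r x) - ld P (T x) \<partial>R)"
      unfolding R(1) by (rule integral_density[symmetric]) (simp_all add: nn)
    finally show ?thesis .
  qed
  note K = KL_density_real[OF PP u, unfolded Ru, OF _ R(2)]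
  show ?A ?B using K(1,2) i e nn by simp_all
  show ?C if "integrable R (\<lambda>x. ln (r x) - ld P (T x))" using K(3) i e nn that by simp
qed

text \<open>The pointwise entropy inequality, weighted by the density of \<open>P\<close>. The left
  side is a squared distance in \<open>L^2\<close>, so small divergences yield almost-everywhere
  convergence and comparisons between two distributions close to the same member.\<close>

lemma hellinger_le_KL:
  fixes r :: "'a \<Rightarrow> real"
  assumes r[measurable]: "r \<in> borel_measurable P0" and nn: "\<And>x. 0 \<le> r x"
    and R: "R = density P0 r" "prob_space R" and P: "P \<in> \<P>"
  shows "(\<integral>\<^sup>+x. ennreal ((sqrt (r x) - sqrt (exp (ld P (T x))))\<^sup>2) \<partial>P0) \<le> KL R P"
proof -
  let ?e = "\<lambda>x. exp (ld P (T x))"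
  let ?u = "\<lambda>x. r x / ?e x"
  have Pd: "P = density P0 (\<lambda>x. ennreal (?e x))" using fam_density_ld[OF P] .
  have "(\<integral>\<^sup>+x. ennreal ((sqrt (r x) - sqrt (?e x))\<^sup>2) \<partial>P0)
    \<le> (\<integral>\<^sup>+x. ennreal (?e x) * ennreal (?u x * ln (?u x) - ?u x + 1) \<partial>P0)"
  proof (rule nn_integral_mono)
    fix x
    have "sqrt (r x) - sqrt (?e x) = sqrt (?e x) * (sqrt (?u x) - 1)"
      by (simp add: real_sqrt_divide right_diff_distrib)
    then have "(sqrt (r x) - sqrt (?e x))\<^sup>2 = ?e x * (sqrt (?u x) - 1)\<^sup>2"
      by (simp add: power_mult_distrib)
    also have "\<dots> \<le> ?e x * (?u x * ln (?u x) - ?u x + 1)"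
      using nn by (intro mult_left_mono sqrt_diff_le_entropy) auto
    finally show "ennreal ((sqrt (r x) - sqrt (?e x))\<^sup>2)
      \<le> ennreal (?e x) * ennreal (?u x * ln (?u x) - ?u x + 1)"
      by (simp add: ennreal_mult'[symmetric] ennreal_leI)
  qed
  also have "\<dots> = (\<integral>\<^sup>+x. ennreal (?u x * ln (?u x) - ?u x + 1) \<partial>P)"
    by (subst (2) Pd, rule nn_integral_density[symmetric]) simp_all
  also have "\<dots> = KL R P" by (rule KL_fam(2)[OF assms, symmetric])
  finally show ?thesis .
qed

text \<open>The entropy of \<open>R\<close> is common to both divergences and cancels; what remains
  is the integral of a function affine in \<open>T\<close>. Finiteness at one member thus gives
  finiteness at all.\<close>

lemma KL_change:
  assumes R: "R \<in> dominated lam" and iT: "integrable R T" and P: "P \<in> \<P>" "P' \<in> \<P>"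
    and fin: "KL R P < \<infinity>"
  shows "KL R P' < \<infinity>"
    and "enn2real (KL R P') = enn2real (KL R P) + ld P (mean T R) - ld P' (mean T R)"
proof -
  interpret R: prob_space R using dominatedD[OF R] by simp
  note K = KL_fam[OF dens_measurable dens_nonneg density_dens[OF R, symmetric] dominatedD(1)[OF R]]
  let ?f = "\<lambda>P x. ln (dens R x) - ld P (T x)"
  have ild: "integrable R (\<lambda>x. ld P (T x))" and eld: "(\<integral>x. ld P (T x) \<partial>R) = ld P (mean T R)" for P
    using iT by (auto simp: ld_def mean_def R.prob_space)
  have f: "integrable R (?f P)" using fin K(1)[OF P(1)] by (auto split: if_splits)
  have eq: "?f P' = (\<lambda>x. ?f P x + ld P (T x) - ld P' (T x))" by auto
  have f': "integrable R (?f P')"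
    unfolding eq by (intro Bochner_Integration.integrable_diff Bochner_Integration.integrable_add f ild)
  have e: "(\<integral>x. ?f P' x \<partial>R) = (\<integral>x. ?f P x \<partial>R) + ld P (mean T R) - ld P' (mean T R)"
    unfolding eq using f ild eld
    by (subst Bochner_Integration.integral_diff Bochner_Integration.integral_add,
      (intro Bochner_Integration.integrable_diff Bochner_Integration.integrable_add f ild)+)+ simp
  show "KL R P' < \<infinity>" using K(1)[OF P(2)] f' by simp
  show "enn2real (KL R P') = enn2real (KL R P) + ld P (mean T R) - ld P' (mean T R)"
    using K(1)[OF P(1)] K(1)[OF P(2)] K(3)[OF P(1)] K(3)[OF P(2)] f f' e by simp
qed

lemma KL_same_0: "prob_space Q \<Longrightarrow> KL Q Q = 0"
proof -
  assume "prob_space Q"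
  then interpret prob_space Q .
  have "AE x in Q. 1 = RN_deriv Q Q x" by (rule RN_deriv_unique) (auto simp: density_1)
  then have *: "AE x in Q. entropy_density (exp 1) Q Q x = 0"
    by eventually_elim (metis (mono_tags) comp_apply enn2real_1 entropy_density_def log_one)
  have "integrable Q (entropy_density (exp 1) Q Q) \<longleftrightarrow> integrable Q (\<lambda>x. 0::real)"
    using * by (intro integrable_cong_AE) auto
  then show ?thesis by (simp add: KL_def absolutely_continuous_def KL_same_eq_0)
qed

lemma KL_0_imp_eq:
  assumes R: "R \<in> dominated lam" and P: "P \<in> \<P>" and 0: "KL R P = 0"
  shows "R = P"
proof -
  have "(\<integral>\<^sup>+x. ennreal ((sqrt (dens R x) - sqrt (exp (ld P (T x))))\<^sup>2) \<partial>P0) = 0"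
    using hellinger_le_KL[OF dens_measurable dens_nonneg density_dens[OF R, symmetric] dominatedD(1)[OF R] P] 0
    by simp
  then have "AE x in P0. dens R x = exp (ld P (T x))"
    by (subst (asm) nn_integral_0_iff_AE) (auto elim!: eventually_mono)
  then have "density P0 (dens R) = density P0 (\<lambda>x. ennreal (exp (ld P (T x))))"
    by (intro density_cong) auto
  then show ?thesis using density_dens[OF R] fam_density_ld[OF P] by simp
qed

text \<open>The difference of the two sides is \<open>KL P' P\<close>, by changing the member in
  \<open>KL P' P' = 0\<close>.\<close>

lemma ld_le_ld:
  assumes P: "P \<in> \<P>" "P' \<in> \<P>"
  shows "ld P (mean T P') \<le> ld P' (mean T P')"
    and "ld P (mean T P') = ld P' (mean T P') \<Longrightarrow> P = P'"
proof -
  have "KL P' P' = 0" by (rule KL_same_0[OF dominatedD(1)[OF fam_dominated[OF P(2)]]])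
  with KL_change[OF fam_dominated[OF P(2)] fam_integrable[OF P(2)] P(2) P(1)]
  have "KL P' P < \<infinity>" "enn2real (KL P' P) = ld P' (mean T P') - ld P (mean T P')" by auto
  note K = this
  show "ld P (mean T P') \<le> ld P' (mean T P')"
    using K(2) enn2real_nonneg[of "KL P' P"] by simp
  show "P = P'" if "ld P (mean T P') = ld P' (mean T P')"
  proof -
    have "KL P' P = 0" using K that by (auto simp: enn2real_eq_0_iff)
    from KL_0_imp_eq[OF fam_dominated[OF P(2)] P(1) this] show ?thesis by simp
  qed
qed

section \<open>The mean as a parameter, and projection onto the family\<close>

lemma mean_inj:
  assumes P: "P \<in> \<P>" "P' \<in> \<P>" and "mean T P = mean T P'"
  shows "P = P'"
  using ld_le_ld[OF P] ld_le_ld[OF P(2,1)] assms(3) by (metis order_antisym)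

lemma member_with_mean_mean:
  "P \<in> \<P> \<Longrightarrow> member_with_mean T \<P> (mean T P) = P"
  unfolding member_with_mean_def by (rule the_equality) (auto intro: mean_inj)

text \<open>Divergences and expected divergences both depend on the member only through its log
  density at a single mean, up to a constant. If some member has that mean, it is the only
  minimiser.\<close>

lemma unique_arg_min:
  fixes J :: "'a measure \<Rightarrow> ennreal"
  assumes P': "P' \<in> \<P>"
    and J: "\<And>P. P \<in> \<P> \<Longrightarrow> J P < \<infinity> \<and> enn2real (J P) = c - ld P (mean T P')"
  shows "is_arg_min J (\<lambda>P. P \<in> \<P>) P \<longleftrightarrow> P = P'"
proof -
  have *: "J Q < J Q' \<longleftrightarrow> ld Q' (mean T P') < ld Q (mean T P')" if Q: "Q \<in> \<P>" "Q' \<in> \<P>" for Q Q'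
  proof -
    have "J Q = ennreal (enn2real (J Q))" "J Q' = ennreal (enn2real (J Q'))"
      using J[OF Q(1)] J[OF Q(2)] ennreal_enn2real by (metis infinity_ennreal_def)+
    then have "J Q < J Q' \<longleftrightarrow> enn2real (J Q) < enn2real (J Q')"
      by (metis enn2real_nonneg ennreal_less_iff)
    then show ?thesis using J[OF Q(1)] J[OF Q(2)] by simp
  qed
  show ?thesis
    unfolding is_arg_min_def
    using ld_le_ld[of _ P'] P' by (metis * leD order.not_eq_order_implies_strict)
qed

lemma arg_min_eqI:
  assumes "\<And>P. is_arg_min J (\<lambda>P. P \<in> \<P>) P \<longleftrightarrow> P = P'"
  shows "arg_min J (\<lambda>P. P \<in> \<P>) = P'"
proof -
  have "is_arg_min J (\<lambda>P. P \<in> \<P>) = (\<lambda>P. P = P')" using assms by auto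
  then show ?thesis unfolding arg_min_def by simp
qed

lemma KL_proj_eq:
  assumes R: "R \<in> dominated lam" and iT: "integrable R T" and P: "P \<in> \<P>" "KL R P < \<infinity>"
    and P': "P' \<in> \<P>" "mean T P' = mean T R"
  shows "KL_proj_exists \<P> R" "KL_proj \<P> R = P'"
proof -
  have *: "is_arg_min (KL R) (\<lambda>P. P \<in> \<P>) Q \<longleftrightarrow> Q = P'" for Q
    using KL_change[OF R iT P(1) _ P(2)] P'(2)
    by (intro unique_arg_min[OF P'(1), where c = "enn2real (KL R P) + ld P (mean T R)"]) simp
  show eq: "KL_proj \<P> R = P'" unfolding KL_proj_def by (rule arg_min_eqI[OF *])
  show "KL_proj_exists \<P> R"
    unfolding KL_proj_exists_def eq using KL_change(1)[OF R iT P(1) P'(1) P(2)]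
    by (auto simp: *)
qed

lemma AE_iid:
  assumes "R \<in> dominated lam" "absolutely_continuous R lam"
  shows "(AE x in iid n lam. Q x) \<longleftrightarrow> (AE x in iid n R. Q x)"
  using assms dominatedD[OF assms(1)]
  by (intro AE_PiM_equivalent sigma_finite_lam) auto

end

section \<open>Mixtures and samples\<close>

text \<open>Integrability is assumed only under the mixture, so the kernels need have a mean only
  almost everywhere. Positive and negative parts are mixed separately as nonnegative integrals and
  subtracted where both are finite.\<close>

lemma bind_integral_real:
  fixes f :: "'a \<Rightarrow> real"
  assumes f[measurable]: "f \<in> borel_measurable K" and N[measurable]: "N \<in> measurable M (subprob_algebra K)"
    and i: "integrable (M \<bind> N) f"
  shows "integrable M (\<lambda>x. \<integral>y. f y \<partial>N x)" and "(\<integral>y. f y \<partial>(M \<bind> N)) = (\<integral>x. (\<integral>y. f y \<partial>N x) \<partial>M)"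
proof -
  define g h where "g x = (\<integral>\<^sup>+y. ennreal (f y) \<partial>N x)" and "h x = (\<integral>\<^sup>+y. ennreal (- f y) \<partial>N x)" for x
  have [measurable]: "g \<in> borel_measurable M" "h \<in> borel_measurable M"
    unfolding g_def h_def by measurable
  have G: "(\<integral>\<^sup>+y. ennreal (f y) \<partial>(M \<bind> N)) = (\<integral>\<^sup>+x. g x \<partial>M)"
    and H: "(\<integral>\<^sup>+y. ennreal (- f y) \<partial>(M \<bind> N)) = (\<integral>\<^sup>+x. h x \<partial>M)"
    unfolding g_def h_def by (rule nn_integral_bind[OF _ N], measurable)+
  have fin: "(\<integral>\<^sup>+x. g x \<partial>M) < \<infinity>" "(\<integral>\<^sup>+x. h x \<partial>M) < \<infinity>"
    using i by (auto simp: real_integrable_def G[symmetric] H[symmetric] less_top)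
  have AEfin: "AE x in M. g x < \<infinity>" "AE x in M. h x < \<infinity>"
    using nn_integral_PInf_AE[of g M] nn_integral_PInf_AE[of h M] fin by (auto simp: less_top)
  have ig: "integrable M (\<lambda>x. enn2real (g x))" "(\<integral>x. enn2real (g x) \<partial>M) = enn2real (\<integral>\<^sup>+x. g x \<partial>M)"
  proof -
    have e: "(\<integral>\<^sup>+x. ennreal (enn2real (g x)) \<partial>M) = (\<integral>\<^sup>+x. g x \<partial>M)"
      using AEfin(1) by (intro nn_integral_cong_AE) (auto elim!: eventually_mono)
    show "integrable M (\<lambda>x. enn2real (g x))" using e fin(1) by (auto simp: integrable_iff_bounded)
    show "(\<integral>x. enn2real (g x) \<partial>M) = enn2real (\<integral>\<^sup>+x. g x \<partial>M)"
      using e by (simp add: integral_eq_nn_integral)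
  qed
  have ih: "integrable M (\<lambda>x. enn2real (h x))" "(\<integral>x. enn2real (h x) \<partial>M) = enn2real (\<integral>\<^sup>+x. h x \<partial>M)"
  proof -
    have e: "(\<integral>\<^sup>+x. ennreal (enn2real (h x)) \<partial>M) = (\<integral>\<^sup>+x. h x \<partial>M)"
      using AEfin(2) by (intro nn_integral_cong_AE) (auto elim!: eventually_mono)
    show "integrable M (\<lambda>x. enn2real (h x))" using e fin(2) by (auto simp: integrable_iff_bounded)
    show "(\<integral>x. enn2real (h x) \<partial>M) = enn2real (\<integral>\<^sup>+x. h x \<partial>M)"
      using e by (simp add: integral_eq_nn_integral)
  qed
  have eq: "AE x in M. (\<integral>y. f y \<partial>N x) = enn2real (g x) - enn2real (h x)"
    using AEfin AE_space
  proof eventually_elim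
    case (elim x)
    have "sets (N x) = sets K" using subprob_measurableD(2)[OF N elim(3)] .
    then have "f \<in> borel_measurable (N x)" using f by (simp cong: measurable_cong_sets)
    then have "integrable (N x) f" using elim by (auto simp: real_integrable_def g_def h_def less_top)
    then show ?case by (simp add: real_lebesgue_integral_def g_def h_def)
  qed
  have m: "(\<lambda>x. \<integral>y. f y \<partial>N x) \<in> borel_measurable M"
    by (rule measurable_compose[OF N integral_measurable_subprob_algebra]) simp
  show "integrable M (\<lambda>x. \<integral>y. f y \<partial>N x)"
    using eq ig(1) ih(1) m by (subst integrable_cong_AE[OF m _ eq]) auto
  have "(\<integral>x. (\<integral>y. f y \<partial>N x) \<partial>M) = (\<integral>x. enn2real (g x) - enn2real (h x) \<partial>M)"
    using m eq by (intro integral_cong_AE) auto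
  also have "\<dots> = enn2real (\<integral>\<^sup>+x. g x \<partial>M) - enn2real (\<integral>\<^sup>+x. h x \<partial>M)" using ig ih by simp
  also have "\<dots> = (\<integral>y. f y \<partial>(M \<bind> N))" using i by (simp add: real_lebesgue_integral_def G H)
  finally show "(\<integral>y. f y \<partial>(M \<bind> N)) = (\<integral>x. (\<integral>y. f y \<partial>N x) \<partial>M)" by simp
qed

lemma bind_integral_euclidean:
  fixes f :: "'a \<Rightarrow> 'b::euclidean_space"
  assumes f[measurable]: "f \<in> borel_measurable K" and N[measurable]: "N \<in> measurable M (subprob_algebra K)"
    and M: "space M \<noteq> {}"
    and i: "integrable (M \<bind> N) f"
  shows "AE x in M. integrable (N x) f" and "integrable M (\<lambda>x. \<integral>y. f y \<partial>N x)"
    and "(\<integral>y. f y \<partial>(M \<bind> N)) = (\<integral>x. (\<integral>y. f y \<partial>N x) \<partial>M)"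
proof -
  have "(\<integral>\<^sup>+y. ennreal (norm (f y)) \<partial>(M \<bind> N)) = (\<integral>\<^sup>+x. (\<integral>\<^sup>+y. ennreal (norm (f y)) \<partial>N x) \<partial>M)"
    by (rule nn_integral_bind[OF _ N]) measurable
  then have "(\<integral>\<^sup>+x. (\<integral>\<^sup>+y. ennreal (norm (f y)) \<partial>N x) \<partial>M) \<noteq> \<infinity>"
    using i by (auto simp: integrable_iff_bounded less_top)
  then have "AE x in M. (\<integral>\<^sup>+y. ennreal (norm (f y)) \<partial>N x) \<noteq> \<infinity>"
    by (intro nn_integral_PInf_AE) auto
  then show a: "AE x in M. integrable (N x) f"
    using AE_space
  proof eventually_elim
    case (elim x)
    have "sets (N x) = sets K" using subprob_measurableD(2)[OF N elim(2)] .
    then have "f \<in> borel_measurable (N x)" using f by (simp cong: measurable_cong_sets)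
    then show ?case using elim by (auto simp: integrable_iff_bounded less_top)
  qed
  have ib: "integrable (M \<bind> N) (\<lambda>y. f y \<bullet> b)" for b using i by simp
  have fb: "(\<lambda>y. f y \<bullet> b) \<in> borel_measurable K" for b by measurable
  note R = bind_integral_real[OF fb N ib]
  have c: "AE x in M. (\<integral>y. f y \<bullet> b \<partial>N x) = (\<integral>y. f y \<partial>N x) \<bullet> b" for b
    using a by eventually_elim simp
  have m: "(\<lambda>x. \<integral>y. f y \<partial>N x) \<in> borel_measurable M"
    by (rule measurable_compose[OF N integral_measurable_subprob_algebra]) simp
  have ic: "integrable M (\<lambda>x. (\<integral>y. f y \<partial>N x) \<bullet> b)" for b
    using R(1)[of b] m integrable_cong_AE[OF _ _ c[of b]] by (simp add: borel_measurable_integrable)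
  have "integrable M (\<lambda>x. \<Sum>b\<in>Basis. ((\<integral>y. f y \<partial>N x) \<bullet> b) *\<^sub>R b)"
    using ic by (intro Bochner_Integration.integrable_sum integrable_scaleR_left) auto
  then show im: "integrable M (\<lambda>x. \<integral>y. f y \<partial>N x)" by (simp add: euclidean_representation)
  show "(\<integral>y. f y \<partial>(M \<bind> N)) = (\<integral>x. (\<integral>y. f y \<partial>N x) \<partial>M)"
  proof (rule euclidean_eqI)
    fix b :: 'b assume "b \<in> Basis"
    have "(\<integral>y. f y \<partial>(M \<bind> N)) \<bullet> b = (\<integral>y. f y \<bullet> b \<partial>(M \<bind> N))" using i by simp
    also have "\<dots> = (\<integral>x. (\<integral>y. f y \<bullet> b \<partial>N x) \<partial>M)" by (rule R(2))
    also have "\<dots> = (\<integral>x. (\<integral>y. f y \<partial>N x) \<bullet> b \<partial>M)"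
      using m R(1)[of b] c[of b] by (intro integral_cong_AE) (auto simp: borel_measurable_integrable)
    also have "\<dots> = (\<integral>x. (\<integral>y. f y \<partial>N x) \<partial>M) \<bullet> b" using im by simp
    finally show "(\<integral>y. f y \<partial>(M \<bind> N)) \<bullet> b = (\<integral>x. (\<integral>y. f y \<partial>N x) \<partial>M) \<bullet> b" .
  qed
qed

lemma sample_stat_measurable:
  fixes T :: "'a \<Rightarrow> 'b::euclidean_space"
  assumes [measurable]: "T \<in> borel_measurable M"
  shows "sample_stat n T \<in> borel_measurable (iid n M)"
  unfolding sample_stat_def by measurable

lemma integral_iid_component:
  fixes f :: "'a \<Rightarrow> 'b::euclidean_space"
  assumes R: "prob_space R" and i: "i < n" and f: "integrable R f"
  shows "integrable (iid n R) (\<lambda>x. f (x i))" "(\<integral>x. f (x i) \<partial>iid n R) = (\<integral>x. f x \<partial>R)"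
proof -
  have d: "distr (iid n R) R (\<lambda>x. x i) = R" using R i by (intro distr_PiM_component) auto
  have m: "(\<lambda>x. x i) \<in> measurable (iid n R) R" using i by simp
  have "integrable (distr (iid n R) R (\<lambda>x. x i)) f" using f d by simp
  then show "integrable (iid n R) (\<lambda>x. f (x i))"
    using m f by (subst (asm) integrable_distr_eq) auto
  have "(\<integral>x. f x \<partial>distr (iid n R) R (\<lambda>x. x i)) = (\<integral>x. f (x i) \<partial>iid n R)"
    using m f by (intro integral_distr) auto
  then show "(\<integral>x. f (x i) \<partial>iid n R) = (\<integral>x. f x \<partial>R)" using d by simp
qed

lemma integral_sample_stat:
  fixes T :: "'a \<Rightarrow> 'b::euclidean_space"
  assumes R: "prob_space R" and n: "n \<ge> 1" and T: "integrable R T"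
  shows "integrable (iid n R) (sample_stat n T)" "(\<integral>x. sample_stat n T x \<partial>iid n R) = mean T R"
proof -
  note C = integral_iid_component[OF R _ T]
  show "integrable (iid n R) (sample_stat n T)"
    unfolding sample_stat_def
    by (intro integrable_scaleR_right Bochner_Integration.integrable_sum C(1)) simp
  have "(\<integral>x. sample_stat n T x \<partial>iid n R) = (1 / real n) *\<^sub>R (\<Sum>i<n. \<integral>x. T (x i) \<partial>iid n R)"
    using C(1) by (simp add: sample_stat_def)
  also have "\<dots> = mean T R" using C(2) n by (simp add: mean_def scaleR_conv_of_real sum_constant_scaleR)
  finally show "(\<integral>x. sample_stat n T x \<partial>iid n R) = mean T R" .
qed

text \<open>The sample density of the tilt is at most \<open>C ^ n\<close>. Through this bound
  integrability at \<open>R0\<close> passes to its bounded tilts.\<close>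

lemma iid_density_le:
  fixes u :: "'a \<Rightarrow> real"
  assumes R: "prob_space R" and u[measurable]: "u \<in> borel_measurable R" and b: "\<And>x. 0 \<le> u x" "\<And>x. u x \<le> C"
    and D: "prob_space (density R u)" and g[measurable]: "g \<in> borel_measurable (iid n R)"
  shows "(\<integral>\<^sup>+x. g x \<partial>iid n (density R u)) \<le> ennreal (C ^ n) * (\<integral>\<^sup>+x. g x \<partial>iid n R)"
proof -
  have "iid n (density R u) = density (iid n R) (\<lambda>x. \<Prod>i<n. ennreal (u (x i)))"
    by (intro PiM_density prob_space_imp_sigma_finite R D) auto
  then have "(\<integral>\<^sup>+x. g x \<partial>iid n (density R u)) = (\<integral>\<^sup>+x. (\<Prod>i<n. ennreal (u (x i))) * g x \<partial>iid n R)"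
    by (simp add: nn_integral_density)
  also have "\<dots> \<le> (\<integral>\<^sup>+x. ennreal (C ^ n) * g x \<partial>iid n R)"
  proof (intro nn_integral_mono mult_right_mono)
    fix x
    have "(\<Prod>i<n. ennreal (u (x i))) = ennreal (\<Prod>i<n. u (x i))" using b by (simp add: prod_ennreal)
    also have "(\<Prod>i<n. u (x i)) \<le> (\<Prod>i<n. C)" using b by (intro prod_mono) auto
    finally show "(\<Prod>i<n. ennreal (u (x i))) \<le> ennreal (C ^ n)" by (simp add: ennreal_leI)
  qed simp
  also have "\<dots> = ennreal (C ^ n) * (\<integral>\<^sup>+x. g x \<partial>iid n R)" by (rule nn_integral_cmult) simp
  finally show ?thesis .
qed

section \<open>Estimators\<close>

context exp_family
begin

lemma sets_iid: "R \<in> dominated lam \<Longrightarrow> sets (iid n R) = sets (iid n P0)"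
  by (intro sets_PiM_cong) (auto dest: dominatedD)

lemma sets_iid_lam: "sets (iid n lam) = sets (iid n P0)"
  by (intro sets_PiM_cong) (auto simp: sets_P0)

lemma space_iid_lam: "space (iid n lam) = space (iid n P0)"
  by (rule sets_eq_imp_space_eq[OF sets_iid_lam])

lemma space_iid: "R \<in> dominated lam \<Longrightarrow> space (iid n R) = space (iid n P0)"
  by (rule sets_eq_imp_space_eq[OF sets_iid])

lemma measurable_iid: "R \<in> dominated lam \<Longrightarrow> measurable (iid n R) N = measurable (iid n P0) N"
  by (rule measurable_cong_sets[OF sets_iid refl])

lemma prob_space_iid: "R \<in> dominated lam \<Longrightarrow> prob_space (iid n R)"
  by (intro prob_space_PiM dominatedD(1))

lemma estimator_dominated: "estimator n lam R \<Longrightarrow> x \<in> space (iid n P0) \<Longrightarrow> R x \<in> dominated lam"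
  unfolding estimator_def space_iid_lam by blast

text \<open>A real-valued version relative to \<open>P0\<close>, still jointly measurable; the
  factor \<open>l\<close> is the derivative of \<open>lam\<close> with respect to
  \<open>P0\<close>.\<close>

lemma estimator_density:
  assumes R: "estimator n lam R"
  obtains r :: "(nat \<Rightarrow> 'a) \<Rightarrow> 'a \<Rightarrow> real"
    where "case_prod r \<in> borel_measurable (iid n P0 \<Otimes>\<^sub>M P0)" "\<And>x y. 0 \<le> r x y"
      "\<And>x. x \<in> space (iid n P0) \<Longrightarrow> R x = density P0 (r x)"
proof -
  interpret P0: prob_space P0 by (rule prob_P0)
  from R obtain q :: "(nat \<Rightarrow> 'a) \<Rightarrow> 'a \<Rightarrow> ennreal"
    where q: "case_prod q \<in> borel_measurable (iid n lam \<Otimes>\<^sub>M lam)"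
      "\<And>x. x \<in> space (iid n P0) \<Longrightarrow> R x = density lam (q x)"
    unfolding estimator_def space_iid_lam by blast
  have qm[measurable]: "case_prod q \<in> borel_measurable (iid n P0 \<Otimes>\<^sub>M P0)"
    using q(1) by (simp add: measurable_cong_sets[OF sets_pair_measure_cong[OF sets_iid_lam sets_P0[symmetric]] refl])
  define l where "l = RN_deriv P0 lam"
  have l[measurable]: "l \<in> borel_measurable P0" unfolding l_def by simp
  have lam: "lam = density P0 l"
    unfolding l_def by (rule P0.density_RN_deriv[symmetric, OF ac_P0_lam]) (simp add: sets_P0)
  show ?thesis
  proof
    show "(\<lambda>(x, y). enn2real (l y * q x y)) \<in> borel_measurable (iid n P0 \<Otimes>\<^sub>M P0)" by measurable
    show "0 \<le> enn2real (l y * q x y)" for x y by simp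
    fix x assume x: "x \<in> space (iid n P0)"
    have [measurable]: "q x \<in> borel_measurable P0"
      using measurable_compose[OF measurable_Pair1'[OF x] qm] by simp
    have "R x = density P0 (\<lambda>y. l y * q x y)"
      unfolding q(2)[OF x] by (subst lam, rule density_density_eq) simp_all
    \<comment> \<open>The estimate has mass 1, so \<open>enn2real\<close>, which sends infinity to
      0, alters its density only on a null set.\<close>
    moreover have "AE y in P0. l y * q x y \<noteq> \<infinity>"
    proof -
      have "emeasure (R x) (space (R x)) = 1"
        using dominatedD(1)[OF estimator_dominated[OF R x]] by (rule prob_space.emeasure_space_1)
      then have "(\<integral>\<^sup>+y. l y * q x y \<partial>P0) = 1"
        using \<open>R x = density P0 (\<lambda>y. l y * q x y)\<close>
        by (simp add: emeasure_density cong: nn_integral_cong)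
      then show ?thesis by (intro nn_integral_PInf_AE) auto
    qed
    then have "AE y in P0. l y * q x y = ennreal (enn2real (l y * q x y))"
      by eventually_elim (simp add: less_top)
    then have "density P0 (\<lambda>y. l y * q x y) = density P0 (\<lambda>y. ennreal (enn2real (l y * q x y)))"
      by (intro density_cong) auto
    ultimately show "R x = density P0 (\<lambda>y. ennreal (enn2real (l y * q x y)))" by simp
  qed
qed

lemma estimator_kernel:
  assumes R: "estimator n lam R"
  shows "R \<in> measurable (iid n P0) (subprob_algebra P0)"
proof (rule measurable_subprob_algebra)
  fix x assume x: "x \<in> space (iid n P0)"
  note D = dominatedD[OF estimator_dominated[OF R x]]
  show "subprob_space (R x)" using D(1) by (rule prob_space_imp_subprob_space)
  show "sets (R x) = sets P0" by (rule D(3))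
next
  fix A assume A: "A \<in> sets P0"
  then have "(\<lambda>x. measure (R x) A) \<in> borel_measurable (iid n P0)"
    using R sets_P0 measurable_cong_sets[OF sets_iid_lam refl] unfolding estimator_def by blast
  then have "(\<lambda>x. ennreal (measure (R x) A)) \<in> borel_measurable (iid n P0)" by simp
  moreover have "emeasure (R x) A = ennreal (measure (R x) A)" if "x \<in> space (iid n P0)" for x
    using dominatedD(1)[OF estimator_dominated[OF R that]]
    by (intro finite_measure.emeasure_eq_measure) (simp add: prob_space_def)
  ultimately show "(\<lambda>x. emeasure (R x) A) \<in> borel_measurable (iid n P0)"
    by (simp cong: measurable_cong)
qed

text \<open>With the nonnegative integrand, the divergence is a parametrised nonnegative integral of
  a jointly measurable function.\<close>

lemma KL_measurable:
  assumes R: "estimator n lam R" and P: "P \<in> \<P>"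
  shows "(\<lambda>x. KL (R x) P) \<in> borel_measurable (iid n P0)"
proof -
  note DP = dominatedD[OF fam_dominated[OF P]]
  interpret P: prob_space P by (rule DP)
  obtain r :: "(nat \<Rightarrow> 'a) \<Rightarrow> 'a \<Rightarrow> real" where r:
    "case_prod r \<in> borel_measurable (iid n P0 \<Otimes>\<^sub>M P0)" "\<And>x y. 0 \<le> r x y"
    "\<And>x. x \<in> space (iid n P0) \<Longrightarrow> R x = density P0 (r x)"
    by (rule estimator_density[OF R]) blast
  have s: "sets (iid n P0 \<Otimes>\<^sub>M P) = sets (iid n P0 \<Otimes>\<^sub>M P0)"
    by (rule sets_pair_measure_cong[OF refl DP(3)])
  have [measurable]: "case_prod r \<in> borel_measurable (iid n P0 \<Otimes>\<^sub>M P)"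
    using r(1) measurable_cong_sets[OF s refl] by blast
  have [measurable]: "T \<in> borel_measurable P"
    using T_P0 measurable_cong_sets[OF DP(3) refl] by blast
  have "(\<lambda>x. \<integral>\<^sup>+y. ennreal (r x y / exp (ld P (T y)) * ln (r x y / exp (ld P (T y)))
      - r x y / exp (ld P (T y)) + 1) \<partial>P) \<in> borel_measurable (iid n P0)"
    by (rule P.borel_measurable_nn_integral) measurable
  moreover have "KL (R x) P = (\<integral>\<^sup>+y. ennreal (r x y / exp (ld P (T y)) * ln (r x y / exp (ld P (T y)))
      - r x y / exp (ld P (T y)) + 1) \<partial>P)" if x: "x \<in> space (iid n P0)" for x
  proof (rule KL_fam(2)[OF _ r(2) r(3)[OF x] _ P])
    show "r x \<in> borel_measurable P0" using measurable_compose[OF measurable_Pair1'[OF x] r(1)] by simp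
    show "prob_space (R x)" using dominatedD(1)[OF estimator_dominated[OF R x]] .
  qed
  ultimately show ?thesis by (simp cong: measurable_cong)
qed

section \<open>Means and divergences averaged over the sample\<close>

lemma KL_mean_integral:
  assumes R: "estimator n lam R" and R0: "R0 \<in> dominated lam" and i: "integrable (KL_mean n R0 R) T"
  shows "AE x in iid n R0. integrable (R x) T"
    and "integrable (iid n R0) (\<lambda>x. mean T (R x))"
    and "mean T (KL_mean n R0 R) = (\<integral>x. mean T (R x) \<partial>iid n R0)"
proof -
  interpret iid: prob_space "iid n R0" by (rule prob_space_iid[OF R0])
  have N: "R \<in> measurable (iid n R0) (subprob_algebra P0)"
    using estimator_kernel[OF R] measurable_iid[OF R0] by blast
  from bind_integral_euclidean[OF T_P0 N iid.not_empty i[unfolded KL_mean_def]]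
  show "AE x in iid n R0. integrable (R x) T"
    "integrable (iid n R0) (\<lambda>x. mean T (R x))"
    "mean T (KL_mean n R0 R) = (\<integral>x. mean T (R x) \<partial>iid n R0)"
    unfolding mean_def KL_mean_def by auto
qed

lemma expected_KL_finite:
  assumes R: "estimator n lam R" and R0: "R0 \<in> dominated lam" and P: "P \<in> \<P>"
    and fin: "expected_KL n R0 R P < \<infinity>"
  shows "AE x in iid n R0. KL (R x) P < \<infinity>"
    and "integrable (iid n R0) (\<lambda>x. enn2real (KL (R x) P))"
    and "(\<integral>x. enn2real (KL (R x) P) \<partial>iid n R0) = enn2real (expected_KL n R0 R P)"
proof -
  have m[measurable]: "(\<lambda>x. KL (R x) P) \<in> borel_measurable (iid n R0)"
    using KL_measurable[OF R P] measurable_iid[OF R0] by blast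
  show a: "AE x in iid n R0. KL (R x) P < \<infinity>"
    using nn_integral_PInf_AE[OF m] fin by (auto simp: expected_KL_def less_top)
  have e: "(\<integral>\<^sup>+x. ennreal (enn2real (KL (R x) P)) \<partial>iid n R0) = expected_KL n R0 R P"
    unfolding expected_KL_def using a by (intro nn_integral_cong_AE) (auto elim!: eventually_mono)
  show "integrable (iid n R0) (\<lambda>x. enn2real (KL (R x) P))"
    using e fin by (auto simp: integrable_iff_bounded)
  show "(\<integral>x. enn2real (KL (R x) P) \<partial>iid n R0) = enn2real (expected_KL n R0 R P)"
    using e by (simp add: integral_eq_nn_integral)
qed

lemma KL_change_AE:
  assumes R: "estimator n lam R" and R0: "R0 \<in> dominated lam" and i: "integrable (KL_mean n R0 R) T"
    and P: "P \<in> \<P>" and fin: "expected_KL n R0 R P < \<infinity>"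
  shows "AE x in iid n R0. \<forall>P'\<in>\<P>. KL (R x) P' < \<infinity> \<and>
    enn2real (KL (R x) P') = enn2real (KL (R x) P) + ld P (mean T (R x)) - ld P' (mean T (R x))"
  using KL_mean_integral(1)[OF R R0 i] expected_KL_finite(1)[OF R R0 P fin] AE_space
proof eventually_elim
  case (elim x)
  then have "R x \<in> dominated lam" using estimator_dominated[OF R] space_iid[OF R0] by blast
  from KL_change[OF this elim(1) P _ elim(2)] show ?case by blast
qed

lemma integrable_ld:
  assumes "prob_space M" "integrable M f"
  shows "integrable M (\<lambda>x. ld P (f x))" "(\<integral>x. ld P (f x) \<partial>M) = ld P (\<integral>x. f x \<partial>M)"
proof -
  interpret prob_space M by fact
  show "integrable M (\<lambda>x. ld P (f x))" "(\<integral>x. ld P (f x) \<partial>M) = ld P (\<integral>x. f x \<partial>M)"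
    using assms(2) by (auto simp: ld_def prob_space)
qed

text \<open>The correction is affine in the mean of the estimate, so averaging over the sample
  replaces that mean by the mean of \<open>T\<close> under the KL mean.\<close>

lemma expected_KL_change:
  assumes R: "estimator n lam R" and R0: "R0 \<in> dominated lam" and i: "integrable (KL_mean n R0 R) T"
    and P: "P \<in> \<P>" and fin: "expected_KL n R0 R P < \<infinity>" and P': "P' \<in> \<P>"
  shows "expected_KL n R0 R P' < \<infinity>"
    and "enn2real (expected_KL n R0 R P') = enn2real (expected_KL n R0 R P)
      + ld P (mean T (KL_mean n R0 R)) - ld P' (mean T (KL_mean n R0 R))"
proof -
  let ?M = "iid n R0"
  let ?k = "\<lambda>P x. enn2real (KL (R x) P)"
  let ?f = "\<lambda>x. ?k P x + ld P (mean T (R x)) - ld P' (mean T (R x))"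
  note E = expected_KL_finite[OF R R0 P fin] and K = KL_mean_integral[OF R R0 i]
  note L = integrable_ld[OF prob_space_iid[OF R0] K(2)]
  have m[measurable]: "(\<lambda>x. KL (R x) P') \<in> borel_measurable ?M"
    using KL_measurable[OF R P'] measurable_iid[OF R0] by blast
  have c: "AE x in ?M. KL (R x) P' = ennreal (?f x)" and c': "AE x in ?M. 0 \<le> ?f x"
  proof -
    have "AE x in ?M. KL (R x) P' < \<infinity> \<and> enn2real (KL (R x) P') = ?f x"
      using KL_change_AE[OF R R0 i P fin] by eventually_elim (use P' in blast)
    then show "AE x in ?M. KL (R x) P' = ennreal (?f x)" "AE x in ?M. 0 \<le> ?f x"
      by (eventually_elim, metis ennreal_enn2real infinity_ennreal_def,
        eventually_elim, metis enn2real_nonneg)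
  qed
  have f: "integrable ?M ?f" using E(2) L(1) by auto
  have "expected_KL n R0 R P' = (\<integral>\<^sup>+x. ennreal (?f x) \<partial>?M)"
    unfolding expected_KL_def using c by (rule nn_integral_cong_AE)
  also have "\<dots> = ennreal (\<integral>x. ?f x \<partial>?M)" by (rule nn_integral_eq_integral[OF f c'])
  finally have e: "expected_KL n R0 R P' = ennreal (\<integral>x. ?f x \<partial>?M)" .
  then show "expected_KL n R0 R P' < \<infinity>" by simp
  have "(\<integral>x. ?f x \<partial>?M) = enn2real (expected_KL n R0 R P)
      + ld P (mean T (KL_mean n R0 R)) - ld P' (mean T (KL_mean n R0 R))"
    using E(2,3) L K(3) by simp
  moreover have "0 \<le> (\<integral>x. ?f x \<partial>?M)" using c' by (rule integral_nonneg_AE)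
  ultimately show "enn2real (expected_KL n R0 R P') = enn2real (expected_KL n R0 R P)
      + ld P (mean T (KL_mean n R0 R)) - ld P' (mean T (KL_mean n R0 R))"
    using e by simp
qed

text \<open>The member sharing its mean with the KL mean minimises the expected divergence: the
  distribution mean is the projection of the KL mean.\<close>

lemma dist_mean_eq:
  assumes R: "estimator n lam R" and R0: "R0 \<in> dominated lam" and i: "integrable (KL_mean n R0 R) T"
    and fin: "dist_variance n \<P> R0 R < \<infinity>" and P': "P' \<in> \<P>" "mean T P' = mean T (KL_mean n R0 R)"
  shows "dist_mean_exists n T \<P> R0 R" "dist_mean n \<P> R0 R = P'"
    "dist_variance n \<P> R0 R = expected_KL n R0 R P'" "expected_KL n R0 R P' < \<infinity>"
proof -
  from fin obtain P where P: "P \<in> \<P>" "expected_KL n R0 R P < \<infinity>"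
    by (auto simp: dist_variance_def INF_less_iff)
  note C = expected_KL_change[OF R R0 i P]
  have *: "is_arg_min (expected_KL n R0 R) (\<lambda>P. P \<in> \<P>) Q \<longleftrightarrow> Q = P'" for Q
    using C P'(2)
    by (intro unique_arg_min[OF P'(1), where
      c = "enn2real (expected_KL n R0 R P) + ld P (mean T (KL_mean n R0 R))"]) simp
  show eq: "dist_mean n \<P> R0 R = P'" unfolding dist_mean_def by (rule arg_min_eqI[OF *])
  show f: "expected_KL n R0 R P' < \<infinity>" using C(1)[OF P'(1)] .
  show "dist_mean_exists n T \<P> R0 R"
    unfolding dist_mean_exists_def eq has_mean_in_def using f i imageI[OF P'(1), of "mean T"] P'(2)
    by (auto simp: *)
  have "is_arg_min (expected_KL n R0 R) (\<lambda>P. P \<in> \<P>) P'" using * by simp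
  then have "expected_KL n R0 R P' \<le> expected_KL n R0 R Q" if "Q \<in> \<P>" for Q
    using that by (auto simp: is_arg_min_def not_less)
  then show "dist_variance n \<P> R0 R = expected_KL n R0 R P'"
    unfolding dist_variance_def using P'(1) by (intro antisym INF_lower INF_greatest)
qed

end

section \<open>Admissible sampling distributions\<close>

context exp_family
begin

section \<open>Boundary members as the common form of both kinds of estimate\<close>

lemma fam_boundary_member:
  assumes P: "P \<in> \<P>" shows "boundary_member lam T \<P> (mean T P) P"
proof -
  have "KL P P = 0" by (rule KL_same_0[OF dominatedD(1)[OF fam_dominated[OF P]]])
  then have "(INF Q\<in>\<P>. KL P Q) \<le> 0" using INF_lower[OF P, of "KL P"] by simp
  then show ?thesis using P fam_dominated fam_integrable by (simp add: boundary_member_def)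
qed

text \<open>A member of the family is itself a boundary member, so the two definitions of the
  estimate merge. Later arguments use only that the estimate has mean \<open>t\<close> and that its
  divergences from the family have infimum zero.\<close>

lemma MLE_boundary_member:
  assumes "is_MLE n lam T \<P> Phat \<or> is_extended_MLE n lam T \<P> Phat"
  shows "AE x in iid n lam. boundary_member lam T \<P> (sample_stat n T x) (Phat x)"
    and "estimator n lam Phat"
proof -
  have m: "boundary_member lam T \<P> (mean T P) (member_with_mean T \<P> (mean T P))" if P: "P \<in> \<P>" for P
    using fam_boundary_member[OF P] P by (simp add: member_with_mean_mean)
  show "AE x in iid n lam. boundary_member lam T \<P> (sample_stat n T x) (Phat x)"
    using assms
  proof
    assume "is_MLE n lam T \<P> Phat"
    then have "AE x in iid n lam. sample_stat n T x \<in> mean T ` \<P> \<and>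
      Phat x = member_with_mean T \<P> (sample_stat n T x)" by (simp add: is_MLE_def)
    then show ?thesis by eventually_elim (use m in auto)
  next
    assume "is_extended_MLE n lam T \<P> Phat"
    then have "AE x in iid n lam.
      (if sample_stat n T x \<in> mean T ` \<P>
       then Phat x = member_with_mean T \<P> (sample_stat n T x)
       else boundary_member lam T \<P> (sample_stat n T x) (Phat x))" by (simp add: is_extended_MLE_def)
    then show ?thesis by eventually_elim (use m in \<open>auto split: if_splits\<close>)
  qed
  show "estimator n lam Phat" using assms by (auto simp: is_MLE_def is_extended_MLE_def)
qed

text \<open>Since \<open>KL Q Q = 0\<close>, a boundary member is its own extended
  projection.\<close>

lemma extended_proj_boundary_member:
  assumes "boundary_member lam T \<P> t Q"
  shows "extended_proj lam T \<P> Q Q"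
  using assms KL_same_0[of Q] by (auto simp: boundary_member_def extended_proj_def dominated_def)

lemma admissibleD:
  assumes "R0 \<in> admissible n lam T \<P> Es"
  shows "R0 \<in> dominated lam" "full_support lam R0" "absolutely_continuous R0 lam" "integrable R0 T"
    "\<exists>P\<in>\<P>. mean T P = mean T R0"
    "\<And>P. P \<in> \<P> \<Longrightarrow> KL R0 P < \<infinity>"
    "\<And>R. R \<in> Es \<Longrightarrow> dist_variance n \<P> R0 R < \<infinity>"
    "\<And>R. R \<in> Es \<Longrightarrow> integrable (KL_mean n R0 R) T"
proof -
  show d: "R0 \<in> dominated lam" and f: "full_support lam R0" and i: "integrable R0 T"
    and "\<And>R. R \<in> Es \<Longrightarrow> dist_variance n \<P> R0 R < \<infinity>"
    and "\<And>R. R \<in> Es \<Longrightarrow> integrable (KL_mean n R0 R) T"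
    using assms by (auto simp: admissible_def has_mean_in_def)
  show "absolutely_continuous R0 lam" by (rule full_support_imp_ac[OF sigma_finite_lam d f])
  show "\<exists>P\<in>\<P>. mean T P = mean T R0"
    using assms by (auto simp: admissible_def has_mean_in_def image_iff)
  have e: "KL_proj_exists \<P> R0" using assms by (simp add: admissible_def)
  then obtain Q where Q: "\<And>Q'. is_arg_min (KL R0) (\<lambda>P. P \<in> \<P>) Q' \<longleftrightarrow> Q' = Q"
    unfolding KL_proj_exists_def by metis
  then have "KL_proj \<P> R0 = Q" unfolding KL_proj_def by (rule arg_min_eqI)
  then have "KL R0 Q < \<infinity>" using e by (simp add: KL_proj_exists_def)
  moreover have "Q \<in> \<P>" using Q[of Q] by (simp add: is_arg_min_def)
  ultimately show "KL R0 P < \<infinity>" if "P \<in> \<P>" for P using KL_change(1)[OF d i _ that] by blast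
qed

lemma KL_proj_admissible:
  assumes R0: "R0 \<in> admissible n lam T \<P> Es" and P: "P \<in> \<P>" "mean T P = mean T R0"
  shows "KL_proj \<P> R0 = P"
  using KL_proj_eq(2)[OF admissibleD(1,4)[OF R0] P(1) admissibleD(6)[OF R0 P(1)] P] .

lemma mean_KL_mean_MLE:
  assumes n: "n \<ge> 1" and mle: "is_MLE n lam T \<P> Phat \<or> is_extended_MLE n lam T \<P> Phat"
    and R0: "R0 \<in> admissible n lam T \<P> Es" and "Phat \<in> Es"
  shows "mean T (KL_mean n R0 Phat) = mean T R0"
proof -
  note A = admissibleD[OF R0]
  note B = MLE_boundary_member[OF mle]
  have "mean T (KL_mean n R0 Phat) = (\<integral>x. mean T (Phat x) \<partial>iid n R0)"
    by (rule KL_mean_integral(3)[OF B(2) A(1) A(8)[OF \<open>Phat \<in> Es\<close>]])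
  also have "\<dots> = (\<integral>x. sample_stat n T x \<partial>iid n R0)"
  proof (rule integral_cong_AE)
    show "(\<lambda>x. mean T (Phat x)) \<in> borel_measurable (iid n R0)"
      using KL_mean_integral(2)[OF B(2) A(1) A(8)[OF \<open>Phat \<in> Es\<close>]] by simp
    show "sample_stat n T \<in> borel_measurable (iid n R0)"
      by (rule sample_stat_measurable) (use A(4) in simp)
    show "AE x in iid n R0. mean T (Phat x) = sample_stat n T x"
      using B(1) unfolding AE_iid[OF A(1,3)] by eventually_elim (simp add: boundary_member_def)
  qed
  also have "\<dots> = mean T R0" by (rule integral_sample_stat(2)[OF dominatedD(1)[OF A(1)] n A(4)])
  finally show ?thesis .
qed

lemma MLE_dist_unbiased:
  assumes n: "n \<ge> 1" and mle: "is_MLE n lam T \<P> Phat \<or> is_extended_MLE n lam T \<P> Phat"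
    and Phat: "Phat \<in> Es"
  shows "dist_unbiased n T \<P> (admissible n lam T \<P> Es) Phat"
  unfolding dist_unbiased_def
proof
  fix R0 assume R0: "R0 \<in> admissible n lam T \<P> Es"
  note A = admissibleD[OF R0]
  obtain P where P: "P \<in> \<P>" "mean T P = mean T R0" using A(5) by blast
  have m: "mean T P = mean T (KL_mean n R0 Phat)"
    using mean_KL_mean_MLE[OF n mle R0 Phat] P by simp
  note D = dist_mean_eq[OF MLE_boundary_member(2)[OF mle] A(1) A(8)[OF Phat] A(7)[OF Phat] P(1) m]
  show "dist_mean_exists n T \<P> R0 Phat \<and> dist_mean n \<P> R0 Phat = KL_proj \<P> R0"
    using D(1,2) KL_proj_admissible[OF R0 P] by simp
qed

text \<open>Turns equality of two arg mins into an equation linear in the estimate: the member with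
  the mean of the KL mean is the distribution mean, the member with the mean of \<open>R0\<close> is
  the projection, and these coincide.\<close>

lemma mean_KL_mean_unbiased:
  assumes R: "estimator n lam R" and u: "dist_unbiased n T \<P> (admissible n lam T \<P> Es) R"
    and R0: "R0 \<in> admissible n lam T \<P> Es" and "R \<in> Es"
  shows "mean T (KL_mean n R0 R) = mean T R0"
proof -
  note A = admissibleD[OF R0]
  obtain P where P: "P \<in> \<P>" "mean T P = mean T R0" using A(5) by blast
  have U: "dist_mean_exists n T \<P> R0 R" "dist_mean n \<P> R0 R = KL_proj \<P> R0"
    using u R0 by (auto simp: dist_unbiased_def)
  then have "has_mean_in T \<P> (KL_mean n R0 R)" by (simp add: dist_mean_exists_def)
  then obtain P' where P': "P' \<in> \<P>" "mean T P' = mean T (KL_mean n R0 R)"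
    by (auto simp: has_mean_in_def image_iff)
  have "P' = P"
    using dist_mean_eq(2)[OF R A(1) A(8)[OF \<open>R \<in> Es\<close>] A(7)[OF \<open>R \<in> Es\<close>] P']
      U(2) KL_proj_admissible[OF R0 P] by simp
  then show ?thesis using P P' by simp
qed

text \<open>The tilt adds \<open>ln u\<close> to the log density, which is bounded because
  \<open>u\<close> lies between two positive constants.\<close>

lemma KL_density_finite:
  fixes u :: "'a \<Rightarrow> real"
  assumes R0: "R0 \<in> dominated lam" and P: "P \<in> \<P>" and fin: "KL R0 P < \<infinity>"
    and u[measurable]: "u \<in> borel_measurable R0" and b: "0 < c" "\<And>x. c \<le> u x" "\<And>x. u x \<le> C"
    and D: "prob_space (density R0 u)"
  shows "KL (density R0 u) P < \<infinity>"
proof -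
  note DR = dominatedD[OF R0]
  interpret R0: prob_space R0 by (rule DR(1))
  have u0: "0 < u x" for x using b(1) b(2)[of x] by simp
  let ?r = "dens R0"
  have [measurable]: "u \<in> borel_measurable P0" using u measurable_cong_sets[OF DR(3) refl] by blast
  have [measurable]: "?r \<in> borel_measurable R0" "T \<in> borel_measurable R0"
    using dens_measurable T_P0 measurable_cong_sets[OF DR(3) refl] by blast+
  have R0d: "R0 = density P0 ?r" by (rule density_dens[OF R0, symmetric])
  have e: "density R0 u = density P0 (\<lambda>x. ennreal (?r x * u x))"
    by (subst R0d, subst density_density_eq) (auto simp: ennreal_mult' dens_nonneg)
  have f: "integrable R0 (\<lambda>x. ln (?r x) - ld P (T x))"
    using fin KL_fam(1)[OF dens_measurable dens_nonneg R0d DR(1) P] by (auto split: if_splits)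
  \<comment> \<open>Splitting \<open>ln (?r x * u x)\<close> below needs \<open>?r x\<close>
    positive, which holds almost everywhere under \<open>R0\<close> itself.\<close>
  have "AE x in density P0 ?r. 0 < ?r x" by (subst AE_density) auto
  then have pos: "AE x in R0. 0 < ?r x" unfolding density_dens[OF R0] .
  have 1: "integrable R0 (\<lambda>x. u x * (ln (?r x) - ld P (T x)))"
    using f by (rule Bochner_Integration.integrable_bound[OF integrable_mult_right[of C]])
      (use b u0 in \<open>auto simp: abs_mult intro!: mult_right_mono order_trans[OF b(3) abs_ge_self] simp: abs_of_pos\<close>)
  have 2: "integrable R0 (\<lambda>x. u x * ln (u x))"
  proof (rule R0.integrable_const_bound[where B = "C * max \<bar>ln c\<bar> \<bar>ln C\<bar>"])
    show "AE x in R0. norm (u x * ln (u x)) \<le> C * max \<bar>ln c\<bar> \<bar>ln C\<bar>"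
    proof (rule AE_I2)
      fix x
      have "ln c \<le> ln (u x)" "ln (u x) \<le> ln C" using b(1) b(2)[of x] b(3)[of x] u0[of x] by auto
      then have "\<bar>ln (u x)\<bar> \<le> max \<bar>ln c\<bar> \<bar>ln C\<bar>" by linarith
      then show "norm (u x * ln (u x)) \<le> C * max \<bar>ln c\<bar> \<bar>ln C\<bar>"
        using b(3)[of x] u0[of x] by (auto simp: abs_mult intro!: mult_mono)
    qed
  qed simp
  have "integrable R0 (\<lambda>x. u x * (ln (?r x * u x) - ld P (T x)))"
  proof (rule integrable_cong_AE_imp[OF Bochner_Integration.integrable_add[OF 1 2]])
    show "AE x in R0. u x * (ln (?r x) - ld P (T x)) + u x * ln (u x) = u x * (ln (?r x * u x) - ld P (T x))"
      using pos by eventually_elim (simp add: ln_mult u0 algebra_simps)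
  qed measurable
  then have "integrable (density R0 u) (\<lambda>x. ln (?r x * u x) - ld P (T x))"
    by (subst integrable_density) (auto simp: less_imp_le[OF u0])
  then show ?thesis
    by (subst KL_fam(1)[OF _ _ e D P]) (auto simp: dens_nonneg less_imp_le[OF u0])
qed

text \<open>The lower bound on \<open>u\<close> preserves full support and keeps \<open>ln u\<close>
  bounded from below; the upper bound preserves integrability. Only the condition that the new mean
  belongs to a member has to be imposed.\<close>

lemma admissible_density:
  fixes u :: "'a \<Rightarrow> real"
  assumes R0: "R0 \<in> admissible n lam T \<P> Es" and Es: "\<And>R. R \<in> Es \<Longrightarrow> estimator n lam R"
    and u[measurable]: "u \<in> borel_measurable R0" and b: "0 < c" "\<And>x. c \<le> u x" "\<And>x. u x \<le> C"
    and D: "prob_space (density R0 u)" and P: "P \<in> \<P>" "mean T P = mean T (density R0 u)"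
  shows "density R0 u \<in> admissible n lam T \<P> Es"
proof -
  note A = admissibleD[OF R0] and DR = dominatedD[OF admissibleD(1)[OF R0]]
  have u0: "0 < u x" for x using b(1) b(2)[of x] by simp
  then have un: "\<not> u x \<le> 0" for x by (simp add: not_le)
  let ?D = "density R0 u"
  have "absolutely_continuous R0 ?D" by (rule absolutely_continuousI_density) simp
  then have dom: "?D \<in> dominated lam"
    using D DR A(1) by (auto simp: dominated_def absolutely_continuous_def)
  have "absolutely_continuous ?D R0"
    by (auto simp: absolutely_continuous_def null_sets_density_iff AE_iff_null_sets un ennreal_eq_0_iff)
  then have acl: "absolutely_continuous ?D lam" using A(3) by (auto simp: absolutely_continuous_def)
  have fs: "full_support lam ?D" by (rule full_supportI[OF sigma_finite_lam dom acl])
  have iT: "integrable ?D T"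
  proof -
    have [measurable]: "T \<in> borel_measurable R0" using A(4) by simp
    have "integrable R0 (\<lambda>x. u x *\<^sub>R T x)"
      using A(4) by (rule Bochner_Integration.integrable_bound[OF integrable_scaleR_right[of C]])
        (use b u0 in \<open>auto intro!: mult_right_mono order_trans[OF b(3) abs_ge_self] simp: abs_of_pos\<close>)
    then show ?thesis using A(4) by (subst integrable_density) (auto simp: less_imp_le[OF u0])
  qed
  have KLf: "KL ?D P < \<infinity>" by (rule KL_density_finite[OF A(1) P(1) A(6)[OF P(1)] u b D])
  \<comment> \<open>Both conditions on an estimator are finiteness of a nonnegative integral over
    the sample: of the divergence, and of the inner integral of \<open>norm (T y)\<close>.\<close>
  have bound: "(\<integral>\<^sup>+x. g x \<partial>iid n ?D) < \<infinity>"
    if g: "g \<in> borel_measurable (iid n P0)" and "(\<integral>\<^sup>+x. g x \<partial>iid n R0) < \<infinity>" for g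
  proof -
    have "g \<in> borel_measurable (iid n R0)" using g measurable_iid[OF A(1)] by blast
    from iid_density_le[OF DR(1) u less_imp_le[OF u0] b(3) D this] that(2)
    show ?thesis by (auto simp: ennreal_mult_less_top intro: le_less_trans)
  qed
  have E: "dist_variance n \<P> ?D R < \<infinity> \<and> integrable (KL_mean n ?D R) T" if R: "R \<in> Es" for R
  proof
    from A(7)[OF R] obtain Q where Q: "Q \<in> \<P>" "expected_KL n R0 R Q < \<infinity>"
      by (auto simp: dist_variance_def INF_less_iff)
    have "expected_KL n ?D R Q < \<infinity>"
      using bound[OF KL_measurable[OF Es[OF R] Q(1)]] Q(2) by (simp add: expected_KL_def)
    then show "dist_variance n \<P> ?D R < \<infinity>"
      using Q(1) by (auto simp: dist_variance_def INF_less_iff)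
    have N: "R \<in> measurable (iid n Q') (subprob_algebra P0)" if "Q' \<in> dominated lam" for Q'
      using estimator_kernel[OF Es[OF R]] measurable_iid[OF that] by blast
    have nn: "(\<integral>\<^sup>+y. ennreal (norm (T y)) \<partial>KL_mean n Q' R)
        = (\<integral>\<^sup>+x. \<integral>\<^sup>+y. ennreal (norm (T y)) \<partial>R x \<partial>iid n Q')"
      and s: "sets (KL_mean n Q' R) = sets P0" if Q': "Q' \<in> dominated lam" for Q'
    proof -
      show "(\<integral>\<^sup>+y. ennreal (norm (T y)) \<partial>KL_mean n Q' R)
        = (\<integral>\<^sup>+x. \<integral>\<^sup>+y. ennreal (norm (T y)) \<partial>R x \<partial>iid n Q')"
        unfolding KL_mean_def by (rule nn_integral_bind[OF _ N[OF Q']]) measurable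
      show "sets (KL_mean n Q' R) = sets P0"
        unfolding KL_mean_def
        by (rule sets_bind[OF sets_kernel[OF N[OF Q']] prob_space.not_empty[OF prob_space_iid[OF Q']]])
    qed
    have "(\<lambda>x. \<integral>\<^sup>+y. ennreal (norm (T y)) \<partial>R x) \<in> borel_measurable (iid n P0)"
      by (rule measurable_compose[OF estimator_kernel[OF Es[OF R]] nn_integral_measurable_subprob_algebra])
        simp
    from bound[OF this] A(8)[OF R]
    have "(\<integral>\<^sup>+y. ennreal (norm (T y)) \<partial>KL_mean n ?D R) < \<infinity>"
      by (simp add: nn[OF dom] nn[OF A(1)] integrable_iff_bounded)
    moreover have "T \<in> borel_measurable (KL_mean n ?D R)"
      using T_P0 measurable_cong_sets[OF s[OF dom] refl] by blast
    ultimately show "integrable (KL_mean n ?D R) T" by (simp add: integrable_iff_bounded)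
  qed
  have "has_mean_in T \<P> ?D" using iT P by (auto simp: has_mean_in_def image_iff) metis
  then show ?thesis
    using dom fs KL_proj_eq(1)[OF dom iT P(1) KLf P] E by (auto simp: admissible_def)
qed

end

section \<open>Polynomials vanishing at sample means\<close>

text \<open>By continuity, vanishing at almost every sample average forces vanishing at every
  average of \<open>n\<close> support points. These contain all sums of at most \<open>n\<close>
  increments around a base point, enough to determine a polynomial of degree \<open>n\<close> on the
  affine hull of the support. A mean weighted by \<open>u\<close> lies in that hull as soon as
  \<open>u\<close> has integral 1; \<open>u\<close> may change sign.\<close>

lemma poly_map_vanishes_means:
  fixes e :: "'a \<Rightarrow> 'e::euclidean_space"
  assumes M: "prob_space M" and n: "n \<ge> 1" and e[measurable]: "e \<in> borel_measurable M"
    and f: "poly_map n f"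
    and van: "AE x in iid n M. f ((1 / real n) *\<^sub>R (\<Sum>i<n. e (x i))) = 0"
    and u: "integrable M u" "(\<integral>x. u x \<partial>M) = 1" and ue: "integrable M (\<lambda>x. u x *\<^sub>R e x)"
  shows "f (\<integral>x. u x *\<^sub>R e x \<partial>M) = 0"
proof -
  interpret M: prob_space M by fact
  interpret P: product_prob_space "\<lambda>_::nat. M" "{..<n}" by standard
  have ne: "{..<n} \<noteq> {}" using n by (metis lessThan_iff empty_iff less_le_trans zero_less_one)
  \<comment> \<open>The topological support of the law of \<open>e\<close>; a countable base makes
    its complement a null event.\<close>
  define S where "S = {z. \<forall>U. open U \<longrightarrow> z \<in> U \<longrightarrow> emeasure M (e -` U \<inter> space M) \<noteq> 0}"
  have S: "AE x in M. e x \<in> S"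
  proof -
    obtain B :: "'e set set" where B: "countable B" "topological_basis B"
      using ex_countable_basis by auto
    let ?B = "{U\<in>B. emeasure M (e -` U \<inter> space M) = 0}"
    have "AE x in M. \<forall>U\<in>?B. e x \<notin> U"
    proof (subst AE_ball_countable)
      show "countable ?B" using B(1) by simp
      show "\<forall>U\<in>?B. AE x in M. e x \<notin> U"
      proof
        fix U assume "U \<in> ?B"
        then have "e -` U \<inter> space M \<in> null_sets M"
          using topological_basis_open[OF B(2)] by (intro null_setsI) auto
        then have "AE x in M. x \<notin> e -` U \<inter> space M" by (rule AE_not_in)
        then show "AE x in M. e x \<notin> U" using AE_space by eventually_elim auto
      qed
    qed
    then show ?thesis
    proof eventually_elim
      case (elim x)
      show ?case unfolding S_def
      proof (intro CollectI allI impI notI)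
        fix U assume U: "open U" "e x \<in> U" and 0: "emeasure M (e -` U \<inter> space M) = 0"
        obtain V where V: "V \<in> B" "e x \<in> V" "V \<subseteq> U" using topological_basisE[OF B(2) U] by blast
        have "emeasure M (e -` V \<inter> space M) \<le> emeasure M (e -` U \<inter> space M)"
          using V U by (intro emeasure_mono) auto
        then show False using 0 V elim by auto
      qed
    qed
  qed
  have avg: "f ((1 / real n) *\<^sub>R (\<Sum>i<n. s i)) = 0" if s: "\<And>i. i < n \<Longrightarrow> s i \<in> S" for s
  proof (rule ccontr)
    let ?a = "(1 / real n) *\<^sub>R (\<Sum>i<n. s i)"
    assume "f ?a \<noteq> 0"
    then have "open (f -` (- {0}))" "?a \<in> f -` (- {0})"
      using open_vimage[OF _ poly_map_continuous[OF f], of "- {0}"] by auto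
    then obtain d where d: "d > 0" "\<And>z. dist z ?a < d \<Longrightarrow> f z \<noteq> 0"
      unfolding open_dist by auto
    \<comment> \<open>Samples whose \<open>i\<close>-th value lies within \<open>d\<close> of
      \<open>s i\<close>. Their averages stay within \<open>d\<close> of \<open>?a\<close>, and the
      event has positive probability as a product of neighbourhoods of support points.\<close>
    let ?A = "Pi\<^sub>E {..<n} (\<lambda>i. e -` ball (s i) d \<inter> space M)"
    have mA: "?A \<in> sets (iid n M)" by (intro sets_PiM_I_finite) auto
    have "emeasure (iid n M) ?A = (\<Prod>i<n. emeasure M (e -` ball (s i) d \<inter> space M))"
      by (intro P.emeasure_PiM) auto
    moreover have "\<dots> \<noteq> 0" using s d(1) by (auto simp: S_def prod_zero_iff)
    moreover have "AE x in iid n M. x \<notin> ?A"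
      using van
    proof eventually_elim
      case (elim x)
      show ?case
      proof
        assume x: "x \<in> ?A"
        have "(1 / real n) *\<^sub>R (\<Sum>i<n. e (x i)) - ?a = (1 / real n) *\<^sub>R (\<Sum>i<n. e (x i) - s i)"
          by (simp add: sum_subtractf scaleR_diff_right)
        then have "dist ((1 / real n) *\<^sub>R (\<Sum>i<n. e (x i))) ?a = (1 / real n) * norm (\<Sum>i<n. e (x i) - s i)"
          by (simp add: dist_norm)
        also have "\<dots> \<le> (1 / real n) * (\<Sum>i<n. norm (e (x i) - s i))"
          by (intro mult_left_mono norm_sum) simp
        also have "\<dots> < (1 / real n) * (\<Sum>i<n. d)"
        proof (intro mult_strict_left_mono sum_strict_mono)
          fix i assume i: "i \<in> {..<n}"
          then have "x i \<in> e -` ball (s i) d \<inter> space M" using x by (rule PiE_mem[rotated])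
          then show "norm (e (x i) - s i) < d" by (simp add: dist_norm norm_minus_commute)
        qed (use n ne in auto)
        also have "\<dots> = d" using n by simp
        finally show False using d(2) elim by blast
      qed
    qed
    then have "emeasure (iid n M) ?A = 0"
      using AE_iff_null_sets[OF mA] by (simp add: null_sets_def)
    ultimately show False by simp
  qed
  have "\<exists>s0. s0 \<in> S"
  proof (rule ccontr)
    assume "\<nexists>s0. s0 \<in> S"
    then have "AE x in M. False" using S by simp
    then show False by simp
  qed
  then obtain s0 where s0: "s0 \<in> S" by blast
  let ?W = "(\<lambda>s. (1 / real n) *\<^sub>R (s - s0)) ` S"
  have lattice: "f (s0 + sum_list ws) = 0" if ws: "set ws \<subseteq> ?W" "length ws \<le> n" for ws
  proof -
    define s where "s i = (if i < length ws then s0 + real n *\<^sub>R (ws ! i) else s0)" for i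
    have "s i \<in> S" for i
    proof (cases "i < length ws")
      case True
      then have "ws ! i \<in> ?W" using ws nth_mem by blast
      then show ?thesis using True n by (auto simp: s_def)
    qed (simp add: s_def s0)
    then have z: "f ((1 / real n) *\<^sub>R (\<Sum>i<n. s i)) = 0" by (rule avg)
    have "(\<Sum>i<n. s i) = (\<Sum>i<n. s0 + (if i < length ws then real n *\<^sub>R (ws ! i) else 0))"
      by (intro sum.cong) (auto simp: s_def)
    also have "\<dots> = real n *\<^sub>R s0 + (\<Sum>i<n. if i < length ws then real n *\<^sub>R (ws ! i) else 0)"
      by (simp add: sum.distrib sum_constant_scaleR)
    also have "(\<Sum>i<n. if i < length ws then real n *\<^sub>R (ws ! i) else 0) = (\<Sum>i<length ws. real n *\<^sub>R (ws ! i))"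
      using ws(2) by (intro sum.mono_neutral_cong_right) auto
    also have "\<dots> = real n *\<^sub>R sum_list ws"
      by (simp add: sum_list_sum_nth scaleR_sum_right atLeast0LessThan)
    finally have "(1 / real n) *\<^sub>R (\<Sum>i<n. s i) = s0 + sum_list ws"
      using n by (simp add: scaleR_add_right)
    then show ?thesis using z by simp
  qed
  let ?z = "\<integral>x. u x *\<^sub>R e x \<partial>M"
  \<comment> \<open>The component \<open>w\<close> orthogonal to the span is orthogonal to
    \<open>e x - s0\<close> almost everywhere; integrating against \<open>u\<close> shows that it is
    orthogonal to \<open>?z - s0\<close>, hence to itself.\<close>
  have "?z - s0 \<in> span ?W"
  proof -
    obtain y w where yw: "y \<in> span ?W" "\<And>v. v \<in> span ?W \<Longrightarrow> orthogonal w v" "?z - s0 = y + w"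
      by (rule orthogonal_subspace_decomp_exists[of ?W "?z - s0"]) blast
    have "w \<bullet> (s - s0) = 0" if "s \<in> S" for s
    proof -
      have "orthogonal w ((1 / real n) *\<^sub>R (s - s0))" using that by (intro yw(2) span_base) auto
      then show ?thesis using n by (simp add: orthogonal_def)
    qed
    then have "AE x in M. u x * (w \<bullet> (e x - s0)) = 0" using S by (auto elim!: eventually_mono)
    then have "(\<integral>x. u x * (w \<bullet> (e x - s0)) \<partial>M) = 0"
      using u(1) by (subst integral_cong_AE[where g="\<lambda>_. 0"]) auto
    moreover have "(\<integral>x. u x * (w \<bullet> (e x - s0)) \<partial>M) = (\<integral>x. u x * (w \<bullet> e x) - u x * (w \<bullet> s0) \<partial>M)"
      by (intro Bochner_Integration.integral_cong) (auto simp: inner_diff_right right_diff_distrib)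
    moreover have "integrable M (\<lambda>x. u x * (w \<bullet> e x))" "(\<integral>x. u x * (w \<bullet> e x) \<partial>M) = w \<bullet> ?z"
      using integrable_inner_right[of w M "\<lambda>x. u x *\<^sub>R e x"]
        integral_inner_right[of w M "\<lambda>x. u x *\<^sub>R e x"] ue by simp_all
    then have "(\<integral>x. u x * (w \<bullet> e x) - u x * (w \<bullet> s0) \<partial>M) = w \<bullet> ?z - w \<bullet> s0"
      using u by simp
    ultimately have "w \<bullet> (?z - s0) = 0" by (simp add: inner_diff_right)
    then have "w \<bullet> w = 0" using yw by (simp add: inner_add_right orthogonal_def)
    then show ?thesis using yw by simp
  qed
  from poly_map_vanishes_span[OF f lattice this] show ?thesis by simp
qed

text \<open>\<open>h\<close> is the conditional expectation of \<open>H\<close> given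
  \<open>X\<close>, as a function of the value of \<open>X\<close>, obtained as a derivative of
  image measures. Working with nonnegative integrals admits arbitrary weights \<open>w\<close>, in
  particular unbounded likelihood ratios.\<close>

lemma conditional_factor:
  fixes X :: "'a \<Rightarrow> 'b::euclidean_space"
  assumes M: "prob_space M" and X[measurable]: "X \<in> borel_measurable M"
    and H[measurable]: "H \<in> borel_measurable M" and fin: "(\<integral>\<^sup>+x. H x \<partial>M) < \<infinity>"
  obtains h :: "'b \<Rightarrow> real" where "h \<in> borel_measurable borel" "\<And>y. 0 \<le> h y"
    "\<And>w. w \<in> borel_measurable borel \<Longrightarrow>
      (\<integral>\<^sup>+x. H x * w (X x) \<partial>M) = (\<integral>\<^sup>+x. ennreal (h (X x)) * w (X x) \<partial>M)"
proof -
  interpret M: prob_space M by fact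
  define \<rho> \<nu> where "\<rho> = distr M borel X" and "\<nu> = distr (density M H) borel X"
  interpret \<rho>: prob_space \<rho> unfolding \<rho>_def by (rule M.prob_space_distr) simp
  have f\<nu>: "finite_measure \<nu>"
  proof
    have "emeasure \<nu> (space \<nu>) = (\<integral>\<^sup>+x. H x \<partial>M)"
      unfolding \<nu>_def by (subst emeasure_distr) (auto simp: emeasure_density cong: nn_integral_cong)
    then show "emeasure \<nu> (space \<nu>) \<noteq> \<infinity>" using fin by auto
  qed
  have ac: "absolutely_continuous \<rho> \<nu>"
    unfolding absolutely_continuous_def
  proof
    fix A assume "A \<in> null_sets \<rho>"
    then have A: "A \<in> sets borel" "X -` A \<inter> space M \<in> null_sets M"
      by (auto simp: \<rho>_def null_sets_def emeasure_distr)
    then have "X -` A \<inter> space M \<in> null_sets (density M H)"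
      using absolutely_continuousI_density[OF H] by (auto simp: absolutely_continuous_def)
    then show "A \<in> null_sets \<nu>" using A(1) by (auto simp: \<nu>_def null_sets_def emeasure_distr)
  qed
  have s: "sets \<nu> = sets \<rho>" by (simp add: \<rho>_def \<nu>_def)
  define h where "h y = enn2real (RN_deriv \<rho> \<nu> y)" for y
  have hm[measurable]: "h \<in> borel_measurable borel"
  proof -
    have "h \<in> borel_measurable \<rho>" unfolding h_def by measurable
    moreover have "sets \<rho> = sets borel" by (simp add: \<rho>_def)
    ultimately show ?thesis using measurable_cong_sets[of \<rho> borel borel borel] by blast
  qed
  have "AE y in \<rho>. RN_deriv \<rho> \<nu> y \<noteq> \<infinity>"
    by (rule \<rho>.RN_deriv_finite[OF _ ac s]) (rule finite_measure.sigma_finite_measure[OF f\<nu>])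
  then have "AE y in \<rho>. RN_deriv \<rho> \<nu> y = ennreal (h y)"
    by eventually_elim (simp add: h_def less_top)
  then have "density \<rho> (RN_deriv \<rho> \<nu>) = density \<rho> h"
    by (intro density_cong) (auto simp: \<rho>_def)
  then have \<nu>: "\<nu> = density \<rho> h" using \<rho>.density_RN_deriv[OF ac s] by simp
  show ?thesis
  proof
    fix w :: "'b \<Rightarrow> ennreal" assume w[measurable]: "w \<in> borel_measurable borel"
    have "(\<integral>\<^sup>+x. H x * w (X x) \<partial>M) = (\<integral>\<^sup>+x. w (X x) \<partial>density M H)"
      by (rule nn_integral_density[symmetric]) simp_all
    also have "\<dots> = (\<integral>\<^sup>+y. w y \<partial>\<nu>)" unfolding \<nu>_def by (rule nn_integral_distr[symmetric]) simp_all
    also have "\<dots> = (\<integral>\<^sup>+y. ennreal (h y) * w y \<partial>\<rho>)"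
      unfolding \<nu> by (rule nn_integral_density) (simp_all add: \<rho>_def)
    also have "\<dots> = (\<integral>\<^sup>+x. ennreal (h (X x)) * w (X x) \<partial>M)"
      unfolding \<rho>_def by (rule nn_integral_distr) simp_all
    finally show "(\<integral>\<^sup>+x. H x * w (X x) \<partial>M) = (\<integral>\<^sup>+x. ennreal (h (X x)) * w (X x) \<partial>M)" .
  qed (rule hm, simp add: h_def)
qed

section \<open>Consequences of completeness\<close>

lemma integrable_Pair:
  fixes f :: "'a \<Rightarrow> 'b::euclidean_space" and g :: "'a \<Rightarrow> 'c::euclidean_space"
  assumes "integrable M f" "integrable M g"
  shows "integrable M (\<lambda>x. (f x, g x))" and "(\<integral>x. (f x, g x) \<partial>M) = (\<integral>x. f x \<partial>M, \<integral>x. g x \<partial>M)"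
proof -
  have 1: "bounded_linear (\<lambda>a::'b. (a, 0::'c))" and 2: "bounded_linear (\<lambda>a::'c. (0::'b, a))"
    by (intro bounded_linear_Pair bounded_linear_ident bounded_linear_zero)+
  have "integrable M (\<lambda>x. (f x, 0::'c) + (0::'b, g x))"
    by (intro Bochner_Integration.integrable_add integrable_bounded_linear[OF 1] integrable_bounded_linear[OF 2] assms)
  then show i: "integrable M (\<lambda>x. (f x, g x))" by simp
  show "(\<integral>x. (f x, g x) \<partial>M) = (\<integral>x. f x \<partial>M, \<integral>x. g x \<partial>M)"
    using integral_bounded_linear[OF bounded_linear_fst i] integral_bounded_linear[OF bounded_linear_snd i]
    by (simp add: prod_eq_iff)
qed

text \<open>Homogeneous of degree \<open>n\<close>, kept as a sum of products of linear forms so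
  that each form can be assigned its own observation. At \<open>(1, \<tau>)\<close> it becomes a
  polynomial of degree at most \<open>n\<close> in \<open>\<tau>\<close>.\<close>

definition hpoly :: "nat \<Rightarrow> (nat \<Rightarrow> 'e::euclidean_space) set \<Rightarrow> ((nat \<Rightarrow> 'e) \<Rightarrow> real) \<Rightarrow> 'e \<Rightarrow> real" where
  "hpoly n \<Phi> c z = (\<Sum>\<phi>\<in>\<Phi>. c \<phi> * (\<Prod>i<n. z \<bullet> \<phi> i))"

lemma poly_map_hpoly: "poly_map n (hpoly n \<Phi> c)"
  unfolding hpoly_def by (intro poly_map_sum poly_map_cmult poly_map_prod_inner)

text \<open>Independence: with one observation per linear form, the expectation of a product is the
  product of the forms at the mean. So the polynomial in the mean has an unbiased estimator that
  does not depend on \<open>Q\<close>.\<close>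

lemma hpoly_iid:
  fixes T :: "'a \<Rightarrow> 'b::euclidean_space" and \<Phi> :: "(nat \<Rightarrow> real \<times> 'b) set"
  assumes Q: "prob_space Q" and T: "integrable Q T"
  shows "integrable (iid n Q) (\<lambda>y. \<Sum>\<phi>\<in>\<Phi>. c \<phi> * (\<Prod>i<n. (1, T (y i)) \<bullet> \<phi> i))"
    and "(\<integral>y. (\<Sum>\<phi>\<in>\<Phi>. c \<phi> * (\<Prod>i<n. (1, T (y i)) \<bullet> \<phi> i)) \<partial>iid n Q) = hpoly n \<Phi> c (1, mean T Q)"
proof -
  interpret Q: prob_space Q by fact
  interpret P: product_sigma_finite "\<lambda>_::nat. Q" by standard
  have i: "integrable Q (\<lambda>x. (1, T x) \<bullet> v)" and e: "(\<integral>x. (1, T x) \<bullet> v \<partial>Q) = (1, mean T Q) \<bullet> v"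
    for v :: "real \<times> 'b"
    using T by (auto simp: inner_prod_def mean_def Q.prob_space)
  have pi: "integrable (iid n Q) (\<lambda>y. \<Prod>i<n. (1, T (y i)) \<bullet> \<phi> i)" for \<phi> :: "nat \<Rightarrow> real \<times> 'b"
    using P.product_integrable_prod[of "{..<n}" "\<lambda>i x. (1, T x) \<bullet> \<phi> i"] i by simp
  have pe: "(\<integral>y. (\<Prod>i<n. (1, T (y i)) \<bullet> \<phi> i) \<partial>iid n Q) = (\<Prod>i<n. (1, mean T Q) \<bullet> \<phi> i)"
    for \<phi> :: "nat \<Rightarrow> real \<times> 'b"
    using P.product_integral_prod[of "{..<n}" "\<lambda>i x. (1, T x) \<bullet> \<phi> i"] i e by simp
  show "integrable (iid n Q) (\<lambda>y. \<Sum>\<phi>\<in>\<Phi>. c \<phi> * (\<Prod>i<n. (1, T (y i)) \<bullet> \<phi> i))"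
    by (intro Bochner_Integration.integrable_sum integrable_mult_right pi)
  have "(\<integral>y. (\<Sum>\<phi>\<in>\<Phi>. c \<phi> * (\<Prod>i<n. (1, T (y i)) \<bullet> \<phi> i)) \<partial>iid n Q)
    = (\<Sum>\<phi>\<in>\<Phi>. \<integral>y. c \<phi> * (\<Prod>i<n. (1, T (y i)) \<bullet> \<phi> i) \<partial>iid n Q)"
    by (rule Bochner_Integration.integral_sum) (intro integrable_mult_right pi)
  also have "\<dots> = hpoly n \<Phi> c (1, mean T Q)"
    unfolding hpoly_def by (intro sum.cong refl) (simp only: integral_mult_right_zero pe)
  finally show "(\<integral>y. (\<Sum>\<phi>\<in>\<Phi>. c \<phi> * (\<Prod>i<n. (1, T (y i)) \<bullet> \<phi> i)) \<partial>iid n Q) = hpoly n \<Phi> c (1, mean T Q)" .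
qed

context exp_family
begin

section \<open>Sample densities of boundary members, and completeness\<close>

lemma sum_ld:
  assumes "n \<ge> 1"
  shows "(\<Sum>i<n. ld P (T (x i))) = real n * ld P (sample_stat n T x)"
  using assms by (simp add: ld_def sample_stat_def sum.distrib inner_sum_right distrib_left)

lemma density_fam:
  fixes q :: "'a \<Rightarrow> real"
  assumes P: "P \<in> \<P>" and q[measurable]: "q \<in> borel_measurable P0" and nn: "\<And>x. 0 \<le> q x"
  shows "density P0 q = density P (\<lambda>x. ennreal (q x / exp (ld P (T x))))"
proof -
  have "density (density P0 (\<lambda>x. ennreal (exp (ld P (T x))))) (\<lambda>x. ennreal (q x / exp (ld P (T x))))
    = density P0 (\<lambda>x. ennreal (exp (ld P (T x))) * ennreal (q x / exp (ld P (T x))))"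
    by (rule density_density_eq) simp_all
  also have "\<dots> = density P0 q" by (simp add: ennreal_mult'[symmetric])
  finally show ?thesis using fam_density_ld[OF P] by simp
qed

lemma prod_tilt:
  assumes "n \<ge> 1"
  shows "(\<Prod>i<n. exp (ld P (T (x i))) / exp (ld P' (T (x i))))
    = exp (real n * (ld P (sample_stat n T x) - ld P' (sample_stat n T x)))"
proof -
  have "(\<Prod>i<n. exp (ld P (T (x i))) / exp (ld P' (T (x i))))
    = exp (\<Sum>i<n. ld P (T (x i)) - ld P' (T (x i)))"
    by (simp add: exp_sum exp_diff)
  then show ?thesis using sum_ld[OF assms] by (simp add: sum_subtractf right_diff_distrib)
qed

text \<open>Divergences below \<open>(1/2) ^ k\<close> make the squared Hellinger distances
  summable, so their integrands sum to a finite value almost everywhere. This gives pointwise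
  convergence without passing to a subsequence.\<close>

lemma boundary_member_ae_limit:
  assumes Q: "boundary_member lam T \<P> t Q"
  obtains p where "\<And>k. p k \<in> \<P>" "AE x in P0. (\<lambda>k. exp (ld (p k) (T x))) \<longlonglongrightarrow> dens Q x"
proof -
  from Q have dom: "Q \<in> dominated lam" and inf: "(INF P\<in>\<P>. KL Q P) = 0"
    by (auto simp: boundary_member_def)
  have "\<exists>P\<in>\<P>. KL Q P < ennreal ((1/2) ^ k)" for k
  proof -
    have "(INF P\<in>\<P>. KL Q P) < ennreal ((1/2) ^ k)" unfolding inf by simp
    then show ?thesis by (simp add: INF_less_iff)
  qed
  then obtain p where p: "\<And>k. p k \<in> \<P>" "\<And>k. KL Q (p k) < ennreal ((1/2) ^ k)" by metis
  let ?d = "\<lambda>k x. (sqrt (dens Q x) - sqrt (exp (ld (p k) (T x))))\<^sup>2"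
  have "(\<integral>\<^sup>+x. (\<Sum>k. ennreal (?d k x)) \<partial>P0) = (\<Sum>k. \<integral>\<^sup>+x. ennreal (?d k x) \<partial>P0)"
    by (rule nn_integral_suminf) measurable
  also have "\<dots> \<le> (\<Sum>k. ennreal ((1/2) ^ k))"
  proof (intro suminf_le summableI)
    fix k
    have "(\<integral>\<^sup>+x. ennreal (?d k x) \<partial>P0) \<le> KL Q (p k)"
      by (rule hellinger_le_KL[OF dens_measurable dens_nonneg density_dens[OF dom, symmetric]
        dominatedD(1)[OF dom] p(1)])
    then show "(\<integral>\<^sup>+x. ennreal (?d k x) \<partial>P0) \<le> ennreal ((1/2) ^ k)" using p(2)[of k] by simp
  qed
  also have "\<dots> < \<infinity>"
    by (subst suminf_ennreal2) (auto simp: summable_geometric)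
  finally have "AE x in P0. (\<Sum>k. ennreal (?d k x)) \<noteq> \<infinity>"
    by (intro nn_integral_PInf_AE) auto
  then have "AE x in P0. (\<lambda>k. exp (ld (p k) (T x))) \<longlonglongrightarrow> dens Q x"
  proof eventually_elim
    case (elim x)
    then have "summable (\<lambda>k. ?d k x)"
      by (intro summable_suminf_not_top) auto
    then have "(\<lambda>k. ?d k x) \<longlonglongrightarrow> 0" by (rule summable_LIMSEQ_zero)
    then have "(\<lambda>k. sqrt (?d k x)) \<longlonglongrightarrow> sqrt 0" by (rule tendsto_real_sqrt)
    then have "(\<lambda>k. sqrt (dens Q x) - sqrt (exp (ld (p k) (T x)))) \<longlonglongrightarrow> 0"
      by (simp add: tendsto_rabs_zero_iff)
    then have "(\<lambda>k. sqrt (dens Q x) - (sqrt (dens Q x) - sqrt (exp (ld (p k) (T x))))) \<longlonglongrightarrow> sqrt (dens Q x) - 0"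
      by (intro tendsto_intros)
    then have "(\<lambda>k. (sqrt (exp (ld (p k) (T x))))\<^sup>2) \<longlonglongrightarrow> (sqrt (dens Q x))\<^sup>2"
      by (intro tendsto_power) simp
    then show ?case by (simp add: dens_nonneg)
  qed
  with p(1) show ?thesis by (rule that)
qed

text \<open>The density of a boundary member is an a.e. limit of exponential tilts, so its sample density
  depends on the sample only through the canonical statistic.\<close>
lemma iid_boundary_member:
  assumes n: "n \<ge> 1" and Q: "boundary_member lam T \<P> t Q" and P1: "P1 \<in> \<P>"
  obtains w :: "'b \<Rightarrow> ennreal" where "w \<in> borel_measurable borel"
    "iid n Q = density (iid n P1) (\<lambda>x. w (sample_stat n T x))"
proof -
  from Q have dom: "Q \<in> dominated lam" by (simp add: boundary_member_def)
  note D1 = dominatedD[OF fam_dominated[OF P1]]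
  obtain p where p: "\<And>k. p k \<in> \<P>" "AE x in P0. (\<lambda>k. exp (ld (p k) (T x))) \<longlonglongrightarrow> dens Q x"
    by (rule boundary_member_ae_limit[OF Q]) blast
  let ?g = "\<lambda>x. dens Q x / exp (ld P1 (T x))"
  \<comment> \<open>The lower limit is defined and measurable at every \<open>\<tau>\<close>,
    including those where the tilts diverge.\<close>
  define w where "w \<tau> = liminf (\<lambda>k. ennreal (exp (real n * (ld (p k) \<tau> - ld P1 \<tau>))))" for \<tau>
  have w[measurable]: "w \<in> borel_measurable borel" unfolding w_def by measurable
  have [measurable]: "?g \<in> borel_measurable P1" "T \<in> borel_measurable P1"
    by (simp_all add: measurable_cong_sets[OF D1(3) refl])
  have tm[measurable]: "sample_stat n T \<in> borel_measurable (iid n P1)"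
    by (rule sample_stat_measurable) simp
  have Qd: "Q = density P1 (\<lambda>x. ennreal (?g x))"
    using density_fam[OF P1 dens_measurable dens_nonneg] density_dens[OF dom] by simp
  have "AE x in P1. (\<lambda>k. exp (ld (p k) (T x))) \<longlonglongrightarrow> dens Q x"
    by (rule absolutely_continuous_AE[OF D1(3,5) p(2)])
  then have "AE x in P1. (\<lambda>k. exp (ld (p k) (T x)) / exp (ld P1 (T x))) \<longlonglongrightarrow> ?g x"
    by eventually_elim (intro tendsto_intros, auto)
  then have "AE x in iid n P1. \<forall>i\<in>{..<n}. (\<lambda>k. exp (ld (p k) (T (x i))) / exp (ld P1 (T (x i)))) \<longlonglongrightarrow> ?g (x i)"
    by (intro AE_finite_allI AE_PiM_component D1(1)) auto
  then have "AE x in iid n P1. (\<Prod>i<n. ennreal (?g (x i))) = w (sample_stat n T x)"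
  proof eventually_elim
    case (elim x)
    then have "(\<lambda>k. \<Prod>i<n. exp (ld (p k) (T (x i))) / exp (ld P1 (T (x i)))) \<longlonglongrightarrow> (\<Prod>i<n. ?g (x i))"
      by (intro tendsto_prod) auto
    then have "(\<lambda>k. ennreal (exp (real n * (ld (p k) (sample_stat n T x) - ld P1 (sample_stat n T x)))))
      \<longlonglongrightarrow> ennreal (\<Prod>i<n. ?g (x i))"
      unfolding prod_tilt[OF n] by (rule tendsto_ennrealI)
    then have "w (sample_stat n T x) = ennreal (\<Prod>i<n. ?g (x i))"
      unfolding w_def by (intro lim_imp_Liminf) auto
    then show ?case by (simp add: prod_ennreal dens_nonneg)
  qed
  moreover have "iid n Q = density (iid n P1) (\<lambda>x. \<Prod>i<n. ennreal (?g (x i)))"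
    by (subst Qd, rule PiM_density)
      (use D1(1) dominatedD(1)[OF dom] Qd in \<open>auto intro: prob_space_imp_sigma_finite\<close>)
  ultimately have "iid n Q = density (iid n P1) (\<lambda>x. w (sample_stat n T x))"
    by (simp only:) (rule density_cong, measurable)
  with w show ?thesis by (rule that)
qed

text \<open>Condition the unbiased estimator of the polynomial on the sample statistic. The sample
  law of each boundary member has a density depending only on that statistic relative to the law of
  \<open>P1\<close>, so one conditional expectation serves all of them. Its expectation vanishes on
  the family, so completeness makes it zero under \<open>P1\<close>, and hence under
  \<open>Q\<close>.\<close>

lemma boundary_hpoly_zero:
  fixes \<Phi> :: "(nat \<Rightarrow> real \<times> 'b) set"
  assumes n: "n \<ge> 1" and comp: "complete_statistic n T \<P>"
    and van: "\<And>P. P \<in> \<P> \<Longrightarrow> hpoly n \<Phi> c (1, mean T P) = 0"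
    and Q: "boundary_member lam T \<P> t Q"
  shows "hpoly n \<Phi> c (1, t) = 0"
proof -
  from Q have dQ: "Q \<in> dominated lam" and iQ: "integrable Q T" and mQ: "mean T Q = t"
    and inf: "(INF P\<in>\<P>. KL Q P) = 0" by (auto simp: boundary_member_def)
  have "\<P> \<noteq> {}" using inf by auto
  then obtain P1 where P1: "P1 \<in> \<P>" by blast
  note D1 = dominatedD[OF fam_dominated[OF P1]]
  let ?M = "iid n P1" and ?X = "sample_stat n T"
  interpret M: prob_space ?M by (rule prob_space_iid[OF fam_dominated[OF P1]])
  have [measurable]: "T \<in> borel_measurable P1" using fam_integrable[OF P1] by simp
  have X[measurable]: "?X \<in> borel_measurable ?M" by (rule sample_stat_measurable) simp
  let ?H = "\<lambda>y. \<Sum>\<phi>\<in>\<Phi>. c \<phi> * (\<Prod>i<n. (1, T (y i)) \<bullet> \<phi> i)"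
  note H1 = hpoly_iid(1)[OF D1(1) fam_integrable[OF P1], where n=n and \<Phi>=\<Phi> and c=c]
  have Hm[measurable]: "?H \<in> borel_measurable ?M" using H1 by (rule borel_measurable_integrable)
  \<comment> \<open>Positive and negative parts are conditioned separately, because the weights met
    in \<open>key\<close> need not be bounded.\<close>
  obtain hp :: "'b \<Rightarrow> real" where hp: "hp \<in> borel_measurable borel" "\<And>y. 0 \<le> hp y"
    "\<And>w. w \<in> borel_measurable borel \<Longrightarrow>
      (\<integral>\<^sup>+x. ennreal (?H x) * w (?X x) \<partial>?M) = (\<integral>\<^sup>+x. ennreal (hp (?X x)) * w (?X x) \<partial>?M)"
    by (rule conditional_factor[OF M.prob_space_axioms X, of "\<lambda>x. ennreal (?H x)"])
      (use H1 in \<open>auto simp: real_integrable_def less_top\<close>)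
  obtain hm :: "'b \<Rightarrow> real" where hm: "hm \<in> borel_measurable borel" "\<And>y. 0 \<le> hm y"
    "\<And>w. w \<in> borel_measurable borel \<Longrightarrow>
      (\<integral>\<^sup>+x. ennreal (- ?H x) * w (?X x) \<partial>?M) = (\<integral>\<^sup>+x. ennreal (hm (?X x)) * w (?X x) \<partial>?M)"
    by (rule conditional_factor[OF M.prob_space_axioms X, of "\<lambda>x. ennreal (- ?H x)"])
      (use H1 in \<open>auto simp: real_integrable_def less_top\<close>)
  note [measurable] = hp(1) hm(1)
  \<comment> \<open>The single function \<open>hp - hm\<close>, built under \<open>P1\<close>, is an
    unbiased estimator of the polynomial under every boundary member.\<close>
  have key: "integrable (iid n Q') (\<lambda>x. hp (?X x) - hm (?X x))"
    "(\<integral>x. hp (?X x) - hm (?X x) \<partial>iid n Q') = hpoly n \<Phi> c (1, mean T Q')"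
    if Q': "boundary_member lam T \<P> t' Q'" for t' Q'
  proof -
    from Q' have d: "Q' \<in> dominated lam" and i: "integrable Q' T" by (auto simp: boundary_member_def)
    obtain w where w[measurable]: "w \<in> borel_measurable borel"
      and e: "iid n Q' = density ?M (\<lambda>x. w (?X x))"
      by (rule iid_boundary_member[OF n Q' P1]) blast
    note H = hpoly_iid[OF dominatedD(1)[OF d] i, where n=n and \<Phi>=\<Phi> and c=c]
    have p: "(\<integral>\<^sup>+x. ennreal (hp (?X x)) \<partial>iid n Q') = (\<integral>\<^sup>+x. ennreal (?H x) \<partial>iid n Q')"
      using hp(3)[OF w] unfolding e by (simp add: nn_integral_density mult.commute)
    have m: "(\<integral>\<^sup>+x. ennreal (hm (?X x)) \<partial>iid n Q') = (\<integral>\<^sup>+x. ennreal (- ?H x) \<partial>iid n Q')"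
      using hm(3)[OF w] unfolding e by (simp add: nn_integral_density mult.commute)
    have [measurable]: "?X \<in> borel_measurable (iid n Q')" unfolding e by simp
    have ip: "integrable (iid n Q') (\<lambda>x. hp (?X x))" "integrable (iid n Q') (\<lambda>x. hm (?X x))"
      using H(1)[unfolded real_integrable_def] p m hp(2) hm(2)
      by (auto simp: integrable_iff_bounded less_top)
    then show "integrable (iid n Q') (\<lambda>x. hp (?X x) - hm (?X x))" by simp
    have "(\<integral>x. hp (?X x) - hm (?X x) \<partial>iid n Q') = (\<integral>x. ?H x \<partial>iid n Q')"
      using ip p m hp(2) hm(2) H(1) by (simp add: integral_eq_nn_integral real_lebesgue_integral_def)
    then show "(\<integral>x. hp (?X x) - hm (?X x) \<partial>iid n Q') = hpoly n \<Phi> c (1, mean T Q')" using H(2) by simp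
  qed
  have "AE x in ?M. hp (?X x) - hm (?X x) = 0"
  proof -
    have hmeas: "(\<lambda>y. hp y - hm y) \<in> borel_measurable borel" by measurable
    have "\<forall>P\<in>\<P>. integrable (iid n P) (\<lambda>x. hp (?X x) - hm (?X x))
       \<and> (\<integral>x. hp (?X x) - hm (?X x) \<partial>iid n P) = 0"
      using key[OF fam_boundary_member] van by auto
    from comp[unfolded complete_statistic_def, rule_format, of "\<lambda>y. hp y - hm y", OF hmeas, OF this[rule_format] P1]
    show ?thesis by simp
  qed
  moreover obtain w where w[measurable]: "w \<in> borel_measurable borel"
    and e: "iid n Q = density ?M (\<lambda>x. w (?X x))"
    by (rule iid_boundary_member[OF n Q P1]) blast
  ultimately have "AE x in iid n Q. hp (?X x) - hm (?X x) = 0"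
    unfolding e by (subst AE_density) (auto elim!: eventually_mono)
  moreover have "?X \<in> borel_measurable (iid n Q)" unfolding e by simp
  ultimately have "(\<integral>x. hp (?X x) - hm (?X x) \<partial>iid n Q) = (\<integral>x. 0 \<partial>iid n Q)"
    by (intro integral_cong_AE) auto
  then show ?thesis using key(2)[OF Q] mQ by simp
qed

text \<open>The existence of the estimate enters here: almost every value of the sample statistic is
  the mean of a boundary member, so the polynomial vanishes at almost every sample average.\<close>

lemma hpoly_vanishes:
  fixes \<Phi> :: "(nat \<Rightarrow> real \<times> 'b) set" and u :: "'a \<Rightarrow> real"
  assumes n: "n \<ge> 1" and comp: "complete_statistic n T \<P>"
    and Phat: "AE x in iid n lam. boundary_member lam T \<P> (sample_stat n T x) (Phat x)"
    and van: "\<And>P. P \<in> \<P> \<Longrightarrow> hpoly n \<Phi> c (1, mean T P) = 0"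
    and R0: "R0 \<in> dominated lam" "absolutely_continuous R0 lam"
    and u: "integrable R0 u" "(\<integral>x. u x \<partial>R0) = 1" "integrable R0 (\<lambda>x. u x *\<^sub>R T x)"
  shows "hpoly n \<Phi> c (\<integral>x. u x *\<^sub>R (1, T x) \<partial>R0) = 0"
proof (rule poly_map_vanishes_means[OF dominatedD(1)[OF R0(1)] n _ poly_map_hpoly _ u(1,2)])
  have [measurable]: "T \<in> borel_measurable R0"
    using T_P0 measurable_cong_sets[OF dominatedD(3)[OF R0(1)] refl] by blast
  show "(\<lambda>x. (1::real, T x)) \<in> borel_measurable R0" by (intro borel_measurable_Pair) auto
  show "integrable R0 (\<lambda>x. u x *\<^sub>R (1::real, T x))"
    using integrable_Pair(1)[OF u(1,3)] by simp
  show "AE x in iid n R0. hpoly n \<Phi> c ((1 / real n) *\<^sub>R (\<Sum>i<n. (1, T (x i)))) = 0"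
    using Phat unfolding AE_iid[OF R0]
  proof eventually_elim
    case (elim x)
    have "(1 / real n) *\<^sub>R (\<Sum>i<n. (1::real, T (x i))) = (1, sample_stat n T x)"
      using n by (simp add: prod_eq_iff fst_sum snd_sum sample_stat_def)
    then show ?case using boundary_hpoly_zero[OF n comp van elim] by simp
  qed
qed

end

section \<open>Bounded densities and product integrals\<close>

text \<open>The bound holds everywhere, so it passes to products over the sample without exceptional
  sets. The sign is free, as needed for differences of densities and sections of the mean
  map.\<close>

definition bounded_measurable :: "'a measure \<Rightarrow> ('a \<Rightarrow> real) \<Rightarrow> bool" where
  "bounded_measurable M g \<longleftrightarrow> g \<in> borel_measurable M \<and> (\<exists>B. \<forall>x. \<bar>g x\<bar> \<le> B)"

lemma bounded_measurableD: "bounded_measurable M g \<Longrightarrow> g \<in> borel_measurable M"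
  by (simp add: bounded_measurable_def)

lemma bounded_measurable_bound:
  assumes "bounded_measurable M g" obtains B where "0 \<le> B" "\<And>x. \<bar>g x\<bar> \<le> B"
  using assms unfolding bounded_measurable_def by (meson abs_ge_zero order_trans)

lemma bounded_measurable_const: "bounded_measurable M (\<lambda>x. c)"
  by (auto simp: bounded_measurable_def)

lemma bounded_measurable_indicator: "A \<in> sets M \<Longrightarrow> bounded_measurable M (indicator A)"
  by (auto simp: bounded_measurable_def indicator_def intro!: exI[of _ 1])

lemma bounded_measurable_add:
  assumes "bounded_measurable M f" "bounded_measurable M g"
  shows "bounded_measurable M (\<lambda>x. f x + g x)"
proof -
  obtain A B where "\<And>x. \<bar>f x\<bar> \<le> A" "\<And>x. \<bar>g x\<bar> \<le> B"
    using assms by (auto simp: bounded_measurable_def)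
  then have "\<bar>f x + g x\<bar> \<le> A + B" for x by (meson abs_triangle_ineq add_mono order_trans)
  then show ?thesis using assms by (auto simp: bounded_measurable_def)
qed

lemma bounded_measurable_mult:
  assumes "bounded_measurable M f" "bounded_measurable M g"
  shows "bounded_measurable M (\<lambda>x. f x * g x)"
proof -
  obtain A B where "\<And>x. \<bar>f x\<bar> \<le> A" "0 \<le> A" "\<And>x. \<bar>g x\<bar> \<le> B"
    using assms bounded_measurable_bound by metis
  then have "\<bar>f x * g x\<bar> \<le> A * B" for x by (auto simp: abs_mult intro!: mult_mono)
  then show ?thesis using assms by (auto simp: bounded_measurable_def)
qed

lemma bounded_measurable_sum:
  "(\<And>i. i \<in> I \<Longrightarrow> bounded_measurable M (f i)) \<Longrightarrow> bounded_measurable M (\<lambda>x. \<Sum>i\<in>I. f i x)"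
  by (induction I rule: infinite_finite_induct)
    (auto intro: bounded_measurable_const bounded_measurable_add)

lemmas bounded_measurable_intros = bounded_measurable_const bounded_measurable_indicator
  bounded_measurable_add bounded_measurable_mult bounded_measurable_sum

lemma bounded_measurable_integrable_scaleR:
  fixes f :: "'a \<Rightarrow> 'b::euclidean_space"
  assumes g: "bounded_measurable M g" and f: "integrable M f"
  shows "integrable M (\<lambda>x. g x *\<^sub>R f x)"
proof -
  obtain B where B: "\<And>x. \<bar>g x\<bar> \<le> B" "0 \<le> B" using bounded_measurable_bound[OF g] by metis
  have [measurable]: "g \<in> borel_measurable M" by (rule bounded_measurableD[OF g])
  show ?thesis
    using f by (rule Bochner_Integration.integrable_bound[OF integrable_scaleR_right[of B]])
      (use B f in \<open>auto intro!: mult_right_mono\<close>)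
qed

lemma integral_scaleR_linear_combination:
  fixes e :: "'a \<Rightarrow> 'b::euclidean_space"
  assumes e: "integrable M e" and u: "bounded_measurable M u" and v: "bounded_measurable M v"
  shows "(\<integral>x. (s * u x + t * v x) *\<^sub>R e x \<partial>M)
    = s *\<^sub>R (\<integral>x. u x *\<^sub>R e x \<partial>M) + t *\<^sub>R (\<integral>x. v x *\<^sub>R e x \<partial>M)"
proof -
  note i = bounded_measurable_integrable_scaleR[OF u e] bounded_measurable_integrable_scaleR[OF v e]
  have "(\<integral>x. (s * u x + t * v x) *\<^sub>R e x \<partial>M)
      = (\<integral>x. s *\<^sub>R (u x *\<^sub>R e x) + t *\<^sub>R (v x *\<^sub>R e x) \<partial>M)"
    by (simp add: scaleR_add_left)
  also have "\<dots> = (\<integral>x. s *\<^sub>R (u x *\<^sub>R e x) \<partial>M) + (\<integral>x. t *\<^sub>R (v x *\<^sub>R e x) \<partial>M)"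
    by (rule Bochner_Integration.integral_add) (intro integrable_scaleR_right i)+
  finally show ?thesis by (simp only: integral_scaleR_right i)
qed

lemma bounded_measurable_integrable:
  "prob_space M \<Longrightarrow> bounded_measurable M g \<Longrightarrow> integrable M g"
  using bounded_measurable_integrable_scaleR[of M g "\<lambda>_. 1::real"]
  by (simp add: prob_space_def finite_measure.integrable_const)

lemma bounded_measurable_prod:
  assumes "\<And>i. i < n \<Longrightarrow> bounded_measurable M (a i)"
  shows "bounded_measurable (iid n M) (\<lambda>x. \<Prod>i<n. a i (x i))"
proof -
  have "\<exists>B. \<forall>i<n. \<forall>x. \<bar>a i x\<bar> \<le> B i"
    using assms unfolding bounded_measurable_def by metis
  then obtain B where B: "\<And>i x. i < n \<Longrightarrow> \<bar>a i x\<bar> \<le> B i" by blast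
  have "\<bar>\<Prod>i<n. a i (x i)\<bar> \<le> (\<Prod>i<n. B i)" for x
    using B by (auto simp: abs_prod intro!: prod_mono)
  moreover have "(\<lambda>x. \<Prod>i<n. a i (x i)) \<in> borel_measurable (iid n M)"
    using assms[THEN bounded_measurableD]
    by (intro borel_measurable_prod) (auto intro!: measurable_compose[OF measurable_component_singleton])
  ultimately show ?thesis by (auto simp: bounded_measurable_def)
qed

lemma integrable_mult_prod:
  fixes \<delta> :: "(nat \<Rightarrow> 'a) \<Rightarrow> real"
  assumes "integrable (iid n M) \<delta>" "\<And>i. i < n \<Longrightarrow> bounded_measurable M (a i)"
  shows "integrable (iid n M) (\<lambda>x. \<delta> x * (\<Prod>i<n. a i (x i)))"
  using bounded_measurable_integrable_scaleR[OF bounded_measurable_prod[OF assms(2)] assms(1)]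
  by (simp add: mult.commute)

text \<open>Expand the product over the set of coordinates that receive \<open>g\<close>; the others
  contribute the power of \<open>s\<close>.\<close>

lemma integral_prod_line_poly:
  fixes \<delta> :: "(nat \<Rightarrow> 'a) \<Rightarrow> real"
  assumes \<delta>: "integrable (iid n M) \<delta>" and g: "bounded_measurable M g" and h: "bounded_measurable M h"
  obtains p where "\<And>s. (\<integral>x. \<delta> x * (\<Prod>i<n. g (x i) + s * h (x i)) \<partial>iid n M) = poly p s"
proof
  fix s :: real
  let ?c = "\<lambda>X x. (\<Prod>i<n. if i \<in> X then g (x i) else h (x i))"
  have i: "integrable (iid n M) (\<lambda>x. \<delta> x * ?c X x)" for X
    using integrable_mult_prod[OF \<delta>, of "\<lambda>i. if i \<in> X then g else h"] g h
    by (simp add: if_distrib[of "\<lambda>f. f _"])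
  have e: "(\<Prod>i<n. g (x i) + s * h (x i)) = (\<Sum>X\<in>Pow {..<n}. s ^ card ({..<n} - X) * ?c X x)" for x
  proof -
    have "(\<Prod>i<n. g (x i) + s * h (x i)) =
      (\<Sum>X\<in>Pow {..<n}. (\<Prod>i\<in>X. g (x i)) * (\<Prod>i\<in>{..<n} - X. s * h (x i)))"
      by (rule prod_add) simp
    also have "\<dots> = (\<Sum>X\<in>Pow {..<n}. s ^ card ({..<n} - X) * ?c X x)"
    proof (rule sum.cong[OF refl])
      fix X assume X: "X \<in> Pow {..<n}"
      have "?c X x = (\<Prod>i\<in>X. g (x i)) * (\<Prod>i\<in>{..<n} - X. h (x i))"
        using X by (subst prod.If_cases) (auto simp: Int_absorb1 Diff_eq intro!: arg_cong2[where f="(*)"] prod.cong)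
      then show "(\<Prod>i\<in>X. g (x i)) * (\<Prod>i\<in>{..<n} - X. s * h (x i)) = s ^ card ({..<n} - X) * ?c X x"
        by (simp add: prod.distrib)
    qed
    finally show ?thesis .
  qed
  have "(\<integral>x. \<delta> x * (\<Prod>i<n. g (x i) + s * h (x i)) \<partial>iid n M)
    = (\<integral>x. (\<Sum>X\<in>Pow {..<n}. s ^ card ({..<n} - X) * (\<delta> x * ?c X x)) \<partial>iid n M)"
    unfolding e by (simp add: sum_distrib_left mult.left_commute)
  also have "\<dots> = (\<Sum>X\<in>Pow {..<n}. s ^ card ({..<n} - X) * (\<integral>x. \<delta> x * ?c X x \<partial>iid n M))"
    using i by simp
  also have "\<dots> = poly (\<Sum>X\<in>Pow {..<n}. monom (\<integral>x. \<delta> x * ?c X x \<partial>iid n M) (card ({..<n} - X))) s"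
    by (simp add: poly_sum poly_monom mult.commute)
  finally show "(\<integral>x. \<delta> x * (\<Prod>i<n. g (x i) + s * h (x i)) \<partial>iid n M) =
    poly (\<Sum>X\<in>Pow {..<n}. monom (\<integral>x. \<delta> x * ?c X x \<partial>iid n M) (card ({..<n} - X))) s" .
qed

text \<open>Expanding each inner product in the basis gives a sum over assignments of basis vectors
  to observations; integrating out the sample leaves constant coefficients.\<close>

lemma integral_prod_inner_hpoly:
  fixes \<delta> :: "(nat \<Rightarrow> 'a) \<Rightarrow> real" and \<gamma> :: "'a \<Rightarrow> 'e::euclidean_space"
  assumes \<delta>: "integrable (iid n M) \<delta>" and \<gamma>: "\<And>v. bounded_measurable M (\<lambda>x. \<gamma> x \<bullet> v)"
  obtains c where "\<And>z. (\<integral>x. \<delta> x * (\<Prod>i<n. z \<bullet> \<gamma> (x i)) \<partial>iid n M)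
    = hpoly n (PiE {..<n} (\<lambda>_. Basis)) c z"
proof
  fix z :: 'e
  let ?\<Phi> = "PiE {..<n} (\<lambda>_. Basis :: 'e set)"
  have i: "integrable (iid n M) (\<lambda>x. \<delta> x * (\<Prod>i<n. \<gamma> (x i) \<bullet> \<phi> i))" for \<phi>
    by (rule integrable_mult_prod[OF \<delta> \<gamma>])
  have e: "(\<Prod>i<n. z \<bullet> \<gamma> (x i)) = (\<Sum>\<phi>\<in>?\<Phi>. (\<Prod>i<n. z \<bullet> \<phi> i) * (\<Prod>i<n. \<gamma> (x i) \<bullet> \<phi> i))" for x
  proof -
    have "(\<Prod>i<n. z \<bullet> \<gamma> (x i)) = (\<Prod>i<n. \<Sum>b\<in>Basis. (z \<bullet> b) * (\<gamma> (x i) \<bullet> b))"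
      by (intro prod.cong refl euclidean_inner)
    also have "\<dots> = (\<Sum>\<phi>\<in>?\<Phi>. \<Prod>i<n. (z \<bullet> \<phi> i) * (\<gamma> (x i) \<bullet> \<phi> i))"
      by (rule prod_sum_PiE) auto
    finally show ?thesis by (simp add: prod.distrib)
  qed
  have "(\<integral>x. \<delta> x * (\<Prod>i<n. z \<bullet> \<gamma> (x i)) \<partial>iid n M)
    = (\<integral>x. (\<Sum>\<phi>\<in>?\<Phi>. (\<Prod>i<n. z \<bullet> \<phi> i) * (\<delta> x * (\<Prod>i<n. \<gamma> (x i) \<bullet> \<phi> i))) \<partial>iid n M)"
    unfolding e by (simp add: sum_distrib_left mult.left_commute)
  also have "\<dots> = (\<Sum>\<phi>\<in>?\<Phi>. (\<Prod>i<n. z \<bullet> \<phi> i) * (\<integral>x. \<delta> x * (\<Prod>i<n. \<gamma> (x i) \<bullet> \<phi> i) \<partial>iid n M))"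
    using i by simp
  finally show "(\<integral>x. \<delta> x * (\<Prod>i<n. z \<bullet> \<gamma> (x i)) \<partial>iid n M)
    = hpoly n ?\<Phi> (\<lambda>\<phi>. \<integral>x. \<delta> x * (\<Prod>i<n. \<gamma> (x i) \<bullet> \<phi> i) \<partial>iid n M) z"
    by (simp add: hpoly_def mult.commute)
qed

text \<open>Separation from a cone: letting the multiple tend to zero bounds \<open>b\<close>, and
  letting it tend to infinity fixes the sign of \<open>q\<close>.\<close>

lemma le_positive_multiples:
  fixes b q :: real
  assumes *: "\<And>t. t > 0 \<Longrightarrow> b \<le> t * q"
  shows "b \<le> 0" and "0 \<le> q"
proof -
  show "b \<le> 0"
  proof (rule ccontr)
    assume b: "\<not> b \<le> 0"
    have "q > 0" using b *[of 1] by simp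
    then show False using b *[of "b / (2 * q)"] by (simp add: field_simps)
  qed
  show "0 \<le> q"
  proof (rule ccontr)
    assume q: "\<not> 0 \<le> q"
    have "0 < (\<bar>b\<bar> + 1) / - q" using q by (intro divide_pos_pos) linarith+
    from *[OF this] q show False by simp
  qed
qed

text \<open>If no such \<open>u\<close> existed, a hyperplane would separate the mean under \<open>N\<close> from all these means, and
  \<open>e\<close> would lie in that hyperplane a.e.\<close>
lemma mean_bounded_density:
  fixes e :: "'a \<Rightarrow> 'e::euclidean_space"
  assumes M: "prob_space M" and e: "integrable M e"
    and N: "sets N = sets M" "absolutely_continuous M N" "absolutely_continuous N M" "integrable N e"
  obtains u c where "bounded_measurable M u" "0 < c" "\<And>x. c \<le> u x"
    "(\<integral>x. u x *\<^sub>R e x \<partial>M) = (\<integral>x. e x \<partial>N)"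
proof -
  interpret M: prob_space M by fact
  let ?G = "{u. bounded_measurable M u \<and> (\<exists>c>0. \<forall>x. c \<le> u x)}"
  let ?L = "\<lambda>u. \<integral>x. u x *\<^sub>R e x \<partial>M"
  let ?z = "\<integral>x. e x \<partial>N"
  note ig = bounded_measurable_integrable_scaleR[OF _ e]
  have comb: "(\<lambda>x. s * u x + t * v x) \<in> ?G" if "u \<in> ?G" "v \<in> ?G" "0 \<le> s" "0 \<le> t" "0 < s + t" for u v s t
  proof -
    from that obtain c d where cd: "c > 0" "\<And>x. c \<le> u x" "d > 0" "\<And>x. d \<le> v x" by auto
    have "s * c + t * d \<le> s * u x + t * v x" for x
      using that cd by (intro add_mono mult_left_mono) auto
    moreover have "0 < s * c + t * d"
    proof (cases "s > 0")
      case True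
      then show ?thesis using cd that by (intro add_pos_nonneg) auto
    next
      case False
      then have "s = 0" "t > 0" using that by auto
      then show ?thesis using cd by simp
    qed
    ultimately show ?thesis using that by (auto intro!: bounded_measurable_intros)
  qed
  have Lcomb: "?L (\<lambda>x. s * u x + t * v x) = s *\<^sub>R ?L u + t *\<^sub>R ?L v" if "u \<in> ?G" "v \<in> ?G" for u v s t
    using that by (intro integral_scaleR_linear_combination e) auto
  have one: "(\<lambda>_. 1) \<in> ?G" by (auto intro!: bounded_measurable_intros exI[of _ 1])
  have "?z \<in> ?L ` ?G"
  proof (rule ccontr)
    assume z: "?z \<notin> ?L ` ?G"
    have "convex (?L ` ?G)"
    proof (rule convexI)
      fix x y and s t :: real
      assume "x \<in> ?L ` ?G" "y \<in> ?L ` ?G" and st: "0 \<le> s" "0 \<le> t" "s + t = 1"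
      then obtain u v where uv: "u \<in> ?G" "v \<in> ?G" "x = ?L u" "y = ?L v" by blast
      show "s *\<^sub>R x + t *\<^sub>R y \<in> ?L ` ?G"
        unfolding uv(3,4) Lcomb[OF uv(1,2), symmetric]
        using comb[OF uv(1,2) st(1,2)] st(3) by (intro imageI) simp
    qed
    moreover have "?L ` ?G \<noteq> {}" using one by blast
    \<comment> \<open>The separating normal is chosen inside the affine hull. Were all the means to
      lie in the hyperplane orthogonal to \<open>a\<close>, so would \<open>?z + a\<close>, which is
      impossible; this excludes a degenerate separation.\<close>
    ultimately obtain a b where ab: "?z + a \<in> affine hull (insert ?z (?L ` ?G))" "a \<noteq> 0"
      "a \<bullet> ?z \<le> b" "\<And>x. x \<in> ?L ` ?G \<Longrightarrow> b \<le> a \<bullet> x"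
      by (rule separating_hyperplane_set_point_inaff[OF _ _ z]) blast
    have sc: "b \<le> t * (a \<bullet> ?L u)" if "u \<in> ?G" "t > 0" for u t
    proof -
      have "(\<lambda>x. t * u x + 0 * u x) \<in> ?G" using that by (intro comb) auto
      then have "b \<le> a \<bullet> ?L (\<lambda>x. t * u x + 0 * u x)" using ab(4) by blast
      then show ?thesis using Lcomb[OF that(1) that(1), of t 0] by simp
    qed
    have pos: "0 \<le> a \<bullet> ?L u" if u: "u \<in> ?G" for u
      using sc[OF u] by (rule le_positive_multiples(2))
    have b0: "b \<le> 0" using sc[OF one] by (rule le_positive_multiples(1))
    let ?Y = "\<lambda>x. a \<bullet> e x"
    have Y: "integrable M ?Y" "integrable N ?Y" using e N(4) by simp_all
    have [measurable]: "?Y \<in> borel_measurable M" using Y(1) by simp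
    let ?A = "{x\<in>space M. ?Y x < 0}"
    have A: "?A \<in> sets M" by measurable
    have iA: "integrable M (\<lambda>x. indicator ?A x * ?Y x)"
      using bounded_measurable_integrable_scaleR[OF bounded_measurable_indicator[OF A] Y(1)] by simp
    have Lin: "a \<bullet> ?L u = (\<integral>x. u x * ?Y x \<partial>M)" if "bounded_measurable M u" for u
      using integral_inner_right[of a M "\<lambda>x. u x *\<^sub>R e x"] ig[OF that] by simp
    \<comment> \<open>The indicator of the event where \<open>?Y\<close> is negative is not bounded
      away from zero, so it is approached by elements of \<open>?G\<close> as \<open>s\<close> tends
      to 0.\<close>
    have "0 \<le> (\<integral>x. indicator ?A x * ?Y x \<partial>M) + s * (\<integral>x. ?Y x \<partial>M)" if s: "s > 0" for s
    proof -
      have bm: "bounded_measurable M (\<lambda>x. indicator ?A x + s * 1)"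
        using A by (intro bounded_measurable_intros)
      have "(\<lambda>x. indicator ?A x + s * 1) \<in> ?G" using bm s by (auto intro!: exI[of _ s])
      from pos[OF this] show ?thesis
        unfolding Lin[OF bm] using iA Y by (simp add: distrib_right)
    qed
    then have nnA: "0 \<le> (\<integral>x. indicator ?A x * ?Y x \<partial>M)"
      using le_positive_multiples(1)[of "- (\<integral>x. indicator ?A x * ?Y x \<partial>M)" "\<integral>x. ?Y x \<partial>M"]
      by fastforce
    have "AE x in M. 0 \<le> ?Y x"
    proof -
      have "AE x in M. 0 \<le> - (indicator ?A x * ?Y x)" by (auto simp: indicator_def)
      moreover have "(\<integral>x. - (indicator ?A x * ?Y x) \<partial>M) = 0"
        using nnA integral_nonneg_AE[OF calculation] by simp
      ultimately have "AE x in M. - (indicator ?A x * ?Y x) = 0"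
        using integral_nonneg_eq_0_iff_AE[of M "\<lambda>x. - (indicator ?A x * ?Y x)"] iA by simp
      then show ?thesis using AE_space by eventually_elim (auto simp: indicator_def split: if_splits)
    qed
    then have YN: "AE x in N. 0 \<le> ?Y x" using AE_absolutely_continuous_iff[OF N(1-3)] by blast
    have "(\<integral>x. ?Y x \<partial>N) = a \<bullet> ?z" using integral_inner_right[of a N e] N(4) by simp
    then have "(\<integral>x. ?Y x \<partial>N) = 0" using ab(3) b0 integral_nonneg_AE[OF YN] by simp
    then have "AE x in N. ?Y x = 0" using integral_nonneg_eq_0_iff_AE[OF Y(2) YN] by simp
    then have Y0: "AE x in M. ?Y x = 0" using AE_absolutely_continuous_iff[OF N(1-3)] by blast
    have "a \<bullet> ?L u = 0" if "u \<in> ?G" for u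
    proof -
      have bm: "bounded_measurable M u" using that by simp
      have [measurable]: "u \<in> borel_measurable M" by (rule bounded_measurableD[OF bm])
      have "(\<integral>x. u x * ?Y x \<partial>M) = (\<integral>x. 0 \<partial>M)"
        using Y0 by (intro integral_cong_AE) auto
      then show ?thesis using Lin[OF bm] by simp
    qed
    moreover have z0: "a \<bullet> ?z = 0" using \<open>(\<integral>x. ?Y x \<partial>N) = a \<bullet> ?z\<close> \<open>(\<integral>x. ?Y x \<partial>N) = 0\<close> by simp
    ultimately have "insert ?z (?L ` ?G) \<subseteq> {x. a \<bullet> x = 0}" by auto
    then have "affine hull (insert ?z (?L ` ?G)) \<subseteq> {x. a \<bullet> x = 0}"
      by (intro hull_minimal affine_hyperplane)
    then have "a \<bullet> (?z + a) = 0" using ab(1) by blast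
    then show False using z0 ab(2) by (simp add: inner_add_right)
  qed
  then show ?thesis using that by (auto simp: eq_commute)
qed

section \<open>Unbiasedness over all bounded densities\<close>

context exp_family
begin

text \<open>The hypothesis concerns only uniformly positive densities with the mean of a member.
  Positivity is removed first, inside a fibre of the mean map, by extending a polynomial along a
  line. The condition on the mean is removed next: it concerns a polynomial in finitely many
  variables, to which completeness applies.\<close>

lemma unbiased_vanishes:
  fixes \<delta> :: "(nat \<Rightarrow> 'a) \<Rightarrow> real"
  assumes n: "n \<ge> 1" and comp: "complete_statistic n T \<P>"
    and Phat: "AE x in iid n lam. boundary_member lam T \<P> (sample_stat n T x) (Phat x)"
    and R0: "R0 \<in> dominated lam" "absolutely_continuous R0 lam" and iT: "integrable R0 T"
    and \<delta>: "integrable (iid n R0) \<delta>"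
    and hyp: "\<And>u c P. bounded_measurable R0 u \<Longrightarrow> 0 < c \<Longrightarrow> (\<And>x. c \<le> u x) \<Longrightarrow>
      prob_space (density R0 u) \<Longrightarrow> P \<in> \<P> \<Longrightarrow> mean T P = mean T (density R0 u) \<Longrightarrow>
      (\<integral>x. \<delta> x * (\<Prod>i<n. u (x i)) \<partial>iid n R0) = 0"
    and g: "bounded_measurable R0 g" "(\<integral>x. g x \<partial>R0) = 1"
  shows "(\<integral>x. \<delta> x * (\<Prod>i<n. g (x i)) \<partial>iid n R0) = 0"
proof -
  interpret R0: prob_space R0 by (rule dominatedD(1)[OF R0(1)])
  let ?e = "\<lambda>x. (1::real, T x)"
  let ?L = "\<lambda>u. \<integral>x. u x *\<^sub>R ?e x \<partial>R0"
  let ?F = "\<lambda>u. \<integral>x. \<delta> x * (\<Prod>i<n. u (x i)) \<partial>iid n R0"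
  let ?z = "\<lambda>P. (1::real, mean T P)"
  have e: "integrable R0 ?e" by (intro integrable_Pair) (use iT in auto)
  note comb = integral_scaleR_linear_combination[OF e]
  have L: "?L u = (\<integral>x. u x \<partial>R0, \<integral>x. u x *\<^sub>R T x \<partial>R0)" if u: "bounded_measurable R0 u" for u
    using integrable_Pair(2)[OF bounded_measurable_integrable[OF R0.prob_space_axioms u]
      bounded_measurable_integrable_scaleR[OF u iT]] by simp
  have pos: "?F u = 0" if u: "bounded_measurable R0 u" and c: "0 < c" "\<And>x. c \<le> u x"
    and P: "P \<in> \<P>" and eq: "?L u = ?z P" for u c P
  proof (rule hyp[OF u c _ P])
    have u0: "0 \<le> u x" for x using c(1) c(2)[of x] by simp
    have [measurable]: "u \<in> borel_measurable R0" by (rule bounded_measurableD[OF u])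
    have m: "(\<integral>x. u x \<partial>R0) = 1" "(\<integral>x. u x *\<^sub>R T x \<partial>R0) = mean T P" using eq L[OF u] by auto
    have "(\<integral>\<^sup>+x. ennreal (u x) \<partial>R0) = 1"
      using nn_integral_eq_integral[OF bounded_measurable_integrable[OF R0.prob_space_axioms u]] u0 m by simp
    then show "prob_space (density R0 u)"
      by (intro prob_spaceI) (simp add: emeasure_density cong: nn_integral_cong)
    show "mean T P = mean T (density R0 u)"
      unfolding mean_def using m(2) iT u0 by (subst integral_density) (auto simp: mean_def)
  qed
  \<comment> \<open>The density of \<open>P\<close> relative to \<open>R0\<close> need be neither
    bounded nor bounded away from zero, so only its mean is reproduced.\<close>
  have z: "\<exists>u c. bounded_measurable R0 u \<and> 0 < c \<and> (\<forall>x. c \<le> u x) \<and> ?L u = ?z P" if P: "P \<in> \<P>" for P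
  proof -
    note D = dominatedD[OF fam_dominated[OF P]] and D0 = dominatedD[OF R0(1)]
    interpret P: prob_space P by (rule D(1))
    have eP: "integrable P ?e" "(\<integral>x. ?e x \<partial>P) = ?z P"
      using integrable_Pair[OF P.integrable_const[of "1::real"] fam_integrable[OF P]]
      by (simp_all add: mean_def P.prob_space)
    have "sets P = sets R0" using D(2) D0(2) by simp
    moreover have "absolutely_continuous R0 P" "absolutely_continuous P R0"
      using R0(2) D(4) ac_fam[OF P] D0(5) by (auto simp: absolutely_continuous_def)
    ultimately obtain u c where "bounded_measurable R0 u" "0 < c" "\<And>x. c \<le> u x" "?L u = (\<integral>x. ?e x \<partial>P)"
      using mean_bounded_density[OF R0.prob_space_axioms e _ _ _ eP(1)] by blast
    then show ?thesis using eP(2) by auto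
  qed
  have fiber: "?F v = 0" if v: "bounded_measurable R0 v" and P: "P \<in> \<P>" and eq: "?L v = ?z P" for v P
  proof -
    obtain u c where u: "bounded_measurable R0 u" "0 < c" "\<And>x. c \<le> u x" "?L u = ?z P" using z[OF P] by blast
    have h: "bounded_measurable R0 (\<lambda>x. v x + (-1) * u x)" by (intro bounded_measurable_intros u v)
    obtain p where p: "\<And>s. ?F (\<lambda>x. u x + s * (v x + (-1) * u x)) = poly p s"
      by (rule integral_prod_line_poly[OF \<delta> u(1) h]) blast
    obtain B where B: "0 \<le> B" "\<And>x. \<bar>v x + (-1) * u x\<bar> \<le> B" using bounded_measurable_bound[OF h] by metis
    \<comment> \<open>On this interval the point on the line from \<open>u\<close> to
      \<open>v\<close> stays above \<open>c / 2\<close>. Using \<open>B + 1\<close> avoids division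
      by zero when \<open>B = 0\<close>.\<close>
    have zero: "poly p s = 0" if s: "s \<in> {0<..<c / (2 * (B + 1))}" for s
    proof -
      have bm: "bounded_measurable R0 (\<lambda>x. u x + s * (v x + (-1) * u x))"
        by (intro bounded_measurable_intros u v)
      have "c / 2 \<le> u x + s * (v x + (-1) * u x)" for x
      proof -
        have "\<bar>s * (v x + (-1) * u x)\<bar> \<le> s * (B + 1)"
          unfolding abs_mult using s B(1) order_trans[OF B(2)[of x], of "B + 1"] by (intro mult_mono) auto
        also have "\<dots> \<le> c / (2 * (B + 1)) * (B + 1)" using s B by (intro mult_right_mono) auto
        also have "\<dots> = c / 2" using B(1) by (simp add: field_simps)
        finally show ?thesis using u(3)[of x] by linarith
      qed
      moreover have "?L (\<lambda>x. u x + s * (v x + (-1) * u x)) = ?z P"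
      proof -
        have "?L (\<lambda>x. (1 - s) * u x + s * v x) = ?z P"
          unfolding comb[OF u(1) v] u(4) eq by (simp add: algebra_simps)
        then show ?thesis by (simp add: algebra_simps)
      qed
      ultimately have "?F (\<lambda>x. u x + s * (v x + (-1) * u x)) = 0"
        using u(2) by (intro pos[OF bm _ _ P, of "c / 2"]) auto
      then show ?thesis using p by simp
    qed
    have "infinite {0<..<c / (2 * (B + 1))}"
      using u(2) B(1) by (intro infinite_Ioo divide_pos_pos) auto
    then have "p = 0" using zero by (rule poly_zero_if_zero_on_infinite)
    then show ?thesis using p[of 1] by simp
  qed
  \<comment> \<open>The range of the mean map may be a proper subspace, when the coordinates of
    \<open>T\<close> are affinely dependent; the linear section is built on it alone.\<close>
  define W where "W = ?L ` Collect (bounded_measurable R0)"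
  have W: "subspace W"
    unfolding W_def
  proof (rule subspaceI)
    show "0 \<in> ?L ` Collect (bounded_measurable R0)"
      by (rule image_eqI[of _ _ "\<lambda>_. 0"]) (auto intro: bounded_measurable_intros simp: prod_eq_iff)
  next
    fix x y assume "x \<in> ?L ` Collect (bounded_measurable R0)" "y \<in> ?L ` Collect (bounded_measurable R0)"
    then obtain u v where uv: "bounded_measurable R0 u" "bounded_measurable R0 v" "x = ?L u" "y = ?L v" by blast
    show "x + y \<in> ?L ` Collect (bounded_measurable R0)"
      using comb[OF uv(1,2), of 1 1] uv
      by (intro image_eqI[of _ _ "\<lambda>x. 1 * u x + 1 * v x"]) (auto intro: bounded_measurable_intros)
  next
    fix s :: real and x assume "x \<in> ?L ` Collect (bounded_measurable R0)"
    then obtain u where u: "bounded_measurable R0 u" "x = ?L u" by blast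
    show "s *\<^sub>R x \<in> ?L ` Collect (bounded_measurable R0)"
      using comb[OF u(1,1), of s 0] u
      by (intro image_eqI[of _ _ "\<lambda>x. s * u x + 0 * u x"]) (auto intro: bounded_measurable_intros)
  qed
  obtain Bs where Bs: "Bs \<subseteq> W" "pairwise orthogonal Bs" "\<And>x. x \<in> Bs \<Longrightarrow> norm x = 1"
    "independent Bs" "span Bs = W"
    by (rule orthonormal_basis_subspace[OF W]) blast
  have fB: "finite Bs" using Bs(4) by (rule independent_imp_finite)
  obtain h where h: "\<And>b. b \<in> Bs \<Longrightarrow> bounded_measurable R0 (h b)" "\<And>b. b \<in> Bs \<Longrightarrow> ?L (h b) = b"
  proof -
    have "\<forall>b\<in>Bs. \<exists>u. bounded_measurable R0 u \<and> ?L u = b" using Bs(1) unfolding W_def by blast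
    then have "\<exists>h. \<forall>b\<in>Bs. bounded_measurable R0 (h b) \<and> ?L (h b) = b" by (rule bchoice)
    then show ?thesis using that by blast
  qed
  define sec where "sec z x = (\<Sum>b\<in>Bs. (z \<bullet> b) * h b x)" for z :: "real \<times> 'b" and x
  have sec: "bounded_measurable R0 (sec z)" for z
    unfolding sec_def by (intro bounded_measurable_intros h)
  have Lsec: "?L (sec z) = z" if "z \<in> W" for z
  proof -
    have "?L (sec z) = (\<integral>x. (\<Sum>b\<in>Bs. (z \<bullet> b) *\<^sub>R (h b x *\<^sub>R ?e x)) \<partial>R0)"
      by (simp only: sec_def scaleR_sum_left scaleR_scaleR)
    also have "\<dots> = (\<Sum>b\<in>Bs. \<integral>x. (z \<bullet> b) *\<^sub>R (h b x *\<^sub>R ?e x) \<partial>R0)"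
      by (rule Bochner_Integration.integral_sum)
        (intro integrable_scaleR_right bounded_measurable_integrable_scaleR h e)
    also have "\<dots> = (\<Sum>b\<in>Bs. (z \<bullet> b) *\<^sub>R b)"
      using h(2) by (intro sum.cong refl) (simp only: integral_scaleR_right
        bounded_measurable_integrable_scaleR[OF h(1) e])
    also have "\<dots> = z" using orthonormal_basis_expand[OF Bs(2,3) _ fB] that Bs(5) by simp
    finally show ?thesis .
  qed
  \<comment> \<open>The kernel part of \<open>g\<close>: adding it to the section makes the section
    pass through \<open>g\<close> at \<open>z = ?L g\<close> and changes no mean.\<close>
  define k where "k x = g x + (-1) * sec (?L g) x" for x
  have k: "bounded_measurable R0 k" unfolding k_def by (intro bounded_measurable_intros g sec)
  have LgW: "?L g \<in> W" using g(1) by (auto simp: W_def)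
  have Lk: "?L k = 0"
    using comb[OF g(1) sec[of "?L g"], of 1 "-1"] Lsec[OF LgW] by (simp add: k_def)
  \<comment> \<open>The factor \<open>fst z\<close> in front of \<open>k\<close> makes the integrand
    linear in \<open>z\<close>; it equals 1 at all the points used below.\<close>
  define \<gamma> where "\<gamma> x = (\<Sum>b\<in>Bs. h b x *\<^sub>R b) + k x *\<^sub>R (1, 0)" for x
  have \<gamma>: "z \<bullet> \<gamma> x = sec z x + fst z * k x" for z x
  proof -
    have "z \<bullet> (1, 0) = fst z" by (simp add: inner_prod_def)
    then show ?thesis
      unfolding \<gamma>_def sec_def inner_add_right inner_sum_right inner_scaleR_right by (simp add: mult.commute)
  qed
  have \<gamma>b: "bounded_measurable R0 (\<lambda>x. \<gamma> x \<bullet> v)" for v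
    unfolding inner_commute[of _ v] \<gamma> by (intro bounded_measurable_intros sec k)
  obtain c where c: "\<And>z. (\<integral>x. \<delta> x * (\<Prod>i<n. z \<bullet> \<gamma> (x i)) \<partial>iid n R0)
    = hpoly n (PiE {..<n} (\<lambda>_. Basis)) c z"
    by (rule integral_prod_inner_hpoly[OF \<delta> \<gamma>b]) blast
  have van: "hpoly n (PiE {..<n} (\<lambda>_. Basis)) c (?z P) = 0" if P: "P \<in> \<P>" for P
  proof -
    obtain u where u: "bounded_measurable R0 u" "?L u = ?z P" using z[OF P] by blast
    then have zW: "?z P \<in> W" unfolding W_def by (intro image_eqI[of _ _ u]) auto
    have bm: "bounded_measurable R0 (\<lambda>x. 1 * sec (?z P) x + 1 * k x)"
      by (intro bounded_measurable_intros sec k)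
    have "?L (\<lambda>x. 1 * sec (?z P) x + 1 * k x) = ?z P"
      unfolding comb[OF sec k] Lsec[OF zW] Lk by simp
    from fiber[OF bm P this] show ?thesis unfolding c[symmetric] \<gamma> by simp
  qed
  have "hpoly n (PiE {..<n} (\<lambda>_. Basis)) c (?L g) = 0"
    using hpoly_vanishes[OF n comp Phat van R0 bounded_measurable_integrable[OF R0.prob_space_axioms g(1)]
      g(2) bounded_measurable_integrable_scaleR[OF g(1) iT]] .
  moreover have "fst (?L g) = 1" using L[OF g(1)] g(2) by simp
  ultimately show ?thesis unfolding c[symmetric] \<gamma> by (simp add: k_def)
qed

end

section \<open>Symmetric events\<close>

definition count_in :: "nat \<Rightarrow> 'a set \<Rightarrow> (nat \<Rightarrow> 'a) \<Rightarrow> nat" where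
  "count_in n A x = card {i\<in>{..<n}. x i \<in> A}"

lemma count_in_eq_sum: "real (count_in n A x) = (\<Sum>i<n. indicator A (x i))"
  by (simp add: count_in_def indicator_def sum.If_cases Int_def)

lemma count_in_le: "count_in n A x \<le> n"
  unfolding count_in_def using card_mono[of "{..<n}" "{i\<in>{..<n}. x i \<in> A}"] by auto

lemma count_in_measurable:
  assumes A[measurable]: "A \<in> sets M"
  shows "{x\<in>space (iid n M). count_in n A x = k} \<in> sets (iid n M)"
proof -
  have "(\<lambda>x. \<Sum>i<n. indicator A (x i) :: real) \<in> borel_measurable (iid n M)" by measurable
  then have "{x\<in>space (iid n M). (\<Sum>i<n. indicator A (x i) :: real) = real k} \<in> sets (iid n M)"
    by measurable
  then show ?thesis unfolding count_in_eq_sum[symmetric] by simp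
qed

text \<open>Prescribing the counts of several sets generates a sigma-algebra of symmetric events.
  Finite intersections again have this form, which gives a pi-system, and the sample average is
  measurable for what it generates.\<close>

definition cylinder :: "nat \<Rightarrow> 'a measure \<Rightarrow> ('a set \<times> nat) list \<Rightarrow> (nat \<Rightarrow> 'a) set" where
  "cylinder n M L = {x\<in>space (iid n M). \<forall>(A, k)\<in>set L. count_in n A x = k}"

lemma cylinder_Nil: "cylinder n M [] = space (iid n M)"
  and cylinder_Cons: "cylinder n M ((A, k) # L) = {x\<in>space (iid n M). count_in n A x = k} \<inter> cylinder n M L"
  by (auto simp: cylinder_def)

lemma cylinder_append: "cylinder n M (L @ L') = cylinder n M L \<inter> cylinder n M L'"
  unfolding cylinder_def set_append ball_Un by (auto simp only: Int_iff mem_Collect_eq)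

lemma cylinder_sets: "fst ` set L \<subseteq> sets M \<Longrightarrow> cylinder n M L \<in> sets (iid n M)"
  by (induction L) (auto simp: cylinder_Nil cylinder_Cons intro!: count_in_measurable sets.Int)

lemma prod_tilt_indicator:
  fixes c :: real
  shows "(\<Prod>i<n. g (x i) * (if x i \<in> A then c else 1)) = c ^ count_in n A x * (\<Prod>i<n. g (x i))"
proof -
  have "(\<Prod>i<n. if x i \<in> A then c else 1) = c ^ count_in n A x"
    by (simp add: prod.If_cases count_in_def Int_def)
  then show ?thesis by (simp add: prod.distrib mult.commute)
qed

text \<open>Tilting \<open>g\<close> by \<open>c\<close> on \<open>A\<close> makes the vanishing integral a polynomial in \<open>c\<close> whose
  coefficients are the integrals over the level sets of the count of \<open>A\<close>.\<close>
lemma integral_cylinder_zero: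
  fixes \<delta> :: "(nat \<Rightarrow> 'a) \<Rightarrow> real"
  assumes \<delta>: "integrable (iid n M) \<delta>"
    and van: "\<And>g c. bounded_measurable M g \<Longrightarrow> 0 < c \<Longrightarrow> (\<And>x. c \<le> g x) \<Longrightarrow>
      (\<integral>x. \<delta> x * (\<Prod>i<n. g (x i)) \<partial>iid n M) = 0"
    and L: "fst ` set L \<subseteq> sets M"
    and g: "bounded_measurable M g" "0 < c" "\<And>x. c \<le> g x"
  shows "(\<integral>x. indicator (cylinder n M L) x * (\<delta> x * (\<Prod>i<n. g (x i))) \<partial>iid n M) = 0"
  using L g
\<comment> \<open>The hypothesis is applied to the tilted weight, which has a different lower bound,
  so both \<open>g\<close> and \<open>c\<close> must vary.\<close>
proof (induction L arbitrary: g c)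
  case Nil
  have "(\<integral>x. indicator (cylinder n M []) x * (\<delta> x * (\<Prod>i<n. g (x i))) \<partial>iid n M)
    = (\<integral>x. \<delta> x * (\<Prod>i<n. g (x i)) \<partial>iid n M)"
    by (intro Bochner_Integration.integral_cong) (auto simp: cylinder_Nil)
  then show ?case using van[OF Nil(2-4)] by simp
next
  case (Cons Ak L)
  obtain A k where Ak: "Ak = (A, k)" by (cases Ak)
  have A: "A \<in> sets M" and L: "fst ` set L \<subseteq> sets M" using Cons.prems(1) Ak by auto
  let ?N = "\<lambda>k. {x\<in>space (iid n M). count_in n A x = k}"
  let ?h = "\<lambda>k x. indicator (?N k) x * (indicator (cylinder n M L) x * (\<delta> x * (\<Prod>i<n. g (x i))))"
  have ih: "integrable (iid n M) (?h k)" for k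
  proof -
    have "bounded_measurable (iid n M) (\<lambda>x. indicator (?N k) x * indicator (cylinder n M L) x)"
      by (intro bounded_measurable_intros count_in_measurable A cylinder_sets L)
    from bounded_measurable_integrable_scaleR[OF this integrable_mult_prod[OF \<delta>, of "\<lambda>_. g"]]
    show ?thesis using Cons.prems(2) by (simp add: mult.assoc)
  qed
  define p where "p = (\<Sum>k\<le>n. monom (\<integral>x. ?h k x \<partial>iid n M) k)"
  have "poly p s = 0" if s: "s \<in> {0<..}" for s :: real
  proof -
    have s: "s > 0" using that by simp
    let ?g = "\<lambda>x. g x * (if x \<in> A then s else 1)"
    have "(\<lambda>x. if x \<in> A then s else 1) = (\<lambda>x. 1 + indicator A x * (s - 1))" by (auto simp: indicator_def)
    then have bm: "bounded_measurable M ?g"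
      using A Cons.prems(2) by (auto intro!: bounded_measurable_intros)
    have "c * min s 1 \<le> ?g x" for x
      using Cons.prems(3) Cons.prems(4)[of x] s by (intro mult_mono) auto
    moreover have "0 < c * min s 1" using s Cons.prems(3) by simp
    ultimately have 0: "(\<integral>x. indicator (cylinder n M L) x * (\<delta> x * (\<Prod>i<n. ?g (x i))) \<partial>iid n M) = 0"
      using Cons.IH[OF L bm] by blast
    have e: "indicator (cylinder n M L) x * (\<delta> x * (\<Prod>i<n. ?g (x i))) = (\<Sum>k\<le>n. s ^ k * ?h k x)"
      if x: "x \<in> space (iid n M)" for x
    proof -
      have "(\<Sum>k\<le>n. s ^ k * ?h k x) = (\<Sum>k\<le>n. if k = count_in n A x then s ^ k * (indicator (cylinder n M L) x * (\<delta> x * (\<Prod>i<n. g (x i)))) else 0)"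
        using x by (intro sum.cong) (auto simp: indicator_def)
      also have "\<dots> = s ^ count_in n A x * (indicator (cylinder n M L) x * (\<delta> x * (\<Prod>i<n. g (x i))))"
        using count_in_le[of n A x] by simp
      finally show ?thesis unfolding prod_tilt_indicator by (simp add: mult.left_commute)
    qed
    have "poly p s = (\<Sum>k\<le>n. s ^ k * (\<integral>x. ?h k x \<partial>iid n M))"
      by (simp add: p_def poly_sum poly_monom mult.commute)
    also have "\<dots> = (\<integral>x. (\<Sum>k\<le>n. s ^ k * ?h k x) \<partial>iid n M)"
      using ih by (subst Bochner_Integration.integral_sum) auto
    also have "\<dots> = (\<integral>x. indicator (cylinder n M L) x * (\<delta> x * (\<Prod>i<n. ?g (x i))) \<partial>iid n M)"
      by (intro Bochner_Integration.integral_cong refl) (simp only: e)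
    finally show ?thesis using 0 by simp
  qed
  then have "p = 0" by (intro poly_zero_if_zero_on_infinite[of "{0<..}"]) (auto simp: infinite_Ioi)
  then have "coeff p k = 0" by simp
  then have "k \<le> n \<Longrightarrow> (\<integral>x. ?h k x \<partial>iid n M) = 0" by (simp add: p_def coeff_sum)
  moreover have "?N k = {}" if "\<not> k \<le> n" using that count_in_le[of n A] by auto
  ultimately have "(\<integral>x. ?h k x \<partial>iid n M) = 0" by (cases "k \<le> n") simp_all
  then show ?case by (simp add: Ak cylinder_Cons indicator_inter_arith mult.assoc)
qed

text \<open>For an indicator the sum over the sample is a count; linearity and monotone limits give
  all nonnegative functions.\<close>

lemma sample_sum_measurable:
  fixes u :: "'a \<Rightarrow> ennreal"
  assumes u: "u \<in> borel_measurable M" and S: "space S = space (iid n M)"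
    and N: "\<And>A k. A \<in> sets M \<Longrightarrow> {x\<in>space S. count_in n A x = k} \<in> sets S"
  shows "(\<lambda>x. \<Sum>i<n. u (x i)) \<in> borel_measurable S"
  using u
proof (induction rule: borel_measurable_induct)
  case (cong f g)
  have "(\<Sum>i<n. f (x i)) = (\<Sum>i<n. g (x i))" if "x \<in> space S" for x
    using that cong(3) by (intro sum.cong) (auto simp: S space_PiM PiE_iff)
  then show ?case using cong(4) by (simp cong: measurable_cong)
next
  case (set A)
  have "count_in n A \<in> measurable S (count_space UNIV)"
    using N[OF set] by (intro measurable_count_space_eq2_countable[THEN iffD2]) (auto simp: vimage_def Int_def conj_commute)
  then have "(\<lambda>x. ennreal (real (count_in n A x))) \<in> borel_measurable S"
    by (rule measurable_compose) simp
  moreover have "(\<Sum>i<n. indicator A (x i)) = ennreal (real (count_in n A x))" for x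
    unfolding count_in_eq_sum by (subst sum_ennreal[symmetric]) (auto simp: indicator_def ennreal_of_nat_eq_real_of_nat intro!: sum.cong)
  ultimately show ?case by simp
next
  case (mult u c)
  then show ?case by (simp add: sum_distrib_left[symmetric])
next
  case (add u v)
  then show ?case by (simp add: sum.distrib)
next
  case (seq U)
  have "(\<Sum>i<n. (SUP j. U j) (x i)) = (SUP j. \<Sum>i<n. U j (x i))" for x
  proof -
    have "incseq (\<lambda>j. U j y)" for y using \<open>incseq U\<close> by (simp add: incseq_def le_fun_def)
    then show ?thesis by (simp add: image_comp ennreal_SUP_sum)
  qed
  then show ?case using seq.IH by (simp only:) (rule borel_measurable_SUP, auto)
qed

text \<open>The constant weight 1 shows that \<open>\<delta>\<close> annihilates the cylinders; the
  events it annihilates form a Dynkin system, hence contain the sigma-algebra they generate. The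
  sample average is measurable there, being a sum that ignores the order of the
  observations.\<close>

lemma integral_sample_stat_event_zero:
  fixes \<delta> :: "(nat \<Rightarrow> 'a) \<Rightarrow> real" and T :: "'a \<Rightarrow> 'b::euclidean_space"
  assumes M: "prob_space M" and \<delta>: "integrable (iid n M) \<delta>"
    and van: "\<And>g c. bounded_measurable M g \<Longrightarrow> 0 < c \<Longrightarrow> (\<And>x. c \<le> g x) \<Longrightarrow>
      (\<integral>x. \<delta> x * (\<Prod>i<n. g (x i)) \<partial>iid n M) = 0"
    and T[measurable]: "T \<in> borel_measurable M" and B: "B \<in> sets borel"
  shows "(\<integral>x. indicator B (sample_stat n T x) * \<delta> x \<partial>iid n M) = 0"
proof -
  let ?\<Omega> = "space (iid n M)"
  define G where "G = {cylinder n M L | L. fst ` set L \<subseteq> sets M}"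
  define S where "S = sigma ?\<Omega> G"
  have GP: "G \<subseteq> Pow ?\<Omega>" by (auto simp: G_def cylinder_def)
  have Gs: "G \<subseteq> sets (iid n M)" by (auto simp: G_def intro: cylinder_sets)
  have sig: "sigma_sets ?\<Omega> G \<subseteq> sets (iid n M)" using Gs by (rule sets.sigma_sets_subset)
  have S: "space S = ?\<Omega>" "sets S = sigma_sets ?\<Omega> G" using GP by (simp_all add: S_def)
  have int: "Int_stable G"
  proof (rule Int_stableI)
    fix a b assume "a \<in> G" "b \<in> G"
    then obtain L L' where L: "a = cylinder n M L" "b = cylinder n M L'"
      "fst ` set L \<subseteq> sets M" "fst ` set L' \<subseteq> sets M" by (auto simp: G_def)
    then have "fst ` set (L @ L') \<subseteq> sets M" by auto
    then show "a \<inter> b \<in> G" unfolding G_def L(1,2) cylinder_append[symmetric] by blast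
  qed
  have zero: "(\<integral>x. indicator D x * \<delta> x \<partial>iid n M) = 0" if D: "D \<in> sigma_sets ?\<Omega> G" for D
    using int GP D
  proof (induction rule: sigma_sets_induct_disjoint)
    case (basic A)
    then obtain L where L: "A = cylinder n M L" "fst ` set L \<subseteq> sets M" by (auto simp: G_def)
    from integral_cylinder_zero[OF \<delta> van L(2) bounded_measurable_const[of M 1] zero_less_one] L(1)
    show ?case by simp
  next
    case (compl A)
    have A: "A \<in> sets (iid n M)" using compl sig by blast
    have "(\<integral>x. indicator (?\<Omega> - A) x * \<delta> x \<partial>iid n M) = (\<integral>x. \<delta> x - indicator A x * \<delta> x \<partial>iid n M)"
      by (intro Bochner_Integration.integral_cong) (auto simp: indicator_def)
    also have "\<dots> = (\<integral>x. \<delta> x \<partial>iid n M)"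
      using compl(2) \<delta> integrable_real_mult_indicator[OF A \<delta>] by (simp add: mult.commute)
    also have "\<dots> = 0" using van[OF bounded_measurable_const[of M 1] zero_less_one] by simp
    finally show ?case .
  next
    case (union A)
    have A: "A i \<in> sets (iid n M)" for i using union(2) sig by blast
    have "(LINT x:(\<Union>i. A i)|iid n M. \<delta> x) = (\<Sum>i. (LINT x:(A i)|iid n M. \<delta> x))"
    proof (rule lebesgue_integral_countable_add)
      show "A i \<inter> A j = {}" if "i \<noteq> j" for i j using union(1) that by (auto simp: disjoint_family_on_def)
      show "set_integrable (iid n M) (\<Union> (range A)) \<delta>"
        unfolding set_integrable_def using A \<delta> by (intro integrable_mult_indicator) auto
    qed (rule A)
    then show ?case using union(3) by (simp add: set_lebesgue_integral_def)
  qed simp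
  have N: "{x\<in>space S. count_in n A x = k} \<in> sets S" if "A \<in> sets M" for A k
  proof -
    have "{x\<in>space S. count_in n A x = k} = cylinder n M [(A, k)]" by (auto simp: S cylinder_def)
    moreover have "cylinder n M [(A, k)] \<in> G" using that by (auto simp: G_def intro!: exI[of _ "[(A, k)]"])
    ultimately show ?thesis using S(2) by auto
  qed
  have "(\<lambda>x. sample_stat n T x \<bullet> b) \<in> borel_measurable S" for b
  proof -
    have *: "(\<lambda>x. \<Sum>i<n. ennreal (s * (T (x i) \<bullet> b))) \<in> borel_measurable S" for s
      by (rule sample_sum_measurable[OF _ S(1) N]) simp_all
    \<comment> \<open>\<open>ennreal\<close> truncates negative numbers to 0, so the two terms are
      the sums of positive and of negative parts.\<close>
    have "(\<Sum>i<n. T (x i) \<bullet> b) = enn2real (\<Sum>i<n. ennreal (1 * (T (x i) \<bullet> b)))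
        - enn2real (\<Sum>i<n. ennreal ((-1) * (T (x i) \<bullet> b)))" for x
    proof -
      have q: "(\<Sum>i<n. ennreal (s * (T (x i) \<bullet> b))) = ennreal (\<Sum>i<n. max 0 (s * (T (x i) \<bullet> b)))" for s
        by (simp add: sum_ennreal[symmetric] ennreal_max_0 del: sum_ennreal)
      have r: "(\<Sum>i<n. T (x i) \<bullet> b) = (\<Sum>i<n. max 0 (1 * (T (x i) \<bullet> b))) - (\<Sum>i<n. max 0 ((-1) * (T (x i) \<bullet> b)))"
        unfolding sum_subtractf[symmetric] by (intro sum.cong) (auto simp: max_def)
      show ?thesis unfolding q r by (subst (1 2) enn2real_ennreal) (auto intro!: sum_nonneg)
    qed
    then have "(\<lambda>x. \<Sum>i<n. T (x i) \<bullet> b) \<in> borel_measurable S"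
      using *[of 1] *[of "-1"] by simp
    then have "(\<lambda>x. (1 / real n) * (\<Sum>i<n. T (x i) \<bullet> b)) \<in> borel_measurable S" by simp
    then show ?thesis by (simp add: sample_stat_def inner_sum_left)
  qed
  then have "sample_stat n T \<in> borel_measurable S" by (subst borel_measurable_euclidean_space) simp
  then have "sample_stat n T -` B \<inter> space S \<in> sets S" using B by (rule measurable_sets)
  then have "(\<integral>x. indicator (sample_stat n T -` B \<inter> ?\<Omega>) x * \<delta> x \<partial>iid n M) = 0"
    using zero S by simp
  moreover have "(\<integral>x. indicator (sample_stat n T -` B \<inter> ?\<Omega>) x * \<delta> x \<partial>iid n M)
    = (\<integral>x. indicator B (sample_stat n T x) * \<delta> x \<partial>iid n M)"
    by (intro Bochner_Integration.integral_cong) (auto simp: indicator_def)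
  ultimately show ?thesis by simp
qed

section \<open>The Pythagorean identity\<close>

text \<open>A measurable selection with finitely many values: the strict comparison keeps the
  earliest maximiser among the indices up to \<open>N\<close>. With log-likelihood gains for
  \<open>a\<close>, it picks the best of the first \<open>Suc N\<close> members.\<close>

primrec argmax_idx :: "(nat \<Rightarrow> 'b \<Rightarrow> real) \<Rightarrow> nat \<Rightarrow> 'b \<Rightarrow> nat" where
  "argmax_idx a 0 \<tau> = 0"
| "argmax_idx a (Suc N) \<tau> =
    (if a (argmax_idx a N \<tau>) \<tau> < a (Suc N) \<tau> then Suc N else argmax_idx a N \<tau>)"

lemma argmax_idx_le: "argmax_idx a N \<tau> \<le> N"
  by (induction N) (auto intro: le_SucI)

lemma argmax_idx_ge: "k \<le> N \<Longrightarrow> a k \<tau> \<le> a (argmax_idx a N \<tau>) \<tau>"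
  by (induction N) (auto simp: le_Suc_eq not_less)

lemma argmax_idx_measurable:
  assumes a: "\<And>k. a k \<in> borel_measurable borel"
  shows "argmax_idx a N \<in> measurable borel (count_space UNIV)"
proof (induction N)
  case (Suc N)
  have [measurable]: "argmax_idx a N \<in> measurable borel (count_space UNIV)" by (rule Suc)
  have [measurable]: "(\<lambda>\<tau>. a (argmax_idx a N \<tau>) \<tau>) \<in> borel_measurable borel"
    by (rule measurable_compose_countable[OF a Suc])
  have [measurable]: "a (Suc N) \<in> borel_measurable borel" by (rule a)
  have "(\<lambda>\<tau>. if a (argmax_idx a N \<tau>) \<tau> < a (Suc N) \<tau> then Suc N else argmax_idx a N \<tau>)
    \<in> measurable borel (count_space UNIV)" by measurable
  then show ?case by simp
qed simp

lemma sum_level_sets: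
  fixes f :: "nat \<Rightarrow> real"
  shows "k \<le> N \<Longrightarrow> f k = (\<Sum>j\<le>N. indicator {j} k * f j)"
  by (subst sum.cong[OF refl, of _ _ "\<lambda>j. if j = k then f j else 0"]) (auto simp: indicator_def)

context exp_family
begin

text \<open>The pairs \<open>(lc Q, th Q)\<close> lie in a separable space, and for fixed
  \<open>\<tau>\<close> the log density is continuous in them. The prescribed member comes first so
  that the best gain over it is never negative.\<close>

lemma countable_family_dense:
  assumes P: "P \<in> \<P>"
  obtains p :: "nat \<Rightarrow> 'a measure" where "\<And>k. p k \<in> \<P>" "p 0 = P"
    "\<forall>Q\<in>\<P>. \<forall>\<tau>. \<forall>\<epsilon>>0. \<exists>k. ld Q \<tau> - \<epsilon> < ld (p k) \<tau>"
proof -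
  let ?c = "\<lambda>Q. (lc Q, th Q)"
  obtain D where D: "countable D" "D \<subseteq> ?c ` \<P>" "?c ` \<P> \<subseteq> closure D" by (rule separable)
  have "D \<noteq> {}" using D(3) P by auto
  then have ran: "range (from_nat_into D) = D" using D(1) by (rule range_from_nat_into)
  then have "\<forall>k. \<exists>Q. Q \<in> \<P> \<and> from_nat_into D k = ?c Q" using D(2) by blast
  then obtain q where q: "\<And>k. q k \<in> \<P>" "\<And>k. from_nat_into D k = ?c (q k)" by metis
  show ?thesis
  proof (rule that[of "case_nat P q"])
    show "case_nat P q k \<in> \<P>" for k using P q(1) by (cases k) auto
    show "case_nat P q 0 = P" by simp
    show "\<forall>Q\<in>\<P>. \<forall>\<tau>. \<forall>\<epsilon>>0. \<exists>k. ld Q \<tau> - \<epsilon> < ld (case_nat P q k) \<tau>"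
    proof (intro ballI allI impI)
      fix Q and \<tau> :: 'b and \<epsilon> :: real assume Q: "Q \<in> \<P>" and \<epsilon>: "0 < \<epsilon>"
      let ?f = "\<lambda>z. fst z + snd z \<bullet> \<tau>"
      have "open {z. ?f (?c Q) - \<epsilon> < ?f z}" by (intro open_Collect_less continuous_intros)
      moreover have "?c Q \<in> closure D" "?c Q \<in> {z. ?f (?c Q) - \<epsilon> < ?f z}" using D(3) Q \<epsilon> by auto
      ultimately obtain d where "d \<in> D" "?f (?c Q) - \<epsilon> < ?f d"
        using open_Int_closure_eq_empty[of "{z. ?f (?c Q) - \<epsilon> < ?f z}" D] by blast
      moreover then obtain k where "d = ?c (q k)" using ran q(2) by (metis imageE)
      ultimately have "ld Q \<tau> - \<epsilon> < ld (case_nat P q (Suc k)) \<tau>" by (simp add: ld_def)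
      then show "\<exists>k. ld Q \<tau> - \<epsilon> < ld (case_nat P q k) \<tau>" by blast
    qed
  qed
qed

text \<open>Unbiasedness at a tilt of \<open>R0\<close> equates the means of the estimate and of the
  sample statistic under the tilted sample law; rewritten under \<open>R0\<close>, this is a
  vanishing integral weighted by the sample density.\<close>

lemma estimator_mean_orthogonal:
  assumes n: "n \<ge> 1" and comp: "complete_statistic n T \<P>"
    and mle: "is_MLE n lam T \<P> Phat \<or> is_extended_MLE n lam T \<P> Phat"
    and R: "estimator n lam R" and unb: "dist_unbiased n T \<P> (admissible n lam T \<P> {Phat, R}) R"
    and R0: "R0 \<in> admissible n lam T \<P> {Phat, R}" and B: "B \<in> sets borel"
  shows "(\<integral>x. indicator B (sample_stat n T x) * ((mean T (R x) - sample_stat n T x) \<bullet> v) \<partial>iid n R0) = 0"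
proof -
  note A = admissibleD[OF R0] and bd = MLE_boundary_member[OF mle]
  note D = dominatedD[OF A(1)]
  interpret R0: prob_space R0 by (rule D(1))
  have Es: "R' \<in> {Phat, R} \<Longrightarrow> estimator n lam R'" for R' using R bd(2) by auto
  let ?\<delta> = "\<lambda>x. (mean T (R x) - sample_stat n T x) \<bullet> v"
  have iR: "integrable (iid n R0) (\<lambda>x. mean T (R x))" by (rule KL_mean_integral(2)[OF R A(1) A(8)]) simp
  have it: "integrable (iid n R0) (sample_stat n T)" by (rule integral_sample_stat(1)[OF D(1) n A(4)])
  have \<delta>: "integrable (iid n R0) ?\<delta>" using iR it by simp
  have hyp: "(\<integral>x. ?\<delta> x * (\<Prod>i<n. u (x i)) \<partial>iid n R0) = 0"
    if u: "bounded_measurable R0 u" and c: "0 < c" "\<And>x. c \<le> u x" and pr: "prob_space (density R0 u)"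
      and P: "P \<in> \<P>" "mean T P = mean T (density R0 u)" for u c P
  proof -
    have [measurable]: "u \<in> borel_measurable R0" by (rule bounded_measurableD[OF u])
    have u0: "0 \<le> u x" for x using c(1) c(2)[of x] by simp
    obtain C where C: "\<And>x. \<bar>u x\<bar> \<le> C" using bounded_measurable_bound[OF u] by metis
    let ?D = "density R0 u"
    have adm: "?D \<in> admissible n lam T \<P> {Phat, R}"
      using admissible_density[OF R0 Es _ c _ pr P, of C] C by (auto intro: order_trans[OF abs_ge_self])
    note A' = admissibleD[OF adm]
    have i1: "integrable (iid n ?D) (\<lambda>x. mean T (R x))"
      and i2: "integrable (iid n ?D) (sample_stat n T)"
      using KL_mean_integral(2)[OF R A'(1) A'(8)] integral_sample_stat(1)[OF pr n A'(4)] by auto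
    have "(\<integral>x. mean T (R x) \<partial>iid n ?D) = mean T ?D"
      using KL_mean_integral(3)[OF R A'(1) A'(8)] mean_KL_mean_unbiased[OF R unb adm] by simp
    also have "\<dots> = (\<integral>x. sample_stat n T x \<partial>iid n ?D)"
      by (rule integral_sample_stat(2)[OF pr n A'(4), symmetric])
    finally have "(\<integral>x. mean T (R x) - sample_stat n T x \<partial>iid n ?D) = 0" using i1 i2 by simp
    moreover have "(\<integral>x. ?\<delta> x \<partial>iid n ?D) = (\<integral>x. mean T (R x) - sample_stat n T x \<partial>iid n ?D) \<bullet> v"
      by (rule integral_inner_left) (use i1 i2 in auto)
    ultimately have "(\<integral>x. ?\<delta> x \<partial>iid n ?D) = 0" by simp
    moreover have "iid n ?D = density (iid n R0) (\<lambda>x. ennreal (\<Prod>i<n. u (x i)))"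
      using PiM_density[of "{..<n}" R0 "\<lambda>x. ennreal (u x)"] D(1) pr u0
      by (simp add: prod_ennreal prob_space_imp_sigma_finite)
    moreover have "?\<delta> \<in> borel_measurable (iid n R0)" using \<delta> by simp
    ultimately show ?thesis
      using u0 by (simp add: integral_density prod_nonneg mult.commute)
  qed
  have van: "(\<integral>x. ?\<delta> x * (\<Prod>i<n. g (x i)) \<partial>iid n R0) = 0"
    if g: "bounded_measurable R0 g" and c: "0 < c" "\<And>x. c \<le> g x" for g c
  proof -
    \<comment> \<open>The vanishing result needs total mass 1; by homogeneity of degree
      \<open>n\<close>, normalising costs only the factor \<open>(1 / ?I) ^ n\<close>.\<close>
    let ?I = "\<integral>x. g x \<partial>R0"
    have ig: "integrable R0 g" by (rule bounded_measurable_integrable[OF R0.prob_space_axioms g])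
    have "(\<integral>x. c \<partial>R0) \<le> ?I" using ig c by (intro integral_mono) auto
    then have I: "?I > 0" using c(1) by (simp add: R0.prob_space)
    have "(\<integral>x. ?\<delta> x * (\<Prod>i<n. (1 / ?I) * g (x i)) \<partial>iid n R0) = 0"
    proof (rule unbiased_vanishes[OF n comp bd(1) A(1,3,4) \<delta> hyp])
      show "bounded_measurable R0 (\<lambda>x. (1 / ?I) * g x)" by (intro bounded_measurable_intros g)
      show "(\<integral>x. (1 / ?I) * g x \<partial>R0) = 1" using I by simp
    qed
    moreover have "?\<delta> x * (\<Prod>i<n. (1 / ?I) * g (x i)) = (1 / ?I) ^ n * (?\<delta> x * (\<Prod>i<n. g (x i)))" for x
      by (simp only: prod.distrib prod_constant card_lessThan mult.left_commute)
    ultimately have "(1 / ?I) ^ n * (\<integral>x. ?\<delta> x * (\<Prod>i<n. g (x i)) \<partial>iid n R0) = 0"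
      by (simp only: integral_mult_right_zero)
    then show ?thesis using I by simp
  qed
  have "T \<in> borel_measurable R0" using A(4) by simp
  from integral_sample_stat_event_zero[OF D(1) \<delta> van this B] show ?thesis .
qed

text \<open>The gain from \<open>P\<close> to the selected member is affine in the mean of the
  estimate. The selection takes finitely many values and depends on \<open>t\<close> alone, so
  orthogonality on its level sets replaces that mean by \<open>t\<close> in expectation. The
  expected gain is then the same for every estimator to which the lemma applies. The variable
  \<open>y\<close> is a real version of the remaining divergence.\<close>

lemma pythagoras:
  fixes p :: "nat \<Rightarrow> 'a measure" and P :: "'a measure"
  defines "a \<equiv> \<lambda>k \<tau>. ld (p k) \<tau> - ld P \<tau>"
  assumes n: "n \<ge> 1" and R: "estimator n lam R" and R0: "R0 \<in> dominated lam"
    and iT: "integrable R0 T" and iK: "integrable (KL_mean n R0 R) T"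
    and P: "P \<in> \<P>" and fin: "expected_KL n R0 R P < \<infinity>" and p: "\<And>k. p k \<in> \<P>"
    and orth: "\<And>B v. B \<in> sets borel \<Longrightarrow>
      (\<integral>x. indicator B (sample_stat n T x) * ((mean T (R x) - sample_stat n T x) \<bullet> v) \<partial>iid n R0) = 0"
  shows "\<exists>y. integrable (iid n R0) y
      \<and> (AE x in iid n R0. 0 \<le> y x \<and> KL (R x) (p (argmax_idx a N (sample_stat n T x))) = ennreal (y x))
      \<and> (\<integral>x. y x \<partial>iid n R0) = enn2real (expected_KL n R0 R P)
        - (\<integral>x. a (argmax_idx a N (sample_stat n T x)) (sample_stat n T x) \<partial>iid n R0)" (is ?thesis1)
    and "integrable (iid n R0) (\<lambda>x. a (argmax_idx a N (sample_stat n T x)) (sample_stat n T x))" (is ?thesis2)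
proof -
  let ?M = "iid n R0" and ?X = "sample_stat n T" and ?\<kappa> = "argmax_idx a N"
  let ?\<mu> = "\<lambda>x. mean T (R x)" and ?k = "\<lambda>x. enn2real (KL (R x) P)"
  interpret M: prob_space ?M by (rule prob_space_iid[OF R0])
  have i\<mu>: "integrable ?M ?\<mu>" by (rule KL_mean_integral(2)[OF R R0 iK])
  have iX: "integrable ?M ?X" by (rule integral_sample_stat(1)[OF dominatedD(1)[OF R0] n iT])
  have am: "a k \<in> borel_measurable borel" for k unfolding a_def by measurable
  have \<kappa>: "?\<kappa> \<in> measurable borel (count_space UNIV)" by (rule argmax_idx_measurable[OF am])
  have S: "?\<kappa> -` {j} \<in> sets borel" for j
    using measurable_sets[OF \<kappa>, of "{j}"] by simp
  have Xm[measurable]: "?X \<in> borel_measurable ?M" using iX by simp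
  have XS: "?X -` (?\<kappa> -` {j}) \<inter> space ?M \<in> sets ?M" for j using Xm S by (rule measurable_sets)
  have ind: "integrable ?M (\<lambda>x. indicator (?\<kappa> -` {j}) (?X x) * f x)" if "integrable ?M f" for j and f :: "_ \<Rightarrow> real"
  proof -
    have "integrable ?M (\<lambda>x. indicator (?X -` (?\<kappa> -` {j}) \<inter> space ?M) x * f x)"
      using bounded_measurable_integrable_scaleR[OF bounded_measurable_indicator[OF XS] that] by simp
    moreover have "integrable ?M (\<lambda>x. indicator (?\<kappa> -` {j}) (?X x) * f x) \<longleftrightarrow>
      integrable ?M (\<lambda>x. indicator (?X -` (?\<kappa> -` {j}) \<inter> space ?M) x * f x)"
      by (rule Bochner_Integration.integrable_cong) (auto simp: indicator_def)
    ultimately show ?thesis by simp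
  qed
  have ia: "integrable ?M (\<lambda>x. a j (f x))" if "integrable ?M f" for j f
    unfolding a_def using integrable_ld(1)[OF M.prob_space_axioms that] by simp
  \<comment> \<open>The statistic used for selection and the argument of the gain are kept apart:
    the identity is needed both at the mean of the estimate and at \<open>t\<close>.\<close>
  have dec: "a (?\<kappa> \<tau>) \<sigma> = (\<Sum>j\<le>N. indicator (?\<kappa> -` {j}) \<tau> * a j \<sigma>)" for \<tau> \<sigma>
  proof -
    have "(indicator (?\<kappa> -` {j}) \<tau> :: real) = indicator {j} (?\<kappa> \<tau>)" for j by (simp add: indicator_def)
    then show ?thesis by (simp only: sum_level_sets[OF argmax_idx_le[of a N \<tau>], of "\<lambda>j. a j \<sigma>"])
  qed
  have i1: "integrable ?M (\<lambda>x. a (?\<kappa> (?X x)) (?\<mu> x))" and i2: "integrable ?M (\<lambda>x. a (?\<kappa> (?X x)) (?X x))"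
    unfolding dec by (intro Bochner_Integration.integrable_sum ind ia i\<mu> iX)+
  have "(\<integral>x. a (?\<kappa> (?X x)) (?\<mu> x) - a (?\<kappa> (?X x)) (?X x) \<partial>?M)
    = (\<integral>x. (\<Sum>j\<le>N. indicator (?\<kappa> -` {j}) (?X x) * ((?\<mu> x - ?X x) \<bullet> (th (p j) - th P))) \<partial>?M)"
  proof (intro Bochner_Integration.integral_cong refl)
    fix x
    have "a j (?\<mu> x) - a j (?X x) = (?\<mu> x - ?X x) \<bullet> (th (p j) - th P)" for j
      by (simp add: a_def ld_def inner_diff_left inner_diff_right inner_commute)
    then show "a (?\<kappa> (?X x)) (?\<mu> x) - a (?\<kappa> (?X x)) (?X x)
      = (\<Sum>j\<le>N. indicator (?\<kappa> -` {j}) (?X x) * ((?\<mu> x - ?X x) \<bullet> (th (p j) - th P)))"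
      unfolding dec sum_subtractf[symmetric] right_diff_distrib[symmetric] by simp
  qed
  also have "\<dots> = (\<Sum>j\<le>N. \<integral>x. indicator (?\<kappa> -` {j}) (?X x) * ((?\<mu> x - ?X x) \<bullet> (th (p j) - th P)) \<partial>?M)"
    by (rule Bochner_Integration.integral_sum) (intro ind, use i\<mu> iX in auto)
  also have "\<dots> = 0" using orth[OF S] by simp
  finally have eq: "(\<integral>x. a (?\<kappa> (?X x)) (?\<mu> x) \<partial>?M) = (\<integral>x. a (?\<kappa> (?X x)) (?X x) \<partial>?M)"
    using i1 i2 by simp
  note E = expected_KL_finite[OF R R0 P fin]
  show ?thesis2 by (rule i2)
  show ?thesis1
  proof (intro exI conjI)
    show "integrable ?M (\<lambda>x. ?k x - a (?\<kappa> (?X x)) (?\<mu> x))" using E(2) i1 by simp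
    show "(\<integral>x. ?k x - a (?\<kappa> (?X x)) (?\<mu> x) \<partial>?M) = enn2real (expected_KL n R0 R P)
      - (\<integral>x. a (?\<kappa> (?X x)) (?X x) \<partial>?M)" using E(2,3) i1 eq by simp
    show "AE x in ?M. 0 \<le> ?k x - a (?\<kappa> (?X x)) (?\<mu> x) \<and>
      KL (R x) (p (?\<kappa> (?X x))) = ennreal (?k x - a (?\<kappa> (?X x)) (?\<mu> x))"
      using KL_change_AE[OF R R0 iK P fin]
    proof eventually_elim
      case (elim x)
      let ?Q = "p (?\<kappa> (?X x))"
      have K: "KL (R x) ?Q < \<infinity>" "enn2real (KL (R x) ?Q) = ?k x - a (?\<kappa> (?X x)) (?\<mu> x)"
        using elim p by (auto simp: a_def)
      have "KL (R x) ?Q = ennreal (enn2real (KL (R x) ?Q))" using K(1) by simp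
      then show ?case using K(2) enn2real_nonneg[of "KL (R x) ?Q"] by metis
    qed
  qed
qed

end

section \<open>Optimality and uniqueness of the estimate\<close>

context exp_family
begin

text \<open>For \<open>Phat\<close> the divergence from the selected member tends to zero, so the
  expected gain tends to its variance. For \<open>R\<close> the same gain leaves a nonnegative
  remainder, which gives the inequality. At equality this remainder tends to zero, so
  \<open>R\<close> and \<open>Phat\<close> both approach the same members.\<close>

lemma MLE_optimal:
  assumes n: "n \<ge> 1" and comp: "complete_statistic n T \<P>"
    and mle: "is_MLE n lam T \<P> Phat \<or> is_extended_MLE n lam T \<P> Phat"
    and R: "estimator n lam R" and unb: "dist_unbiased n T \<P> (admissible n lam T \<P> {Phat, R}) R"
    and R0: "R0 \<in> admissible n lam T \<P> {Phat, R}"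
  shows "dist_variance n \<P> R0 Phat \<le> dist_variance n \<P> R0 R"
    and "dist_variance n \<P> R0 R = dist_variance n \<P> R0 Phat \<Longrightarrow> AE x in iid n lam. R x = Phat x"
proof -
  note A = admissibleD[OF R0] and bd = MLE_boundary_member[OF mle]
  note AR = A(7,8)[OF insertI2[OF insertI1]] and AP = A(7,8)[OF insertI1]
  let ?M = "iid n R0" and ?X = "sample_stat n T"
  obtain P where P: "P \<in> \<P>" "mean T P = mean T R0" using A(5) by blast
  have "mean T P = mean T (KL_mean n R0 R)" using mean_KL_mean_unbiased[OF R unb R0] P(2) by simp
  note vR = dist_mean_eq(3,4)[OF R A(1) AR(2,1) P(1) this]
  have "mean T P = mean T (KL_mean n R0 Phat)" using mean_KL_mean_MLE[OF n mle R0] P(2) by simp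
  note vP = dist_mean_eq(3,4)[OF bd(2) A(1) AP(2,1) P(1) this]
  obtain p :: "nat \<Rightarrow> 'a measure" where p: "\<And>k. p k \<in> \<P>" "p 0 = P"
    "\<forall>Q\<in>\<P>. \<forall>\<tau>. \<forall>\<epsilon>>0. \<exists>k. ld Q \<tau> - \<epsilon> < ld (p k) \<tau>"
    by (rule countable_family_dense[OF P(1)]) blast
  define a where "a = (\<lambda>k \<tau>. ld (p k) \<tau> - ld P \<tau>)"
  \<comment> \<open>The log-likelihood gain per observation over \<open>P\<close> of the best among
    the first \<open>Suc N\<close> members.\<close>
  define m where "m N x = a (argmax_idx a N (?X x)) (?X x)" for N x
  have bdM: "AE x in ?M. boundary_member lam T \<P> (?X x) (Phat x)"
    using bd(1) unfolding AE_iid[OF A(1,3)] .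
  \<comment> \<open>For the estimate itself the mean equals the sample statistic almost everywhere,
    so orthogonality is immediate and the identity applies to it as well.\<close>
  have orthP: "(\<integral>x. indicator B (?X x) * ((mean T (Phat x) - ?X x) \<bullet> v) \<partial>?M) = 0"
    for B v
    by (rule integral_eq_zero_AE) (use bdM in \<open>eventually_elim, simp add: boundary_member_def\<close>)
  have "\<exists>y. integrable ?M y
    \<and> (AE x in ?M. 0 \<le> y x \<and> KL (R x) (p (argmax_idx a N (?X x))) = ennreal (y x))
    \<and> (\<integral>x. y x \<partial>?M) = enn2real (expected_KL n R0 R P) - (\<integral>x. m N x \<partial>?M)" for N
    unfolding a_def m_def
    by (rule pythagoras(1)[OF n R A(1,4) AR(2) P(1) vR(2) p(1)
      estimator_mean_orthogonal[OF n comp mle R unb R0]])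
  from choice[OF allI, OF this] obtain yR where yR: "\<forall>N. integrable ?M (yR N)
    \<and> (AE x in ?M. 0 \<le> yR N x \<and> KL (R x) (p (argmax_idx a N (?X x))) = ennreal (yR N x))
    \<and> (\<integral>x. yR N x \<partial>?M) = enn2real (expected_KL n R0 R P) - (\<integral>x. m N x \<partial>?M)" ..
  note yR = yR[THEN spec, THEN conjunct1] yR[THEN spec, THEN conjunct2, THEN conjunct1]
    yR[THEN spec, THEN conjunct2, THEN conjunct2]
  have "\<exists>y. integrable ?M y
    \<and> (AE x in ?M. 0 \<le> y x \<and> KL (Phat x) (p (argmax_idx a N (?X x))) = ennreal (y x))
    \<and> (\<integral>x. y x \<partial>?M) = enn2real (expected_KL n R0 Phat P) - (\<integral>x. m N x \<partial>?M)" for N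
    unfolding a_def m_def
    by (rule pythagoras(1)[OF n bd(2) A(1,4) AP(2) P(1) vP(2) p(1) orthP])
  from choice[OF allI, OF this] obtain yP where yP: "\<forall>N. integrable ?M (yP N)
    \<and> (AE x in ?M. 0 \<le> yP N x \<and> KL (Phat x) (p (argmax_idx a N (?X x))) = ennreal (yP N x))
    \<and> (\<integral>x. yP N x \<partial>?M) = enn2real (expected_KL n R0 Phat P) - (\<integral>x. m N x \<partial>?M)" ..
  note yP = yP[THEN spec, THEN conjunct1] yP[THEN spec, THEN conjunct2, THEN conjunct1]
    yP[THEN spec, THEN conjunct2, THEN conjunct2]
  have im: "integrable ?M (m N)" for N
    unfolding a_def m_def
    by (rule pythagoras(2)[OF n bd(2) A(1,4) AP(2) P(1) vP(2) p(1) orthP])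
  let ?k = "\<lambda>x. enn2real (KL (Phat x) P)"
  note E = expected_KL_finite[OF bd(2) A(1) P(1) vP(2)]
  have KP: "AE x in ?M. \<forall>Q\<in>\<P>. KL (Phat x) Q < \<infinity> \<and>
    enn2real (KL (Phat x) Q) = ?k x + ld P (?X x) - ld Q (?X x)"
    using KL_change_AE[OF bd(2) A(1) AP(2) P(1) vP(2)] bdM
    by eventually_elim (simp add: boundary_member_def)
  have m0: "0 \<le> m N x" for N x
    using argmax_idx_ge[of 0 N a "?X x"] p(2) by (simp add: m_def a_def)
  \<comment> \<open>The gain cannot exceed the divergence from \<open>P\<close>, since the
    divergence left from the selected member is nonnegative. This provides the dominating
    function.\<close>
  have mk: "AE x in ?M. norm (m N x) \<le> ?k x" for N
    using KP
  proof eventually_elim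
    case (elim x)
    have "enn2real (KL (Phat x) (p (argmax_idx a N (?X x)))) = ?k x - m N x"
      using elim p(1) by (simp add: m_def a_def)
    then have "m N x \<le> ?k x" using enn2real_nonneg[of "KL (Phat x) (p (argmax_idx a N (?X x)))"] by linarith
    then show ?case using m0[of N x] by simp
  qed
  have mkA: "AE x in ?M. \<forall>N. norm (m N x) \<le> ?k x"
    unfolding AE_all_countable by (rule allI) (rule mk)
  \<comment> \<open>Half of \<open>r\<close> is spent on a member \<open>Q\<close> nearly attaining
    the infimum zero, the other half on an element of the dense sequence close to \<open>Q\<close>
    at the observed statistic.\<close>
  have mlim: "AE x in ?M. (\<lambda>N. m N x) \<longlonglongrightarrow> ?k x"
    using KP bdM mkA
  proof eventually_elim
    case (elim x)
    show ?case
    proof (rule LIMSEQ_I)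
      fix r :: real assume r: "0 < r"
      have "(INF Q\<in>\<P>. KL (Phat x) Q) < ennreal (r / 2)" using elim(2) r by (simp add: boundary_member_def)
      then obtain Q where Q: "Q \<in> \<P>" "KL (Phat x) Q < ennreal (r / 2)" by (auto simp: INF_less_iff)
      then have "enn2real (KL (Phat x) Q) < r / 2"
        using elim(1) r by (cases "KL (Phat x) Q") (auto simp: ennreal_less_iff)
      then have kQ: "?k x + ld P (?X x) - ld Q (?X x) < r / 2" using elim(1) Q(1) by simp
      obtain K where K: "ld Q (?X x) - r / 2 < ld (p K) (?X x)" using p(3)[rule_format, OF Q(1), of "r / 2"] r by auto
      have "norm (m N x - ?k x) < r" if "K \<le> N" for N
      proof -
        have "a K (?X x) \<le> m N x" using argmax_idx_ge[OF that, of a "?X x"] by (simp add: m_def)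
        then have "?k x - r < m N x" using K kQ by (simp add: a_def)
        then show ?thesis using elim(3)[rule_format, of N] m0[of N x] by simp
      qed
      then show "\<exists>K. \<forall>N\<ge>K. norm (m N x - ?k x) < r" by blast
    qed
  qed
  have lim: "(\<lambda>N. \<integral>x. m N x \<partial>?M) \<longlonglongrightarrow> enn2real (expected_KL n R0 Phat P)"
    unfolding E(3)[symmetric]
    by (rule integral_dominated_convergence[OF _ _ E(2) mlim mk]) (use E(2) im in auto)
  have ennr: "expected_KL n R0 R P = ennreal (enn2real (expected_KL n R0 R P))"
    "expected_KL n R0 Phat P = ennreal (enn2real (expected_KL n R0 Phat P))"
    using vR(2) vP(2) by simp_all
  \<comment> \<open>The difference of the two sides is the expected divergence of \<open>R\<close>
    from the selected member.\<close>
  have "(\<integral>x. m N x \<partial>?M) \<le> enn2real (expected_KL n R0 R P)" for N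
  proof -
    have "0 \<le> (\<integral>x. yR N x \<partial>?M)" by (rule integral_nonneg_AE) (use yR(2)[of N] in \<open>auto elim!: eventually_mono\<close>)
    then show ?thesis using yR(3) by simp
  qed
  then have "enn2real (expected_KL n R0 Phat P) \<le> enn2real (expected_KL n R0 R P)"
    by (intro LIMSEQ_le_const2[OF lim]) auto
  then show "dist_variance n \<P> R0 Phat \<le> dist_variance n \<P> R0 R"
    unfolding vR(1) vP(1) by (subst ennr(1), subst ennr(2)) (rule ennreal_leI)
  assume eq: "dist_variance n \<P> R0 R = dist_variance n \<P> R0 Phat"
  obtain r :: "(nat \<Rightarrow> 'a) \<Rightarrow> 'a \<Rightarrow> real" where r:
    "case_prod r \<in> borel_measurable (iid n P0 \<Otimes>\<^sub>M P0)" "\<And>x y. 0 \<le> r x y"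
    "\<And>x. x \<in> space (iid n P0) \<Longrightarrow> R x = density P0 (r x)"
    by (rule estimator_density[OF R]) blast
  obtain q :: "(nat \<Rightarrow> 'a) \<Rightarrow> 'a \<Rightarrow> real" where q:
    "case_prod q \<in> borel_measurable (iid n P0 \<Otimes>\<^sub>M P0)" "\<And>x y. 0 \<le> q x y"
    "\<And>x. x \<in> space (iid n P0) \<Longrightarrow> Phat x = density P0 (q x)"
    by (rule estimator_density[OF bd(2)]) blast
  interpret P0: prob_space P0 by (rule prob_P0)
  have rm: "r x \<in> borel_measurable P0" and qm: "q x \<in> borel_measurable P0"
    if x: "x \<in> space (iid n P0)" for x
    using measurable_compose[OF measurable_Pair1'[OF x] r(1)] measurable_compose[OF measurable_Pair1'[OF x] q(1)]
    by simp_all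
  \<comment> \<open>Squared Hellinger distance between the two estimates; it is measurable in the
    sample, and its vanishing identifies them.\<close>
  define h where "h x = (\<integral>\<^sup>+y. ennreal ((sqrt (r x y) - sqrt (q x y))\<^sup>2) \<partial>P0)" for x
  have "h \<in> borel_measurable (iid n P0)"
  proof -
    note [measurable] = r(1) q(1)
    show ?thesis unfolding h_def by (rule P0.borel_measurable_nn_integral) measurable
  qed
  then have hm: "h \<in> borel_measurable ?M" using measurable_iid[OF A(1)] by blast
  \<comment> \<open>The factor 2 comes from the bound of a squared sum by twice the sum of squares,
    with the root of the density of \<open>Q\<close> inserted between the two roots.\<close>
  have hle: "h x \<le> 2 * KL (R x) Q + 2 * KL (Phat x) Q" if x: "x \<in> space (iid n P0)" and Q: "Q \<in> \<P>" for x Q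
  proof -
    note [measurable] = rm[OF x] qm[OF x]
    let ?s = "\<lambda>y. sqrt (exp (ld Q (T y)))"
    have "h x \<le> (\<integral>\<^sup>+y. 2 * ennreal ((sqrt (r x y) - ?s y)\<^sup>2) + 2 * ennreal ((sqrt (q x y) - ?s y)\<^sup>2) \<partial>P0)"
      unfolding h_def
    proof (rule nn_integral_mono)
      fix y
      have "(sqrt (r x y) - sqrt (q x y))\<^sup>2 \<le> 2 * (sqrt (r x y) - ?s y)\<^sup>2 + 2 * (sqrt (q x y) - ?s y)\<^sup>2"
        using sum_squares_bound[of "sqrt (r x y) - ?s y" "?s y - sqrt (q x y)"]
        by (simp add: power2_eq_square algebra_simps)
      then have "ennreal ((sqrt (r x y) - sqrt (q x y))\<^sup>2)
        \<le> ennreal (2 * (sqrt (r x y) - ?s y)\<^sup>2 + 2 * (sqrt (q x y) - ?s y)\<^sup>2)" by (rule ennreal_leI)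
      then show "ennreal ((sqrt (r x y) - sqrt (q x y))\<^sup>2)
        \<le> 2 * ennreal ((sqrt (r x y) - ?s y)\<^sup>2) + 2 * ennreal ((sqrt (q x y) - ?s y)\<^sup>2)"
        by (simp add: ennreal_plus ennreal_mult')
    qed
    also have "\<dots> = 2 * (\<integral>\<^sup>+y. ennreal ((sqrt (r x y) - ?s y)\<^sup>2) \<partial>P0)
      + 2 * (\<integral>\<^sup>+y. ennreal ((sqrt (q x y) - ?s y)\<^sup>2) \<partial>P0)"
      by (simp add: nn_integral_add nn_integral_cmult)
    also have "\<dots> \<le> 2 * KL (R x) Q + 2 * KL (Phat x) Q"
      using hellinger_le_KL[OF rm[OF x] r(2) r(3)[OF x] dominatedD(1)[OF estimator_dominated[OF R x]] Q]
        hellinger_le_KL[OF qm[OF x] q(2) q(3)[OF x] dominatedD(1)[OF estimator_dominated[OF bd(2) x]] Q]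
      by (intro add_mono mult_left_mono) auto
    finally show ?thesis .
  qed
  \<comment> \<open>With the selected member as intermediate point, the first integral tends to the
    difference of the two variances and the second to zero.\<close>
  have hN: "(\<integral>\<^sup>+x. h x \<partial>?M) \<le> ennreal (2 * (\<integral>x. yR N x \<partial>?M) + 2 * (\<integral>x. yP N x \<partial>?M))" for N
  proof -
    have "AE x in ?M. h x \<le> ennreal (2 * yR N x + 2 * yP N x) \<and> 0 \<le> 2 * yR N x + 2 * yP N x"
      using yR(2)[of N] yP(2)[of N] AE_space
    proof eventually_elim
      case (elim x)
      then have "x \<in> space (iid n P0)" using space_iid[OF A(1)] by simp
      from hle[OF this p(1)[of "argmax_idx a N (?X x)"]] show ?case
        using elim by (simp add: ennreal_plus ennreal_mult')
    qed
    then have h1: "AE x in ?M. h x \<le> ennreal (2 * yR N x + 2 * yP N x)"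
      and h2: "AE x in ?M. 0 \<le> 2 * yR N x + 2 * yP N x" by (auto elim!: eventually_mono)
    have "(\<integral>\<^sup>+x. h x \<partial>?M) \<le> (\<integral>\<^sup>+x. ennreal (2 * yR N x + 2 * yP N x) \<partial>?M)"
      by (rule nn_integral_mono_AE[OF h1])
    also have "\<dots> = ennreal (\<integral>x. 2 * yR N x + 2 * yP N x \<partial>?M)"
      by (rule nn_integral_eq_integral[OF _ h2]) (use yR(1) yP(1) in auto)
    also have "(\<integral>x. 2 * yR N x + 2 * yP N x \<partial>?M) = 2 * (\<integral>x. yR N x \<partial>?M) + 2 * (\<integral>x. yP N x \<partial>?M)"
      using yR(1) yP(1) by simp
    finally show ?thesis .
  qed
  have "(\<lambda>N. 2 * (\<integral>x. yR N x \<partial>?M) + 2 * (\<integral>x. yP N x \<partial>?M)) \<longlonglongrightarrow>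
    2 * (enn2real (expected_KL n R0 R P) - enn2real (expected_KL n R0 Phat P))
    + 2 * (enn2real (expected_KL n R0 Phat P) - enn2real (expected_KL n R0 Phat P))"
    unfolding yR(3) yP(3) by (intro tendsto_intros lim)
  then have "(\<lambda>N. 2 * (\<integral>x. yR N x \<partial>?M) + 2 * (\<integral>x. yP N x \<partial>?M)) \<longlonglongrightarrow> 0"
    using eq vR(1) vP(1) by simp
  then have "(\<lambda>N. ennreal (2 * (\<integral>x. yR N x \<partial>?M) + 2 * (\<integral>x. yP N x \<partial>?M))) \<longlonglongrightarrow> ennreal 0"
    by (rule tendsto_ennrealI)
  then have "(\<integral>\<^sup>+x. h x \<partial>?M) \<le> ennreal 0" by (rule LIMSEQ_le_const) (use hN in auto)
  then have "AE x in ?M. h x = 0" using hm by (simp add: nn_integral_0_iff_AE)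
  then have "AE x in ?M. R x = Phat x"
    using AE_space
  proof eventually_elim
    case (elim x)
    then have x: "x \<in> space (iid n P0)" using space_iid[OF A(1)] by simp
    note [measurable] = rm[OF x] qm[OF x]
    have "AE y in P0. ennreal ((sqrt (r x y) - sqrt (q x y))\<^sup>2) = 0"
      using elim(1) unfolding h_def by (subst (asm) nn_integral_0_iff_AE) auto
    then have "AE y in P0. ennreal (r x y) = ennreal (q x y)" by eventually_elim simp
    then have "density P0 (r x) = density P0 (q x)" by (intro density_cong) auto
    then show ?case using r(3)[OF x] q(3)[OF x] by simp
  qed
  then show "AE x in iid n lam. R x = Phat x" unfolding AE_iid[OF A(1,3)] .
qed

end

theorem theorem4p2:
  fixes lam :: "'a measure"
    and T :: "'a \<Rightarrow> 'b::euclidean_space"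
    and \<P> :: "'a measure set"
    and n :: nat
    and Phat :: "(nat \<Rightarrow> 'a) \<Rightarrow> 'a measure"
  assumes "sigma_finite_measure lam"
    and "n \<ge> 1"
    and "exponential_family lam T \<P>"
    and "\<forall>P\<in>\<P>. integrable P T"
    and "complete_statistic n T \<P>"
    and "is_MLE n lam T \<P> Phat \<or> is_extended_MLE n lam T \<P> Phat"
  shows "dist_unbiased n T \<P> (admissible n lam T \<P> {Phat}) Phat \<and>
    extended_proj_exists_ae n lam T \<P> Phat \<and>
    (\<forall>R. estimator n lam R \<longrightarrow>
         dist_unbiased n T \<P> (admissible n lam T \<P> {Phat, R}) R \<longrightarrow>
         extended_proj_exists_ae n lam T \<P> R \<longrightarrow>
         (\<forall>R0\<in>admissible n lam T \<P> {Phat, R}.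
            dist_variance n \<P> R0 Phat \<le> dist_variance n \<P> R0 R) \<and>
         (admissible n lam T \<P> {Phat, R} \<noteq> {} \<longrightarrow>
          (\<forall>R0\<in>admissible n lam T \<P> {Phat, R}.
             dist_variance n \<P> R0 R = dist_variance n \<P> R0 Phat) \<longrightarrow>
          (AE x in iid n lam. R x = Phat x)))"
proof -
  obtain P0 where P0: "P0 \<in> dominated lam" "full_support lam P0"
    and fam: "\<forall>P\<in>\<P>. \<exists>\<theta> c. 0 < c \<and> P = density P0 (\<lambda>x. ennreal (c * exp (\<theta> \<bullet> T x)))"
    and sub: "\<P> \<subseteq> dominated lam" and T: "T \<in> borel_measurable lam"
    using assms(3) unfolding exponential_family_def by blast
  obtain th c where tc: "\<And>P. P \<in> \<P> \<Longrightarrow> 0 < c P \<and> P = density P0 (\<lambda>x. ennreal (c P * exp (th P \<bullet> T x)))"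
    using fam by metis
  interpret exp_family lam T \<P> P0 "\<lambda>P. ln (c P)" th
  proof (rule exp_family.intro)
    show "P = density P0 (\<lambda>x. ennreal (exp (ln (c P) + th P \<bullet> T x)))" if "P \<in> \<P>" for P
      using tc[OF that] by (simp add: exp_add)
    show "absolutely_continuous P0 lam" by (rule full_support_imp_ac[OF assms(1) P0])
    show "P \<in> dominated lam" if "P \<in> \<P>" for P using sub that by blast
    show "integrable P T" if "P \<in> \<P>" for P using assms(4) that by blast
  qed (rule assms(1) T P0(1))+
  have "extended_proj_exists_ae n lam T \<P> Phat"
    using MLE_boundary_member(1)[OF assms(6)] unfolding extended_proj_exists_ae_def
    by eventually_elim (blast intro: extended_proj_boundary_member)
  then show ?thesis
    using MLE_dist_unbiased[OF assms(2,6)] MLE_optimal[OF assms(2,5,6)] by blast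
qed

end
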